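(* Let $G$ be a noncompact second countable locally compact Abelian group. For any $\phi\in L^2(G)$, a measurable function $\sigma:\hat G\times G\to[0,1]$ is thin if and only if the operator on $L^2(G)$ $$T_\sigma f=\int_{\hat G\times G}\sigma(p,q)\,\langle f,\phi_{p,q}\rangle\,\phi_{p,q}\;d(\hat\mu\otimes\mu)(p,q)$$ is compact.
   Context: $\mu$ is a Haar measure on $G$, $\hat G$ is the dual group, and $\hat\mu$ is the Haar measure on $\hat G$ for which Plancherel's theorem holds. For $\phi\in L^2(G)$ and $(p,q)\in\hat G\times G$, $\phi_{p,q}(x)=p(q^{-1}x)\,\phi(q^{-1}x)$. The integral defining $T_\sigma$ is understood weakly. Fix a proper (balls are precompact) translation-invariant metric $d$ on $\hat G\times G$ inducing its topology; $(p',q')\to\infty$ means that the $d$-distance from $(p',q')$ to the identity tends to infinity. A function $\sigma$ is thin (with respect to $\phi$) if $$\int_{\hat G\times G}\sigma(p,q)\,|\langle\phi_{p,q},\phi_{p',q'}\rangle|^2\,d(\hat\mu\otimes\mu)(p,q)\to0\quad\text{as }(p',q')\to\infty.$$ *)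

theory Defs
  imports "HOL-Analysis.Analysis"
begin

text \<open>Locally compact Abelian groups are written additively, and so is the dual group.\<close>

typedef (overloaded) 'g pontryagin_dual =
  "{\<xi> :: 'g::topological_ab_group_add \<Rightarrow> complex.
      continuous_on UNIV \<xi> \<and> (\<forall>x y. \<xi> (x + y) = \<xi> x * \<xi> y) \<and> (\<forall>x. cmod (\<xi> x) = 1)}"
  morphisms char_apply Abs_pontryagin_dual
  by (rule exI[of _ "\<lambda>_. 1"]) auto

setup_lifting type_definition_pontryagin_dual

instantiation pontryagin_dual :: (topological_ab_group_add) ab_group_add
begin

lift_definition zero_pontryagin_dual :: "'a pontryagin_dual" is "\<lambda>_. 1"
  by auto

lift_definition plus_pontryagin_dual ::
    "'a pontryagin_dual \<Rightarrow> 'a pontryagin_dual \<Rightarrow> 'a pontryagin_dual"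
  is "\<lambda>\<xi> \<psi> x. \<xi> x * \<psi> x"
  by (auto intro!: continuous_intros simp: norm_mult)

lift_definition uminus_pontryagin_dual :: "'a pontryagin_dual \<Rightarrow> 'a pontryagin_dual"
  is "\<lambda>\<xi> x. cnj (\<xi> x)"
  by (auto intro!: continuous_intros)

definition minus_pontryagin_dual ::
    "'a pontryagin_dual \<Rightarrow> 'a pontryagin_dual \<Rightarrow> 'a pontryagin_dual" where
  "minus_pontryagin_dual \<xi> \<psi> = \<xi> + - \<psi>"

instance
proof
  fix a b c :: "'a pontryagin_dual"
  show "a + b + c = a + (b + c)" by transfer (auto simp: mult.assoc)
  show "a + b = b + a" by transfer (auto simp: mult.commute)
  show "0 + a = a" by transfer auto
  show "- a + a = 0"
    by transfer (auto simp: fun_eq_iff mult.commute complex_norm_square[symmetric])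
  show "a - b = a + - b" by (rule minus_pontryagin_dual_def)
qed

end

text \<open>The compact-open topology.\<close>

instantiation pontryagin_dual :: (topological_ab_group_add) topological_space
begin

definition open_pontryagin_dual :: "'a pontryagin_dual set \<Rightarrow> bool" where
  "open_pontryagin_dual =
     generate_topology {{\<xi>. char_apply \<xi> ` K \<subseteq> U} | K U. compact K \<and> open U}"

instance
proof
  show "open (UNIV :: 'a pontryagin_dual set)"
    unfolding open_pontryagin_dual_def by (rule generate_topology.UNIV)
next
  fix S T :: "'a pontryagin_dual set"
  assume "open S" "open T"
  then show "open (S \<inter> T)"
    unfolding open_pontryagin_dual_def by (rule generate_topology.Int)
next
  fix K :: "'a pontryagin_dual set set"
  assume "\<forall>S\<in>K. open S"
  then show "open (\<Union>K)"
    unfolding open_pontryagin_dual_def by (auto intro: generate_topology.UN)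
qed

end

text \<open>A Haar measure is a nonzero translation-invariant Radon measure on the Borel sets.\<close>

definition haar_measure :: "'a::{ab_group_add, topological_space} measure \<Rightarrow> bool" where
  "haar_measure M \<longleftrightarrow>
     sets M = sets borel \<and>
     emeasure M UNIV \<noteq> 0 \<and>
     (\<forall>a. \<forall>A\<in>sets borel. emeasure M ((+) a ` A) = emeasure M A) \<and>
     (\<forall>K. compact K \<longrightarrow> emeasure M K < \<infinity>) \<and>
     (\<forall>A\<in>sets borel. emeasure M A = (INF U\<in>{U. open U \<and> A \<subseteq> U}. emeasure M U)) \<and>
     (\<forall>U. open U \<longrightarrow> emeasure M U = (SUP K\<in>{K. compact K \<and> K \<subseteq> U}. emeasure M K))"

definition square_integrable :: "'a measure \<Rightarrow> ('a \<Rightarrow> complex) \<Rightarrow> bool" where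
  "square_integrable M f \<longleftrightarrow>
     f \<in> borel_measurable M \<and> integrable M (\<lambda>x. (cmod (f x))\<^sup>2)"

definition fourier ::
    "'g::topological_ab_group_add measure \<Rightarrow> ('g \<Rightarrow> complex) \<Rightarrow> 'g pontryagin_dual \<Rightarrow> complex" where
  "fourier M f \<xi> = (LINT x|M. f x * cnj (char_apply \<xi> x))"

text \<open>
  Among the Haar measures on the dual group, which differ by a positive factor, the isometry
  on the intersection of L1 and L2 singles out the Plancherel measure.
\<close>

definition plancherel_measure ::
    "'g::topological_ab_group_add measure \<Rightarrow> 'g pontryagin_dual measure \<Rightarrow> bool" where
  "plancherel_measure M N \<longleftrightarrow>
     haar_measure N \<and>
     (\<forall>f. integrable M f \<and> square_integrable M f \<longrightarrow>
        (\<integral>\<^sup>+ \<xi>. ennreal ((cmod (fourier M f \<xi>))\<^sup>2) \<partial>N) = (\<integral>\<^sup>+ x. ennreal ((cmod (f x))\<^sup>2) \<partial>M))"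

text \<open>
  Elements of the Hilbert space L2 are classes of square-integrable functions modulo equality
  almost everywhere. The operations below are computed on arbitrarily chosen representatives;
  none of them depends on the choice.
\<close>

type_synonym 'a l2 = "('a \<Rightarrow> complex) set"

definition L2_class :: "'a measure \<Rightarrow> ('a \<Rightarrow> complex) \<Rightarrow> 'a l2" where
  "L2_class M f = {g. square_integrable M g \<and> (AE x in M. g x = f x)}"

definition L2 :: "'a measure \<Rightarrow> 'a l2 set" where
  "L2 M = L2_class M ` {f. square_integrable M f}"

definition L2_rep :: "'a l2 \<Rightarrow> 'a \<Rightarrow> complex" where
  "L2_rep u = (SOME f. f \<in> u)"

definition L2_add :: "'a measure \<Rightarrow> 'a l2 \<Rightarrow> 'a l2 \<Rightarrow> 'a l2" where
  "L2_add M u v = L2_class M (\<lambda>x. L2_rep u x + L2_rep v x)"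

definition L2_scale :: "'a measure \<Rightarrow> complex \<Rightarrow> 'a l2 \<Rightarrow> 'a l2" where
  "L2_scale M c u = L2_class M (\<lambda>x. c * L2_rep u x)"

definition L2_inner :: "'a measure \<Rightarrow> 'a l2 \<Rightarrow> 'a l2 \<Rightarrow> complex" where
  "L2_inner M u v = (LINT x|M. L2_rep u x * cnj (L2_rep v x))"

definition L2_norm :: "'a measure \<Rightarrow> 'a l2 \<Rightarrow> real" where
  "L2_norm M u = sqrt (LINT x|M. (cmod (L2_rep u x))\<^sup>2)"

definition L2_dist :: "'a measure \<Rightarrow> 'a l2 \<Rightarrow> 'a l2 \<Rightarrow> real" where
  "L2_dist M u v = sqrt (LINT x|M. (cmod (L2_rep u x - L2_rep v x))\<^sup>2)"

abbreviation L2_topology :: "'a measure \<Rightarrow> 'a l2 topology" where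
  "L2_topology M \<equiv> Metric_space.mtopology (L2 M) (L2_dist M)"

definition L2_linear :: "'a measure \<Rightarrow> ('a l2 \<Rightarrow> 'a l2) \<Rightarrow> bool" where
  "L2_linear M T \<longleftrightarrow>
     (\<forall>u\<in>L2 M. T u \<in> L2 M) \<and>
     (\<forall>u\<in>L2 M. \<forall>v\<in>L2 M. T (L2_add M u v) = L2_add M (T u) (T v)) \<and>
     (\<forall>c. \<forall>u\<in>L2 M. T (L2_scale M c u) = L2_scale M c (T u))"

definition compact_operator :: "'a measure \<Rightarrow> ('a l2 \<Rightarrow> 'a l2) \<Rightarrow> bool" where
  "compact_operator M T \<longleftrightarrow>
     L2_linear M T \<and>
     compactin (L2_topology M)
       (L2_topology M closure_of (T ` {u \<in> L2 M. L2_norm M u \<le> 1}))"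

definition tf_shift ::
    "'g::topological_ab_group_add measure \<Rightarrow> 'g l2 \<Rightarrow> 'g pontryagin_dual \<times> 'g \<Rightarrow> 'g l2" where
  "tf_shift M \<phi> = (\<lambda>(p, q). L2_class M (\<lambda>x. char_apply p (x - q) * L2_rep \<phi> (x - q)))"

definition localization_operator ::
    "'g::topological_ab_group_add measure \<Rightarrow> 'g pontryagin_dual measure \<Rightarrow> 'g l2 \<Rightarrow>
     ('g pontryagin_dual \<times> 'g \<Rightarrow> real) \<Rightarrow> 'g l2 \<Rightarrow> 'g l2" where
  "localization_operator M N \<phi> \<sigma> f =
     (THE h. h \<in> L2 M \<and>
        (\<forall>g\<in>L2 M. has_bochner_integral (N \<Otimes>\<^sub>M M)
           (\<lambda>z. of_real (\<sigma> z) * L2_inner M f (tf_shift M \<phi> z) * L2_inner M (tf_shift M \<phi> z) g)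
           (L2_inner M h g)))"

definition proper_invariant_metric ::
    "('a::{ab_group_add, topological_space} \<Rightarrow> 'a \<Rightarrow> real) \<Rightarrow> bool" where
  "proper_invariant_metric d \<longleftrightarrow>
     Metric_space UNIV d \<and>
     Metric_space.mtopology UNIV d = euclidean \<and>
     (\<forall>x y a. d (a + x) (a + y) = d x y) \<and>
     (\<forall>x r. compact (closure (Metric_space.mball UNIV d x r)))"

text \<open>
  The integrand is nonnegative, so its integral is taken in the extended nonnegative reals;
  no value is assigned by default to a divergent integral.
\<close>

definition thin ::
    "'g::topological_ab_group_add measure \<Rightarrow> 'g pontryagin_dual measure \<Rightarrow>
     ('g pontryagin_dual \<times> 'g \<Rightarrow> 'g pontryagin_dual \<times> 'g \<Rightarrow> real) \<Rightarrow> 'g l2 \<Rightarrow>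
     ('g pontryagin_dual \<times> 'g \<Rightarrow> real) \<Rightarrow> bool" where
  "thin M N d \<phi> \<sigma> \<longleftrightarrow>
     ((\<lambda>w. \<integral>\<^sup>+ z. ennreal (\<sigma> z * (cmod (L2_inner M (tf_shift M \<phi> z) (tf_shift M \<phi> w)))\<^sup>2)
             \<partial>(N \<Otimes>\<^sub>M M)) \<longlongrightarrow> 0)
       (filtercomap (\<lambda>w. d w 0) at_top)"

end

theory Submission
  imports Defs "HOL-Complex_Analysis.Great_Picard"
begin

text \<open>
  Write \<open>V f z\<close> for the inner product of \<open>f\<close> with the time-frequency shift \<open>\<phi>\<^sub>z\<close>. Plancherel's
  theorem gives the Moyal identity: the L2 norm of \<open>V f\<close> is the product of the norms of
  \<open>f\<close> and \<open>\<phi>\<close>. Let \<open>F w\<close> be the integral that defines thinness; it equals the inner product of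
  \<open>T \<phi>\<^sub>w\<close> with \<open>\<phi>\<^sub>w\<close>.

  If \<open>T\<close> is compact then \<open>F\<close> vanishes at infinity, because \<open>\<phi>\<^sub>w\<close> tends weakly to 0: \<open>V h\<close> is
  square integrable and its absolute value is uniformly continuous.

  For the converse, \<open>|V f w|\<close> is at most \<open>|V f (w + z)|\<close> plus a term whose L2 norm in \<open>w\<close> is
  at most the norm of \<open>f\<close> times the norm of \<open>\<phi> - \<phi>\<^sub>z\<close>. Average this over \<open>z\<close> in a small
  neighbourhood of 0, on which the inner product of \<open>\<phi>\<close> with \<open>\<phi>\<^sub>z\<close> stays away from 0. The
  integral of \<open>\<sigma> |V f|\<^sup>2\<close> is thereby bounded by a small multiple of the squared norm of \<open>f\<close>
  plus a constant times the integral of \<open>F |V f|\<^sup>2\<close>. A bounded sequence has a subsequence along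
  which \<open>V f\<close> converges pointwise. When \<open>F\<close> vanishes at infinity, the last integral tends to 0
  for the differences of members of this subsequence: on compact sets by dominated convergence,
  elsewhere by the smallness of \<open>F\<close>.
\<close>

section \<open>Square-integrable functions\<close>

text \<open>Thinness speaks only of inner products between shifts of \<phi>, compactness of
  arbitrary f. One double integral links them, that of \<sigma>(w) |<\<phi>_w, \<phi>_v>|^2 |V
  f(v)|^2. Integrated over w first, it gives F(v) |V f(v)|^2. With v = w + z the middle factor
  depends on z alone, so near z = 0 the inner integral dominates, up to a constant, \<sigma>(w)
  times a local average of |V f|^2 around w. The integral of \<sigma> |V f|^2 is the quantity to
  make small because \<sigma>^2 \<le> \<sigma>: Cauchy-Schwarz and Moyal then bound the norm of T f
  by its square root times the norm of \<phi>. The neighbourhood is fixed by the tolerance before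
  the subsequence enters, so its measure is a mere constant. Two substitutes shape the rest.
  Convergence of V f on a countable dense set, spread by equicontinuity, takes the place of weak
  compactness of the unit ball. And since the dual group is given as a bare topological space with
  an addition, the metric d supplies continuity of its translations, the exhaustion by compact sets
  and sigma-finiteness.\<close>

definition l2_ip :: "'a measure \<Rightarrow> ('a \<Rightarrow> complex) \<Rightarrow> ('a \<Rightarrow> complex) \<Rightarrow> complex" where
  "l2_ip M f g = (LINT x|M. f x * cnj (g x))"

definition l2_nrm :: "'a measure \<Rightarrow> ('a \<Rightarrow> complex) \<Rightarrow> real" where
  "l2_nrm M f = sqrt (LINT x|M. (cmod (f x))\<^sup>2)"

lemma borel_measurable_cnj [measurable (raw)]:
  "f \<in> borel_measurable M \<Longrightarrow> (\<lambda>x. cnj (f x)) \<in> borel_measurable M"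
  by (rule borel_measurable_continuous_on[OF continuous_on_cnj[OF continuous_on_id]])

lemma square_integrable_measurable [measurable_dest]:
  "square_integrable M f \<Longrightarrow> f \<in> borel_measurable M"
  by (simp add: square_integrable_def)

lemma square_integrable_iff_nn:
  "square_integrable M f \<longleftrightarrow>
     f \<in> borel_measurable M \<and> (\<integral>\<^sup>+x. ennreal ((cmod (f x))\<^sup>2) \<partial>M) < \<infinity>"
  unfolding square_integrable_def integrable_iff_bounded by (auto intro: borel_measurable_power)

lemma cmod_add_sq: "(cmod (a + b))\<^sup>2 \<le> 2 * (cmod a)\<^sup>2 + 2 * (cmod b)\<^sup>2"
proof -
  have "(cmod (a + b))\<^sup>2 \<le> (cmod a + cmod b)\<^sup>2"
    by (simp add: norm_triangle_ineq power_mono)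
  also have "\<dots> \<le> 2 * (cmod a)\<^sup>2 + 2 * (cmod b)\<^sup>2"
    using zero_le_power2[of "cmod a - cmod b"] by (simp add: power2_eq_square algebra_simps)
  finally show ?thesis .
qed

lemma square_integrable_add:
  assumes [measurable]: "square_integrable M f" "square_integrable M g"
  shows "square_integrable M (\<lambda>x. f x + g x)"
  unfolding square_integrable_def
proof
  show "integrable M (\<lambda>x. (cmod (f x + g x))\<^sup>2)"
  proof (rule Bochner_Integration.integrable_bound)
    show "integrable M (\<lambda>x. 2 * (cmod (f x))\<^sup>2 + 2 * (cmod (g x))\<^sup>2)"
      using assms by (simp add: square_integrable_def)
    show "AE x in M. norm ((cmod (f x + g x))\<^sup>2) \<le> norm (2 * (cmod (f x))\<^sup>2 + 2 * (cmod (g x))\<^sup>2)"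
      by (intro AE_I2) (simp add: cmod_add_sq abs_of_nonneg)
  qed measurable
qed measurable

lemma square_integrable_scale:
  assumes [measurable]: "square_integrable M f"
  shows "square_integrable M (\<lambda>x. c * f x)"
  using assms by (auto simp: square_integrable_def norm_mult power_mult_distrib)

lemma square_integrable_diff:
  assumes "square_integrable M f" "square_integrable M g"
  shows "square_integrable M (\<lambda>x. f x - g x)"
  using square_integrable_add[OF assms(1) square_integrable_scale[OF assms(2), of "-1"]] by simp

lemma square_integrable_zero: "square_integrable M (\<lambda>x. 0)"
  by (simp add: square_integrable_def)

lemma square_integrable_prod:
  assumes [measurable]: "square_integrable M f" "square_integrable M g"
  shows "integrable M (\<lambda>x. cmod (f x) * cmod (g x))" "integrable M (\<lambda>x. f x * cnj (g x))"
proof -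
  have *: "cmod (f x) * cmod (g x) \<le> (cmod (f x))\<^sup>2 + (cmod (g x))\<^sup>2" for x
  proof -
    have "2 * (cmod (f x) * cmod (g x)) \<le> (cmod (f x))\<^sup>2 + (cmod (g x))\<^sup>2"
      using zero_le_power2[of "cmod (f x) - cmod (g x)"] by (simp add: power2_eq_square algebra_simps)
    moreover have "0 \<le> cmod (f x) * cmod (g x)" by simp
    ultimately show ?thesis by linarith
  qed
  have int: "integrable M (\<lambda>x. (cmod (f x))\<^sup>2 + (cmod (g x))\<^sup>2)"
    using assms by (simp add: square_integrable_def)
  show "integrable M (\<lambda>x. cmod (f x) * cmod (g x))"
    by (rule Bochner_Integration.integrable_bound[OF int])
      (measurable, intro AE_I2, insert *, simp add: abs_of_nonneg)
  show "integrable M (\<lambda>x. f x * cnj (g x))"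
  proof (rule Bochner_Integration.integrable_bound[OF int])
    show "(\<lambda>x. f x * cnj (g x)) \<in> borel_measurable M" by measurable
  qed (intro AE_I2, insert *, simp add: abs_of_nonneg norm_mult)
qed

lemma l2_nrm_nonneg [simp]: "0 \<le> l2_nrm M f"
  by (simp add: l2_nrm_def)

lemma l2_nrm_sq: "(l2_nrm M f)\<^sup>2 = (LINT x|M. (cmod (f x))\<^sup>2)"
  by (simp add: l2_nrm_def)

lemma nn_integral_sq_eq:
  "square_integrable M f \<Longrightarrow> (\<integral>\<^sup>+x. ennreal ((cmod (f x))\<^sup>2) \<partial>M) = ennreal ((l2_nrm M f)\<^sup>2)"
  unfolding l2_nrm_sq square_integrable_def by (intro nn_integral_eq_integral) auto

lemma l2_ip_self: "l2_ip M f f = of_real ((l2_nrm M f)\<^sup>2)"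
proof -
  have "f x * cnj (f x) = complex_of_real ((cmod (f x))\<^sup>2)" for x
    by (simp only: complex_norm_square)
  then show ?thesis unfolding l2_nrm_sq l2_ip_def by (simp del: of_real_power)
qed

lemma l2_ip_cnj: "cnj (l2_ip M f g) = l2_ip M g f"
  unfolding l2_ip_def by (subst Bochner_Integration.integral_cnj[symmetric]) (simp add: mult.commute)

lemma l2_ip_CS:
  assumes [measurable]: "square_integrable M f" "square_integrable M g"
  shows "cmod (l2_ip M f g) \<le> l2_nrm M f * l2_nrm M g"
proof -
  define I where "I = (LINT x|M. cmod (f x) * cmod (g x))"
  have I0: "0 \<le> I" unfolding I_def by (intro integral_nonneg_AE) simp
  have "ennreal I = (\<integral>\<^sup>+x. ennreal (cmod (f x) * cmod (g x)) \<partial>M)"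
    unfolding I_def using square_integrable_prod(1)[OF assms]
    by (intro nn_integral_eq_integral[symmetric]) auto
  also have "\<dots> = (\<integral>\<^sup>+x. ennreal (cmod (f x)) * ennreal (cmod (g x)) \<partial>M)"
    by (simp add: ennreal_mult)
  finally have "(ennreal I)\<^sup>2 \<le> (\<integral>\<^sup>+x. (ennreal (cmod (f x)))\<^sup>2 \<partial>M) * (\<integral>\<^sup>+x. (ennreal (cmod (g x)))\<^sup>2 \<partial>M)"
    using Cauchy_Schwarz_nn_integral[of "\<lambda>x. ennreal (cmod (f x))" M "\<lambda>x. ennreal (cmod (g x))"] by simp
  also have "\<dots> = ennreal ((l2_nrm M f)\<^sup>2) * ennreal ((l2_nrm M g)\<^sup>2)"
    using nn_integral_sq_eq[OF assms(1)] nn_integral_sq_eq[OF assms(2)] by (simp add: ennreal_power)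
  finally have "ennreal (I\<^sup>2) \<le> ennreal ((l2_nrm M f * l2_nrm M g)\<^sup>2)"
    using I0 by (simp add: ennreal_power ennreal_mult power_mult_distrib)
  then have "I\<^sup>2 \<le> (l2_nrm M f * l2_nrm M g)\<^sup>2" by (simp add: ennreal_le_iff)
  then have "I \<le> l2_nrm M f * l2_nrm M g" by (rule power2_le_imp_le) simp
  moreover have "cmod (l2_ip M f g) \<le> I"
    unfolding l2_ip_def I_def using integral_norm_bound[of M "\<lambda>x. f x * cnj (g x)"]
    by (simp add: norm_mult)
  ultimately show ?thesis by linarith
qed

lemma l2_ip_add_left:
  assumes "square_integrable M f" "square_integrable M g" "square_integrable M h"
  shows "l2_ip M (\<lambda>x. f x + g x) h = l2_ip M f h + l2_ip M g h"
  unfolding l2_ip_def using square_integrable_prod(2)[OF assms(1,3)] square_integrable_prod(2)[OF assms(2,3)]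
  by (simp add: distrib_right)

lemma l2_ip_diff_left:
  assumes "square_integrable M f" "square_integrable M g" "square_integrable M h"
  shows "l2_ip M (\<lambda>x. f x - g x) h = l2_ip M f h - l2_ip M g h"
  unfolding l2_ip_def using square_integrable_prod(2)[OF assms(1,3)] square_integrable_prod(2)[OF assms(2,3)]
  by (simp add: left_diff_distrib)

lemma l2_ip_scale_left: "l2_ip M (\<lambda>x. c * f x) h = c * l2_ip M f h"
  unfolding l2_ip_def by (simp add: mult.assoc)

lemma l2_ip_add_right:
  assumes "square_integrable M f" "square_integrable M g" "square_integrable M h"
  shows "l2_ip M h (\<lambda>x. f x + g x) = l2_ip M h f + l2_ip M h g"
  using arg_cong[OF l2_ip_add_left[OF assms], of cnj] by (simp add: l2_ip_cnj)

lemma l2_ip_diff_right: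
  assumes "square_integrable M f" "square_integrable M g" "square_integrable M h"
  shows "l2_ip M h (\<lambda>x. f x - g x) = l2_ip M h f - l2_ip M h g"
  using arg_cong[OF l2_ip_diff_left[OF assms], of cnj] by (simp add: l2_ip_cnj)

lemma l2_ip_scale_right: "l2_ip M h (\<lambda>x. c * f x) = cnj c * l2_ip M h f"
  using arg_cong[OF l2_ip_scale_left[of M c f h], of cnj] by (simp add: l2_ip_cnj)

lemma l2_nrm_scale: "l2_nrm M (\<lambda>x. c * f x) = cmod c * l2_nrm M f"
  unfolding l2_nrm_def by (simp add: norm_mult power_mult_distrib real_sqrt_mult)

lemma l2_nrm_add_sq:
  assumes "square_integrable M f" "square_integrable M g"
  shows "(l2_nrm M (\<lambda>x. f x + g x))\<^sup>2 = (l2_nrm M f)\<^sup>2 + (l2_nrm M g)\<^sup>2 + 2 * Re (l2_ip M f g)"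
proof -
  have "complex_of_real ((l2_nrm M (\<lambda>x. f x + g x))\<^sup>2)
      = l2_ip M f f + l2_ip M f g + (l2_ip M g f + l2_ip M g g)"
    unfolding l2_ip_self[symmetric]
    using assms by (simp add: l2_ip_add_left l2_ip_add_right square_integrable_add)
  then have "(l2_nrm M (\<lambda>x. f x + g x))\<^sup>2 = Re (l2_ip M f f + l2_ip M f g + (l2_ip M g f + l2_ip M g g))"
    by (metis Re_complex_of_real)
  also have "Re (l2_ip M g f) = Re (l2_ip M f g)" by (subst l2_ip_cnj[symmetric]) simp
  then have "Re (l2_ip M f f + l2_ip M f g + (l2_ip M g f + l2_ip M g g))
     = (l2_nrm M f)\<^sup>2 + (l2_nrm M g)\<^sup>2 + 2 * Re (l2_ip M f g)"
    by (simp add: l2_ip_self del: of_real_power)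
  finally show ?thesis .
qed

lemma l2_nrm_diff_sq:
  assumes "square_integrable M f" "square_integrable M g"
  shows "(l2_nrm M (\<lambda>x. f x - g x))\<^sup>2 = (l2_nrm M f)\<^sup>2 + (l2_nrm M g)\<^sup>2 - 2 * Re (l2_ip M f g)"
  using l2_nrm_add_sq[OF assms(1) square_integrable_scale[OF assms(2), of "-1"]]
    l2_ip_scale_right[of M f "-1" g] l2_nrm_scale[of M "-1" g] by simp

lemma l2_nrm_triangle:
  assumes "square_integrable M f" "square_integrable M g"
  shows "l2_nrm M (\<lambda>x. f x + g x) \<le> l2_nrm M f + l2_nrm M g"
proof (rule power2_le_imp_le)
  have "Re (l2_ip M f g) \<le> l2_nrm M f * l2_nrm M g"
    using l2_ip_CS[OF assms] complex_Re_le_cmod order_trans by blast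
  then show "(l2_nrm M (\<lambda>x. f x + g x))\<^sup>2 \<le> (l2_nrm M f + l2_nrm M g)\<^sup>2"
    unfolding l2_nrm_add_sq[OF assms] by (simp add: power2_sum)
qed simp

lemma l2_nrm_minus_commute: "l2_nrm M (\<lambda>x. f x - g x) = l2_nrm M (\<lambda>x. g x - f x)"
  unfolding l2_nrm_def by (simp add: norm_minus_commute)

lemma l2_dist_triangle:
  assumes "square_integrable M f" "square_integrable M g" "square_integrable M h"
  shows "l2_nrm M (\<lambda>x. f x - h x) \<le> l2_nrm M (\<lambda>x. f x - g x) + l2_nrm M (\<lambda>x. g x - h x)"
  using l2_nrm_triangle[OF square_integrable_diff[OF assms(1,2)] square_integrable_diff[OF assms(2,3)]]
  by simp

lemma l2_nrm_eq_0_iff: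
  assumes "square_integrable M f"
  shows "l2_nrm M f = 0 \<longleftrightarrow> (AE x in M. f x = 0)"
  using assms integral_nonneg_eq_0_iff_AE[of M "\<lambda>x. (cmod (f x))\<^sup>2"]
  by (simp add: l2_nrm_def square_integrable_def)

lemma l2_ip_cong_AE:
  assumes "AE x in M. f x = f' x" "AE x in M. g x = g' x"
    "f \<in> borel_measurable M" "f' \<in> borel_measurable M" "g \<in> borel_measurable M" "g' \<in> borel_measurable M"
  shows "l2_ip M f g = l2_ip M f' g'"
  unfolding l2_ip_def using assms by (intro integral_cong_AE) auto

lemma l2_nrm_cong_AE:
  assumes "AE x in M. f x = f' x" "f \<in> borel_measurable M" "f' \<in> borel_measurable M"
  shows "l2_nrm M f = l2_nrm M f'"
  unfolding l2_nrm_def using assms by (intro arg_cong[where f=sqrt] integral_cong_AE) auto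

text \<open>The map a -> a |a| is strongly monotone: its increment has real inner product at least
  (|a| + |b|) |a - b|^2 / 2 with a - b, and |a - b| \<le> |a| + |b|. The inequality transfers
  continuity of translation from L1 to L2, because \<phi> |\<phi>| is integrable when \<phi> is
  square integrable.\<close>

lemma cmod_diff_sq_le:
  "(cmod (a - b))\<^sup>2 \<le> 2 * cmod (a * of_real (cmod a) - b * of_real (cmod b))"
proof (cases "a = b")
  case False
  define s t R where "s = cmod a" and "t = cmod b" and "R = Re (a * cnj b)"
  define c where "c = a * of_real s - b * of_real t"
  have nn: "0 \<le> s" "0 \<le> t" by (auto simp: s_def t_def)
  have sq: "Re (a * cnj a) = s\<^sup>2" "Re (b * cnj b) = t\<^sup>2" "Re (b * cnj a) = R"
    by (simp_all only: complex_norm_square[symmetric] Re_complex_of_real s_def t_def)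
      (simp add: R_def mult.commute)
  have D: "(cmod (a - b))\<^sup>2 = s\<^sup>2 + t\<^sup>2 - 2 * R"
    by (simp add: s_def t_def R_def cmod_power2) (simp add: power2_eq_square algebra_simps)
  have "Re (c * cnj (a - b)) = s * s\<^sup>2 + t * t\<^sup>2 - (s + t) * R"
    unfolding c_def sq[symmetric] R_def by (simp add: algebra_simps)
  also have "\<dots> = (s + t) * (s\<^sup>2 + t\<^sup>2 - 2 * R) / 2 + (s + t) * (s - t)\<^sup>2 / 2"
    by (simp add: power2_eq_square field_simps)
  finally have "(s + t) * (cmod (a - b))\<^sup>2 / 2 \<le> Re (c * cnj (a - b))" using nn by (simp add: D)
  also have "\<dots> \<le> cmod c * cmod (a - b)" by (metis complex_Re_le_cmod complex_mod_cnj norm_mult)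
  finally have *: "(s + t) * (cmod (a - b))\<^sup>2 / 2 \<le> cmod c * cmod (a - b)" .
  have pos: "cmod (a - b) > 0" using False by simp
  have "cmod (a - b) \<le> s + t" unfolding s_def t_def by (rule norm_triangle_ineq4)
  then have "cmod (a - b) * (cmod (a - b))\<^sup>2 / 2 \<le> (s + t) * (cmod (a - b))\<^sup>2 / 2"
    by (intro divide_right_mono mult_right_mono) auto
  with * have "cmod (a - b) * (cmod (a - b))\<^sup>2 / 2 \<le> cmod c * cmod (a - b)" by linarith
  then have "cmod (a - b) * (cmod (a - b))\<^sup>2 \<le> cmod (a - b) * (2 * cmod c)" by (simp add: mult.commute mult.left_commute)
  then show ?thesis using pos by (simp add: c_def s_def t_def)
qed simp

section \<open>Completeness and the Riesz representation\<close>

lemma l2_complete: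
  assumes sq: "\<And>n. square_integrable M (f n)"
    and Cauchy: "\<And>e. e > 0 \<Longrightarrow> \<exists>N. \<forall>m\<ge>N. \<forall>n\<ge>N. l2_nrm M (\<lambda>x. f m x - f n x) < e"
  obtains g where "square_integrable M g" "(\<lambda>n. l2_nrm M (\<lambda>x. f n x - g x)) \<longlonglongrightarrow> 0"
proof -
  have [measurable]: "f n \<in> borel_measurable M" for n
    using sq by (simp add: square_integrable_def)
  have "\<forall>i. \<exists>N. \<forall>m\<ge>N. \<forall>n\<ge>N. l2_nrm M (\<lambda>x. f m x - f n x) < (1/4::real)^i"
    using Cauchy by simp
  then obtain Nf where Nf: "\<And>i m n. m \<ge> Nf i \<Longrightarrow> n \<ge> Nf i \<Longrightarrow> l2_nrm M (\<lambda>x. f m x - f n x) < (1/4::real)^i"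
    by metis
  \<comment> \<open>Partial sums of \<open>Nf\<close> give a monotone index that is at least
    \<open>Nf j\<close> for every j \<le> i.\<close>
  define k where "k i = (\<Sum>j\<le>i. Nf j)" for i
  have k_ge: "Nf j \<le> k i" if "j \<le> i" for i j
    unfolding k_def using that by (intro member_le_sum) auto
  define d where "d i x = f (k (Suc i)) x - f (k i) x" for i x
  have [measurable]: "d i \<in> borel_measurable M" for i unfolding d_def by measurable
  have d_sq: "square_integrable M (d i)" for i
    unfolding d_def using sq by (intro square_integrable_diff)
  have d_nrm: "l2_nrm M (d i) \<le> (1/4)^i" for i
    unfolding d_def using k_ge[of i "Suc i"] k_ge[of i i] Nf by (intro less_imp_le) auto
  \<comment> \<open>The weight 2^i is small enough to keep the integrals summable, since 2/16 = 1/8,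
    and large enough to recover absolute convergence from square convergence by t \<le> 1/a + a t^2
    with a = 2^i.\<close>
  have d_int: "(\<integral>\<^sup>+x. ennreal (2^i * (cmod (d i x))\<^sup>2) \<partial>M) \<le> ennreal ((1/8)^i)" for i
  proof -
    have "(\<integral>\<^sup>+x. ennreal (2^i * (cmod (d i x))\<^sup>2) \<partial>M) = ennreal (2^i) * (\<integral>\<^sup>+x. ennreal ((cmod (d i x))\<^sup>2) \<partial>M)"
      by (subst nn_integral_cmult[symmetric]) (auto simp: ennreal_mult)
    also have "\<dots> = ennreal (2^i * (l2_nrm M (d i))\<^sup>2)"
      by (simp add: nn_integral_sq_eq[OF d_sq] ennreal_mult)
    also have "\<dots> \<le> ennreal (2^i * ((1/4)^i)\<^sup>2)"
      using d_nrm[of i] by (intro ennreal_leI mult_left_mono power_mono) auto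
    also have "2^i * ((1/4)^i)\<^sup>2 = (1/8::real)^i"
      by (simp add: power2_eq_square power_mult_distrib[symmetric])
    finally show ?thesis .
  qed
  have "(\<integral>\<^sup>+x. (\<Sum>i. ennreal (2^i * (cmod (d i x))\<^sup>2)) \<partial>M) = (\<Sum>i. \<integral>\<^sup>+x. ennreal (2^i * (cmod (d i x))\<^sup>2) \<partial>M)"
    by (rule nn_integral_suminf) measurable
  also have "\<dots> \<le> (\<Sum>i. ennreal ((1/8)^i))"
    by (intro suminf_le d_int) auto
  also have "\<dots> = ennreal (\<Sum>i. (1/8)^i)"
    by (intro suminf_ennreal2) (auto intro: summable_geometric)
  also have "\<dots> < \<infinity>" by simp
  finally have fin: "(\<integral>\<^sup>+x. (\<Sum>i. ennreal (2^i * (cmod (d i x))\<^sup>2)) \<partial>M) \<noteq> \<infinity>" by simp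
  have "AE x in M. (\<Sum>i. ennreal (2^i * (cmod (d i x))\<^sup>2)) \<noteq> \<infinity>"
    by (rule nn_integral_noteq_infinite[OF _ fin]) measurable
  then have conv: "AE x in M. convergent (\<lambda>i. f (k i) x)"
  proof eventually_elim
    case (elim x)
    have s1: "summable (\<lambda>i. 2^i * (cmod (d i x))\<^sup>2)"
      by (rule summable_suminf_not_top) (use elim in auto)
    have "summable (\<lambda>i. (1/2::real)^i + 2^i * (cmod (d i x))\<^sup>2)"
      by (intro summable_add s1 summable_geometric) auto
    moreover have "norm (d i x) \<le> (1/2::real)^i + 2^i * (cmod (d i x))\<^sup>2" for i
    proof -
      define a where "a = (2::real)^i"
      define t where "t = cmod (d i x)"
      have a: "a > 0" "(1/2::real)^i = 1/a" by (auto simp: a_def power_one_over)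
      have "0 \<le> (a*t - 1)\<^sup>2 + a*t" using a by (simp add: t_def)
      then have "a * t \<le> 1 + a\<^sup>2 * t\<^sup>2" by (simp add: power2_eq_square algebra_simps)
      then have "t \<le> 1/a + a * t\<^sup>2" using a by (simp add: field_simps power2_eq_square)
      then show ?thesis using a by (simp add: t_def a_def)
    qed
    ultimately have "summable (\<lambda>i. d i x)"
      by (rule summable_comparison_test'[where N=0])
    then have "convergent (\<lambda>n. \<Sum>i<n. d i x)" by (simp add: summable_iff_convergent)
    then have "convergent (\<lambda>n. f (k 0) x + (\<Sum>i<n. d i x))"
      by (intro convergent_add convergent_const)
    moreover have "f (k 0) x + (\<Sum>i<n. d i x) = f (k n) x" for n
      unfolding d_def by (simp add: sum_lessThan_telescope[where f="\<lambda>i. f (k i) x"])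
    ultimately show ?case by simp
  qed
  define g where "g x = lim (\<lambda>i. f (k i) x)" for x
  have [measurable]: "g \<in> borel_measurable M"
    unfolding g_def by (rule borel_measurable_lim_metric) measurable
  \<comment> \<open>Fatou's lemma along the subsequence \<open>k\<close>, applied to the differences
    from a fixed \<open>f n\<close>, gives convergence of the whole sequence and, with j = 0, square
    integrability of the limit.\<close>
  have key: "(\<integral>\<^sup>+x. ennreal ((cmod (f n x - g x))\<^sup>2) \<partial>M) \<le> ennreal (((1/4)^j)\<^sup>2)" if n: "n \<ge> Nf j" for n j
  proof -
    have "(\<integral>\<^sup>+x. ennreal ((cmod (f n x - g x))\<^sup>2) \<partial>M)
        = (\<integral>\<^sup>+x. liminf (\<lambda>i. ennreal ((cmod (f n x - f (k i) x))\<^sup>2)) \<partial>M)"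
    proof (rule nn_integral_cong_AE)
      show "AE x in M. ennreal ((cmod (f n x - g x))\<^sup>2) = liminf (\<lambda>i. ennreal ((cmod (f n x - f (k i) x))\<^sup>2))"
        using conv
      proof eventually_elim
        case (elim x)
        then have "(\<lambda>i. f (k i) x) \<longlonglongrightarrow> g x" unfolding g_def by (simp add: convergent_LIMSEQ_iff)
        then have "(\<lambda>i. ennreal ((cmod (f n x - f (k i) x))\<^sup>2)) \<longlonglongrightarrow> ennreal ((cmod (f n x - g x))\<^sup>2)"
          by (intro tendsto_ennrealI tendsto_intros)
        then show ?case by (intro lim_imp_Liminf[symmetric]) auto
      qed
    qed
    also have "\<dots> \<le> liminf (\<lambda>i. \<integral>\<^sup>+x. ennreal ((cmod (f n x - f (k i) x))\<^sup>2) \<partial>M)"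
      by (rule nn_integral_liminf) measurable
    also have "\<dots> \<le> ennreal (((1/4)^j)\<^sup>2)"
    proof (rule Liminf_le)
      show "\<forall>\<^sub>F i in sequentially. (\<integral>\<^sup>+x. ennreal ((cmod (f n x - f (k i) x))\<^sup>2) \<partial>M) \<le> ennreal (((1/4)^j)\<^sup>2)"
        using eventually_ge_at_top[of j]
      proof eventually_elim
        case (elim i)
        have "l2_nrm M (\<lambda>x. f n x - f (k i) x) \<le> (1/4)^j"
          using Nf[OF n k_ge[OF elim]] by simp
        then show ?case
          unfolding nn_integral_sq_eq[OF square_integrable_diff[OF sq sq]]
          by (intro ennreal_leI power_mono) auto
      qed
    qed simp
    finally show ?thesis .
  qed
  have dsq: "square_integrable M (\<lambda>x. f n x - g x)" if "n \<ge> Nf 0" for n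
    unfolding square_integrable_iff_nn using key[OF that] by (auto simp: less_top[symmetric] top_unique)
  have gsq: "square_integrable M g"
    using square_integrable_diff[OF sq dsq[OF order_refl], of "Nf 0"] by simp
  have nb: "l2_nrm M (\<lambda>x. f n x - g x) \<le> (1/4)^j" if "n \<ge> Nf j" for n j
  proof -
    have "(l2_nrm M (\<lambda>x. f n x - g x))\<^sup>2 \<le> ((1/4)^j)\<^sup>2"
      using key[OF that] unfolding nn_integral_sq_eq[OF square_integrable_diff[OF sq gsq]] by (subst (asm) ennreal_le_iff) auto
    then show ?thesis by (rule power2_le_imp_le) simp
  qed
  have "(\<lambda>n. l2_nrm M (\<lambda>x. f n x - g x)) \<longlonglongrightarrow> 0"
  proof (rule LIMSEQ_I)
    fix e :: real assume "e > 0"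
    then obtain j where j: "(1/4)^j < e" using real_arch_pow_inv[of e "1/4"] by auto
    show "\<exists>n0. \<forall>n\<ge>n0. norm (l2_nrm M (\<lambda>x. f n x - g x) - 0) < e"
      using nb[of j] j by (intro exI[of _ "Nf j"]) (auto intro: le_less_trans)
  qed
  with gsq show thesis by (rule that)
qed

lemma l2_ip_tendsto:
  assumes "\<And>n. square_integrable M (f n)" "square_integrable M h" "square_integrable M v"
    and lim: "(\<lambda>n. l2_nrm M (\<lambda>x. f n x - h x)) \<longlonglongrightarrow> 0"
  shows "(\<lambda>n. l2_ip M (f n) v) \<longlonglongrightarrow> l2_ip M h v"
proof (rule LIM_zero_cancel, rule Lim_null_comparison)
  show "\<forall>\<^sub>F n in sequentially. norm (l2_ip M (f n) v - l2_ip M h v)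
      \<le> l2_nrm M (\<lambda>x. f n x - h x) * l2_nrm M v"
    using l2_ip_CS[OF square_integrable_diff[OF assms(1,2)] assms(3)]
    by (intro always_eventually) (simp add: l2_ip_diff_left[OF assms(1,2,3)])
  show "(\<lambda>n. l2_nrm M (\<lambda>x. f n x - h x) * l2_nrm M v) \<longlonglongrightarrow> 0"
    using tendsto_mult_left_zero[OF lim] .
qed

text \<open>Since \<open>l\<close> is conjugate linear, \<open>h\<close> represents it in the first
  slot. It minimises ||g||^2 - 2 Re l(g): the parallelogram law makes a minimising sequence Cauchy,
  the vanishing first variation identifies the real parts, and replacing \<open>v\<close> by i v
  gives the imaginary parts.\<close>

lemma l2_riesz:
  fixes l :: "('a \<Rightarrow> complex) \<Rightarrow> complex"
  assumes add: "\<And>f g. square_integrable M f \<Longrightarrow> square_integrable M g \<Longrightarrow> l (\<lambda>x. f x + g x) = l f + l g"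
    and scale: "\<And>f c. square_integrable M f \<Longrightarrow> l (\<lambda>x. c * f x) = cnj c * l f"
    and bound: "\<And>f. square_integrable M f \<Longrightarrow> cmod (l f) \<le> C * l2_nrm M f"
  obtains h where "square_integrable M h" "\<And>g. square_integrable M g \<Longrightarrow> l2_ip M h g = l g"
proof -
  define J where "J g = (l2_nrm M g)\<^sup>2 - 2 * Re (l g)" for g
  define S where "S = {g. square_integrable M g}"
  have J_lower: "- (C\<^sup>2) \<le> J g" if "g \<in> S" for g
  proof -
    have "Re (l g) \<le> C * l2_nrm M g"
      using bound[of g] that complex_Re_le_cmod[of "l g"] by (simp add: S_def)
    moreover have "0 \<le> (l2_nrm M g - C)\<^sup>2" by simp
    ultimately show ?thesis by (simp add: J_def power2_eq_square algebra_simps)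
  qed
  define m where "m = Inf (J ` S)"
  have bdd: "bdd_below (J ` S)" using J_lower by (auto intro!: bdd_belowI)
  have m_le: "m \<le> J g" if "square_integrable M g" for g
    unfolding m_def using that bdd by (auto intro!: cInf_lower simp: S_def)
  have S_ne: "S \<noteq> {}" using square_integrable_zero by (auto simp: S_def)
  have "\<exists>g\<in>S. J g < m + 1 / real (Suc n)" for n
    using cInf_lessD[of "J ` S" "m + 1 / real (Suc n)"] S_ne unfolding m_def by auto
  then obtain g where gS: "\<And>n. g n \<in> S" and gJ: "\<And>n. J (g n) < m + 1 / real (Suc n)"
    by metis
  have g: "square_integrable M (g n)" for n using gS by (simp add: S_def)
  \<comment> \<open>Parallelogram identity, with the midpoint of \<open>a\<close> and
    \<open>b\<close> as competitor for the infimum.\<close>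
  have diff: "(l2_nrm M (\<lambda>x. a x - b x))\<^sup>2 \<le> 2 * (J a - m) + 2 * (J b - m)"
    if a: "square_integrable M a" and b: "square_integrable M b" for a b
  proof -
    have ab: "square_integrable M (\<lambda>x. a x + b x)" using a b by (rule square_integrable_add)
    have "m \<le> J (\<lambda>x. (1/2) * (a x + b x))" by (intro m_le square_integrable_scale ab)
    also have "\<dots> = (l2_nrm M (\<lambda>x. a x + b x))\<^sup>2 / 4 - Re (l a) - Re (l b)"
      unfolding J_def l2_nrm_scale scale[OF ab] add[OF a b] by (simp add: power_divide field_simps)
    finally have "4 * m \<le> (l2_nrm M (\<lambda>x. a x + b x))\<^sup>2 - 4 * Re (l a) - 4 * Re (l b)" by simp
    then show ?thesis
      unfolding J_def l2_nrm_diff_sq[OF a b] l2_nrm_add_sq[OF a b] by simp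
  qed
  have Cau: "\<exists>N. \<forall>p\<ge>N. \<forall>q\<ge>N. l2_nrm M (\<lambda>x. g p x - g q x) < e" if e: "e > 0" for e
  proof -
    \<comment> \<open>The two defects contribute 2/(N + 1) each, so 4/(N + 1) < e^2 is
      needed.\<close>
    obtain N where N: "4 / e\<^sup>2 < real N" using reals_Archimedean2 by blast
    have "l2_nrm M (\<lambda>x. g p x - g q x) < e" if "p \<ge> N" "q \<ge> N" for p q
    proof (rule power2_less_imp_less)
      have "4 < real N * e\<^sup>2" using N e by (simp add: field_simps)
      also have "\<dots> \<le> real (Suc N) * e\<^sup>2" by (intro mult_right_mono) auto
      finally have N0: "4 < real (Suc N) * e\<^sup>2" .
      have *: "1 / real (Suc p) \<le> 1 / real (Suc N)" "1 / real (Suc q) \<le> 1 / real (Suc N)"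
        using that by (simp_all add: frac_le)
      have "(l2_nrm M (\<lambda>x. g p x - g q x))\<^sup>2 \<le> 2 * (1 / real (Suc N)) + 2 * (1 / real (Suc N))"
      proof (rule order_trans[OF diff[OF g[of p] g[of q]]], intro add_mono mult_left_mono)
        show "J (g p) - m \<le> 1 / real (Suc N)"
          by (rule order_trans[OF _ *(1)]) (use gJ[of p] in \<open>simp only: diff_le_eq add.commute less_imp_le\<close>)
        show "J (g q) - m \<le> 1 / real (Suc N)"
          by (rule order_trans[OF _ *(2)]) (use gJ[of q] in \<open>simp only: diff_le_eq add.commute less_imp_le\<close>)
      qed simp_all
      also have "\<dots> = 4 / real (Suc N)" by simp
      also have "\<dots> < e\<^sup>2" using N0 by (simp add: field_simps)
      finally show "(l2_nrm M (\<lambda>x. g p x - g q x))\<^sup>2 < e\<^sup>2" .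
    qed (use e in simp)
    then show ?thesis by blast
  qed
  obtain h where h: "square_integrable M h" and lim: "(\<lambda>n. l2_nrm M (\<lambda>x. g n x - h x)) \<longlonglongrightarrow> 0"
    by (rule l2_complete[of M g, OF g Cau])
  have Re_eq: "Re (l2_ip M h v) = Re (l v)" if v: "square_integrable M v" for v
  proof -
    define D where "D = Re (l2_ip M h v) - Re (l v)"
    have ineq: "0 \<le> t\<^sup>2 * (l2_nrm M v)\<^sup>2 + 2 * t * D" for t :: real
    proof -
      have tv: "square_integrable M (\<lambda>x. of_real t * v x)" by (intro square_integrable_scale v)
      have "0 \<le> 1 / real (Suc n) + t\<^sup>2 * (l2_nrm M v)\<^sup>2 + 2 * t * (Re (l2_ip M (g n) v) - Re (l v))" for n
      proof -
        have "m \<le> J (\<lambda>x. g n x + of_real t * v x)" by (intro m_le square_integrable_add g tv)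
        also have "\<dots> = J (g n) + t\<^sup>2 * (l2_nrm M v)\<^sup>2 + 2 * t * (Re (l2_ip M (g n) v) - Re (l v))"
          unfolding J_def l2_nrm_add_sq[OF g tv] add[OF g tv] scale[OF v] l2_nrm_scale l2_ip_scale_right
          by (simp add: power_mult_distrib algebra_simps)
        finally show ?thesis using gJ[of n] by simp
      qed
      moreover have "(\<lambda>n. 1 / real (Suc n) + t\<^sup>2 * (l2_nrm M v)\<^sup>2 + 2 * t * (Re (l2_ip M (g n) v) - Re (l v)))
          \<longlonglongrightarrow> 0 + t\<^sup>2 * (l2_nrm M v)\<^sup>2 + 2 * t * (Re (l2_ip M h v) - Re (l v))"
        by (intro tendsto_intros l2_ip_tendsto[OF g h v lim] LIMSEQ_Suc[OF lim_1_over_n])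
      ultimately show ?thesis
        unfolding D_def by (intro LIMSEQ_le_const[where a=0]) auto
    qed
    \<comment> \<open>The quadratic in t is tested at t = -D/A; the added 1 keeps \<open>A\<close>
      positive when \<open>v\<close> has norm 0.\<close>
    define A where "A = (l2_nrm M v)\<^sup>2 + 1"
    have A: "A > 0" by (simp add: A_def add_nonneg_pos)
    have "0 \<le> (-(D/A))\<^sup>2 * (A - 1) + 2 * (-(D/A)) * D" using ineq[of "-(D/A)"] by (simp add: A_def)
    then have "0 \<le> A\<^sup>2 * ((-(D/A))\<^sup>2 * (A - 1) + 2 * (-(D/A)) * D)" by simp
    also have "\<dots> = D\<^sup>2 * (A - 1) - 2 * A * D\<^sup>2" using A by (simp add: field_simps power2_eq_square)
    also have "\<dots> = - (D\<^sup>2 * (A + 1))" by (simp add: algebra_simps)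
    finally have "D\<^sup>2 * (A + 1) \<le> 0" by simp
    then have "D = 0" using A by (simp add: mult_le_0_iff)
    then show ?thesis by (simp add: D_def)
  qed
  have "l2_ip M h v = l v" if v: "square_integrable M v" for v
  proof (rule complex_eqI)
    show "Re (l2_ip M h v) = Re (l v)" by (rule Re_eq[OF v])
    show "Im (l2_ip M h v) = Im (l v)"
      using Re_eq[OF square_integrable_scale[OF v, of \<i>]] by (simp add: l2_ip_scale_right scale[OF v])
  qed
  with h show thesis by (rule that)
qed

section \<open>The Hilbert space L2\<close>

lemma L2_class_in: "square_integrable M f \<Longrightarrow> L2_class M f \<in> L2 M"
  by (simp add: L2_def)

lemma L2_class_eq_iff:
  assumes "square_integrable M f" "square_integrable M g"
  shows "L2_class M f = L2_class M g \<longleftrightarrow> (AE x in M. f x = g x)"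
proof
  assume "L2_class M f = L2_class M g"
  moreover have "f \<in> L2_class M f" using assms by (simp add: L2_class_def)
  ultimately show "AE x in M. f x = g x" by (simp add: L2_class_def)
next
  assume ae: "AE x in M. f x = g x"
  have "(AE x in M. h x = f x) \<longleftrightarrow> (AE x in M. h x = g x)" for h
  proof
    assume "AE x in M. h x = f x" with ae show "AE x in M. h x = g x" by eventually_elim simp
  next
    assume "AE x in M. h x = g x" with ae show "AE x in M. h x = f x" by eventually_elim simp
  qed
  then show "L2_class M f = L2_class M g" by (simp add: L2_class_def)
qed

lemma L2_rep_class:
  assumes "square_integrable M f"
  shows "square_integrable M (L2_rep (L2_class M f))" "AE x in M. L2_rep (L2_class M f) x = f x"
proof -
  have "f \<in> L2_class M f" using assms by (simp add: L2_class_def)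
  then have "L2_rep (L2_class M f) \<in> L2_class M f" unfolding L2_rep_def by (rule someI[of "\<lambda>f. f \<in> _"])
  then show "square_integrable M (L2_rep (L2_class M f))" "AE x in M. L2_rep (L2_class M f) x = f x"
    by (auto simp: L2_class_def)
qed

lemma L2_rep_sq: "u \<in> L2 M \<Longrightarrow> square_integrable M (L2_rep u)"
  unfolding L2_def using L2_rep_class by auto

lemma L2_class_rep: "u \<in> L2 M \<Longrightarrow> L2_class M (L2_rep u) = u"
  unfolding L2_def using L2_class_eq_iff[THEN iffD2, OF L2_rep_class(1) _ L2_rep_class(2)] by blast

lemma L2_eq_iff:
  assumes "u \<in> L2 M" "v \<in> L2 M"
  shows "u = v \<longleftrightarrow> (AE x in M. L2_rep u x = L2_rep v x)"
  using L2_class_eq_iff[OF L2_rep_sq[OF assms(1)] L2_rep_sq[OF assms(2)]] assms by (simp add: L2_class_rep)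

lemma L2_inner_ip: "L2_inner M u v = l2_ip M (L2_rep u) (L2_rep v)"
  by (simp add: L2_inner_def l2_ip_def)

lemma L2_norm_nrm: "L2_norm M u = l2_nrm M (L2_rep u)"
  by (simp add: L2_norm_def l2_nrm_def)

lemma L2_dist_nrm: "L2_dist M u v = l2_nrm M (\<lambda>x. L2_rep u x - L2_rep v x)"
  by (simp add: L2_dist_def l2_nrm_def)

lemma Metric_space_L2: "Metric_space (L2 M) (L2_dist M)"
proof
  fix u v w assume uvw: "u \<in> L2 M" "v \<in> L2 M"
  show "L2_dist M u v = 0 \<longleftrightarrow> u = v"
    unfolding L2_dist_nrm L2_eq_iff[OF uvw]
    using l2_nrm_eq_0_iff[OF square_integrable_diff[OF L2_rep_sq[OF uvw(1)] L2_rep_sq[OF uvw(2)]]]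
    by simp
  assume w: "w \<in> L2 M"
  show "L2_dist M u w \<le> L2_dist M u v + L2_dist M v w"
    unfolding L2_dist_nrm using uvw w by (intro l2_dist_triangle L2_rep_sq)
qed (simp add: L2_dist_nrm, simp only: L2_dist_nrm, rule l2_nrm_minus_commute)

lemma L2_dist_class:
  assumes "u \<in> L2 M" "square_integrable M g"
  shows "L2_dist M u (L2_class M g) = l2_nrm M (\<lambda>x. L2_rep u x - g x)"
  unfolding L2_dist_nrm
proof (rule l2_nrm_cong_AE)
  have [measurable]: "square_integrable M (L2_rep u)" "square_integrable M (L2_rep (L2_class M g))" "square_integrable M g"
    using assms by (auto intro: L2_rep_sq L2_rep_class)
  show "AE x in M. L2_rep u x - L2_rep (L2_class M g) x = L2_rep u x - g x"
    using L2_rep_class(2)[OF assms(2)] by auto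
  show "(\<lambda>x. L2_rep u x - L2_rep (L2_class M g) x) \<in> borel_measurable M"
    "(\<lambda>x. L2_rep u x - g x) \<in> borel_measurable M" by measurable
qed

text \<open>Completeness turns total boundedness of the image of the unit ball into compactness of
  its closure.\<close>

lemma L2_mcomplete: "Metric_space.mcomplete (L2 M) (L2_dist M)"
proof -
  interpret Metric_space "L2 M" "L2_dist M" by (rule Metric_space_L2)
  show ?thesis unfolding mcomplete_def
  proof (intro allI impI)
    fix s assume s: "MCauchy s"
    then have sL: "s n \<in> L2 M" for n by (auto simp: MCauchy_def)
    have C: "\<exists>N. \<forall>m\<ge>N. \<forall>n\<ge>N. l2_nrm M (\<lambda>x. L2_rep (s m) x - L2_rep (s n) x) < e" if "e > 0" for e
      using s that by (simp add: MCauchy_def L2_dist_nrm) 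
    obtain g where g: "square_integrable M g" "(\<lambda>n. l2_nrm M (\<lambda>x. L2_rep (s n) x - g x)) \<longlonglongrightarrow> 0"
      by (rule l2_complete[of M "\<lambda>n. L2_rep (s n)", OF L2_rep_sq[OF sL] C])
    have "limitin mtopology s (L2_class M g) sequentially"
      unfolding limitin_metric_dist_null
    proof (intro conjI)
      show "\<forall>\<^sub>F n in sequentially. s n \<in> L2 M" using sL by simp
      show "(\<lambda>n. L2_dist M (s n) (L2_class M g)) \<longlonglongrightarrow> 0"
        unfolding L2_dist_class[OF sL g(1)] by (rule g(2))
    qed (rule L2_class_in[OF g(1)])
    then show "\<exists>x. limitin mtopology s x sequentially" ..
  qed
qed

lemma L2_inner_class_left:
  assumes f: "square_integrable M f" and g: "g \<in> L2 M"
  shows "L2_inner M (L2_class M f) g = l2_ip M f (L2_rep g)"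
  unfolding L2_inner_ip using L2_rep_class[OF f] f L2_rep_sq[OF g]
  by (intro l2_ip_cong_AE) (auto simp: square_integrable_def)

lemma L2_inner_cnj: "cnj (L2_inner M f g) = L2_inner M g f"
  by (simp add: L2_inner_ip l2_ip_cnj)

lemma L2_inner_class_right:
  assumes f: "square_integrable M f" and g: "g \<in> L2 M"
  shows "L2_inner M g (L2_class M f) = l2_ip M (L2_rep g) f"
  using L2_inner_class_left[OF assms, THEN arg_cong, of cnj] by (simp add: L2_inner_cnj l2_ip_cnj)

lemma L2_add_in: "u \<in> L2 M \<Longrightarrow> v \<in> L2 M \<Longrightarrow> L2_add M u v \<in> L2 M"
  unfolding L2_add_def by (intro L2_class_in square_integrable_add L2_rep_sq)

lemma L2_scale_in: "u \<in> L2 M \<Longrightarrow> L2_scale M c u \<in> L2 M"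
  unfolding L2_scale_def by (intro L2_class_in square_integrable_scale L2_rep_sq)

lemma L2_inner_add_left:
  assumes "u \<in> L2 M" "v \<in> L2 M" "g \<in> L2 M"
  shows "L2_inner M (L2_add M u v) g = L2_inner M u g + L2_inner M v g"
  unfolding L2_add_def L2_inner_ip[of M u] L2_inner_ip[of M v] using assms
  by (simp add: L2_inner_class_left square_integrable_add L2_rep_sq l2_ip_add_left)

lemma L2_inner_scale_left:
  assumes "u \<in> L2 M" "g \<in> L2 M"
  shows "L2_inner M (L2_scale M c u) g = c * L2_inner M u g"
  unfolding L2_scale_def L2_inner_ip[of M u] using assms
  by (simp add: L2_inner_class_left square_integrable_scale L2_rep_sq l2_ip_scale_left)

text \<open>The test vector is the class of the difference of the representatives. This is the
  uniqueness half of the weak definition of the operator.\<close>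

lemma L2_eqI:
  assumes h: "h \<in> L2 M" and k: "k \<in> L2 M"
    and eq: "\<And>g. g \<in> L2 M \<Longrightarrow> L2_inner M h g = L2_inner M k g"
  shows "h = k"
proof -
  interpret Metric_space "L2 M" "L2_dist M" by (rule Metric_space_L2)
  define w where "w x = L2_rep h x - L2_rep k x" for x
  have w: "square_integrable M w" unfolding w_def by (intro square_integrable_diff L2_rep_sq h k)
  have "complex_of_real ((l2_nrm M w)\<^sup>2) = l2_ip M w w" by (rule l2_ip_self[symmetric])
  also have "\<dots> = l2_ip M (L2_rep h) w - l2_ip M (L2_rep k) w"
    unfolding w_def[abs_def] by (intro l2_ip_diff_left square_integrable_diff L2_rep_sq h k)
  also have "\<dots> = L2_inner M h (L2_class M w) - L2_inner M k (L2_class M w)"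
    by (simp only: L2_inner_class_right[OF w h] L2_inner_class_right[OF w k])
  also have "\<dots> = 0" using eq[OF L2_class_in[OF w]] by simp
  finally have "l2_nrm M w = 0" by simp
  then have "L2_dist M h k = 0" by (simp add: L2_dist_nrm w_def[abs_def])
  then show ?thesis using h k by simp
qed

section \<open>Characters and Haar measures\<close>

lemma continuous_on_UNIV_openI:
  assumes "\<And>B. open B \<Longrightarrow> open (f -` B)"
  shows "continuous_on UNIV f"
  using assms by (simp add: continuous_on_open_vimage)

lemma char_add: "char_apply \<xi> (x + y) = char_apply \<xi> x * char_apply \<xi> y"
  using char_apply[of \<xi>] by auto

lemma cmod_char [simp]: "cmod (char_apply \<xi> x) = 1"
  using char_apply[of \<xi>] by auto

lemma continuous_char: "continuous_on UNIV (char_apply \<xi>)"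
  using char_apply[of \<xi>] by auto

lemma char_mult_cnj: "char_apply \<xi> x * cnj (char_apply \<xi> x) = 1"
  by (simp flip: complex_norm_square)

lemma open_char_image: "compact K \<Longrightarrow> open U \<Longrightarrow> open {\<xi>. char_apply \<xi> ` K \<subseteq> U}"
  unfolding open_pontryagin_dual_def by (rule generate_topology.Basis) auto

lemma continuous_char_eval: "continuous_on UNIV (\<lambda>\<xi>. char_apply \<xi> x)"
proof (rule continuous_on_UNIV_openI)
  fix B :: "complex set" assume "open B"
  then have "open {\<xi>. char_apply \<xi> ` {x} \<subseteq> B}" by (intro open_char_image) auto
  moreover have "{\<xi>. char_apply \<xi> ` {x} \<subseteq> B} = (\<lambda>\<xi>. char_apply \<xi> x) -` B" by auto
  ultimately show "open ((\<lambda>\<xi>. char_apply \<xi> x) -` B)" by simp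
qed

text \<open>Distinct characters are separated by their values at one point. Hausdorffness makes the
  compact sets \<open>Kd n\<close> closed, hence Borel.\<close>

instance pontryagin_dual :: (topological_ab_group_add) t2_space
proof
  fix \<xi> \<psi> :: "'a pontryagin_dual" assume "\<xi> \<noteq> \<psi>"
  then have "char_apply \<xi> \<noteq> char_apply \<psi>" by (simp add: char_apply_inject)
  then obtain x where "char_apply \<xi> x \<noteq> char_apply \<psi> x" by (auto simp: fun_eq_iff)
  from hausdorff[OF this]
  obtain U V where UV: "open U" "open V" "char_apply \<xi> x \<in> U" "char_apply \<psi> x \<in> V" "U \<inter> V = {}"
    by (elim exE conjE) rule
  have "open ((\<lambda>\<xi>. char_apply \<xi> x) -` U)" "open ((\<lambda>\<xi>. char_apply \<xi> x) -` V)"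
    by (rule open_vimage[OF UV(1) continuous_char_eval], rule open_vimage[OF UV(2) continuous_char_eval])
  then show "\<exists>U V. open U \<and> open V \<and> \<xi> \<in> U \<and> \<psi> \<in> V \<and> U \<inter> V = {}"
    using UV by (intro exI[of _ "(\<lambda>\<xi>. char_apply \<xi> x) -` U"] exI[of _ "(\<lambda>\<xi>. char_apply \<xi> x) -` V"]) auto
qed

lemma borel_measurable_group_diff [measurable (raw)]:
  fixes f g :: "'a \<Rightarrow> 'g::{topological_ab_group_add, second_countable_topology}"
  assumes "f \<in> borel_measurable L" "g \<in> borel_measurable L"
  shows "(\<lambda>x. f x - g x) \<in> borel_measurable L"
  by (rule borel_measurable_continuous_Pair[OF assms]) (intro continuous_intros)

text \<open>
  The type of the dual is not an instance of \<open>second_countable_topology\<close>, so joint measurability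
  is obtained by approximating the group variable by points of a countable dense set.
\<close>

lemma measurable_char_joint:
  fixes f :: "'a \<Rightarrow> 'g::{topological_ab_group_add, second_countable_topology} pontryagin_dual"
  assumes f [measurable]: "f \<in> borel_measurable L" and g [measurable]: "g \<in> borel_measurable L"
  shows "(\<lambda>x. char_apply (f x) (g x)) \<in> borel_measurable L"
proof -
  obtain A :: "nat \<Rightarrow> 'g set" where A: "\<And>i. open (A i)" "\<And>i. 0 \<in> A i"
    and A_lim: "\<And>F. (\<forall>n. F n \<in> A n) \<Longrightarrow> F \<longlonglongrightarrow> 0"
    by (rule first_countable_topology_class.countable_basis[of 0]) blast
  obtain D :: "'g set" where D: "countable D" "\<And>X. open X \<Longrightarrow> X \<noteq> {} \<Longrightarrow> \<exists>d\<in>D. d \<in> X"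
    by (rule countable_dense_setE) blast
  have "D \<noteq> {}" using D(2)[of UNIV] by auto
  define s where "s = from_nat_into D"
  have s: "\<exists>k. s k - y \<in> A n" for y n
  proof -
    have "open ((\<lambda>z. z - y) -` A n)" using A by (intro open_vimage) (auto intro!: continuous_intros)
    moreover have "y \<in> (\<lambda>z. z - y) -` A n" using A by simp
    ultimately have "\<exists>z\<in>D. z \<in> (\<lambda>z. z - y) -` A n" by (intro D(2)) blast+
    then obtain z where "z \<in> D" "z - y \<in> A n" by auto
    then show ?thesis unfolding s_def using from_nat_into_surj[OF D(1)] by blast
  qed
  \<comment> \<open>Taking the least index makes the choice of the approximating point measurable,
    with countably many values.\<close>
  define \<kappa> where "\<kappa> n y = (LEAST k. s k - y \<in> A n)" for n y
  have \<kappa>: "s (\<kappa> n y) - y \<in> A n" for n y unfolding \<kappa>_def using s by (rule LeastI_ex)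
  have [measurable]: "A n \<in> sets borel" for n using A by simp
  have [measurable]: "(\<lambda>x. \<kappa> n (g x)) \<in> measurable L (count_space UNIV)" for n
    unfolding \<kappa>_def by measurable
  have [measurable]: "(\<lambda>x. char_apply (f x) (s k)) \<in> borel_measurable L" for k
    using measurable_compose[OF f borel_measurable_continuous_onI[OF continuous_char_eval[of "s k"]]] .
  show ?thesis
  proof (rule borel_measurable_LIMSEQ_metric)
    show "(\<lambda>x. char_apply (f x) (s (\<kappa> n (g x)))) \<in> borel_measurable L" for n
      by (rule measurable_compose_countable[where f="\<lambda>k x. char_apply (f x) (s k)" and g="\<lambda>x. \<kappa> n (g x)"]) measurable
    fix x
    have "(\<lambda>n. s (\<kappa> n (g x)) - g x) \<longlonglongrightarrow> 0" using \<kappa> by (intro A_lim) auto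
    then have "(\<lambda>n. s (\<kappa> n (g x))) \<longlonglongrightarrow> g x"
      using tendsto_add[of "\<lambda>n. s (\<kappa> n (g x)) - g x" 0 sequentially "\<lambda>_. g x" "g x"] by simp
    then show "(\<lambda>n. char_apply (f x) (s (\<kappa> n (g x)))) \<longlonglongrightarrow> char_apply (f x) (g x)"
      using continuous_on_tendsto_compose[OF continuous_char] by auto
  qed
qed

section \<open>Invariance and positivity of Haar measures\<close>

lemma
  assumes "haar_measure L"
  shows haar_sets: "sets L = sets borel"
    and haar_UNIV: "emeasure L UNIV \<noteq> 0"
    and haar_translate: "A \<in> sets borel \<Longrightarrow> emeasure L ((+) a ` A) = emeasure L A"
    and haar_compact: "compact K \<Longrightarrow> emeasure L K < \<infinity>"
    and haar_outer: "A \<in> sets borel \<Longrightarrow> emeasure L A = (INF U\<in>{U. open U \<and> A \<subseteq> U}. emeasure L U)"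
    and haar_inner: "open U \<Longrightarrow> emeasure L U = (SUP K\<in>{K. compact K \<and> K \<subseteq> U}. emeasure L K)"
proof -
  note h = assms[unfolded haar_measure_def]
  note h2 = h[THEN conjunct2]
  note h3 = h2[THEN conjunct2]
  note h4 = h3[THEN conjunct2]
  note h5 = h4[THEN conjunct2]
  show "sets L = sets borel" by (rule h[THEN conjunct1])
  show "emeasure L UNIV \<noteq> 0" by (rule h2[THEN conjunct1])
  show "A \<in> sets borel \<Longrightarrow> emeasure L ((+) a ` A) = emeasure L A"
    by (rule h3[THEN conjunct1, rule_format])
  show "compact K \<Longrightarrow> emeasure L K < \<infinity>"
    by (rule h4[THEN conjunct1, rule_format])
  show "A \<in> sets borel \<Longrightarrow> emeasure L A = (INF U\<in>{U. open U \<and> A \<subseteq> U}. emeasure L U)"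
    by (rule h5[THEN conjunct1, rule_format])
  show "open U \<Longrightarrow> emeasure L U = (SUP K\<in>{K. compact K \<and> K \<subseteq> U}. emeasure L K)"
    by (rule h5[THEN conjunct2, rule_format])
qed

text \<open>Continuity of the translation is a hypothesis because the lemma serves both the group
  and its dual, and the dual is no instance of a topological group class.\<close>

lemma haar_distr:
  assumes haar: "haar_measure L" and cont: "continuous_on UNIV ((+) a)"
  shows "distr L L ((+) a) = L"
proof (rule measure_eqI)
  have sets: "sets L = sets borel" by (rule haar_sets[OF haar])
  have space: "space L = UNIV" using sets_eq_imp_space_eq[OF sets] by simp
  have meas: "(+) a \<in> measurable L L"
    using borel_measurable_continuous_onI[OF cont] sets by (simp cong: measurable_cong_sets)
  fix A assume "A \<in> sets (distr L L ((+) a))"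
  then have A: "A \<in> sets L" by simp
  have pre: "(+) a -` A \<in> sets borel" using measurable_sets[OF meas A] sets space by simp
  have "(+) a ` ((+) a -` A) = A" by (rule surj_image_vimage_eq) (simp add: surj_plus)
  then show "emeasure (distr L L ((+) a)) A = emeasure L A"
    using haar_translate[OF haar pre, of a] emeasure_distr[OF meas A] unfolding space by simp
qed simp

lemma haar_nn_integral:
  assumes haar: "haar_measure L" and cont: "continuous_on UNIV ((+) a)"
    and f: "f \<in> borel_measurable L"
  shows "(\<integral>\<^sup>+x. f (a + x) \<partial>L) = (\<integral>\<^sup>+x. f x \<partial>L)"
proof -
  have sets: "sets L = sets borel" by (rule haar_sets[OF haar])
  have meas: "(+) a \<in> measurable L L"
    using borel_measurable_continuous_onI[OF cont] sets by (simp cong: measurable_cong_sets)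
  show ?thesis
    using nn_integral_distr[OF meas, of f] f haar_distr[OF haar cont] by simp
qed

text \<open>If \<open>U\<close> were null, so would be its translates, finitely many of which cover
  any compact set; inner regularity would then make the whole space null.\<close>

lemma haar_open_pos:
  fixes L :: "'a::{ab_group_add, topological_space} measure"
  assumes haar: "haar_measure L" and cont: "\<And>a::'a. continuous_on UNIV ((+) a)"
    and U: "open U" "U \<noteq> {}"
  shows "emeasure L U > 0"
proof (rule ccontr)
  assume "\<not> emeasure L U > 0"
  then have null: "emeasure L U = 0" by (simp add: not_less)
  obtain u where u: "u \<in> U" using U by blast
  have sets: "sets L = sets borel" by (rule haar_sets[OF haar])
  have shift: "open ((+) a ` U)" "emeasure L ((+) a ` U) = 0" for a
  proof -
    have "(+) a ` U = (+) (-a) -` U" by (auto simp: image_iff algebra_simps intro!: bexI[of _ "_ - a"])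
    then show "open ((+) a ` U)" using open_vimage[OF U(1) cont] by simp
    show "emeasure L ((+) a ` U) = 0" using haar_translate[OF haar, of U a] U null by simp
  qed
  have "emeasure L K = 0" if K: "compact K" for K
  proof -
    have "K \<subseteq> (\<Union>k\<in>K. (+) (k - u) ` U)" using u by (force simp: image_iff)
    then obtain F where F: "F \<subseteq> K" "finite F" "K \<subseteq> (\<Union>k\<in>F. (+) (k - u) ` U)"
      using compactE_image[OF K, of K "\<lambda>k. (+) (k - u) ` U"] shift by blast
    have S: "(\<lambda>k. (+) (k - u) ` U) ` F \<subseteq> sets L" using shift(1) sets by auto
    have "emeasure L K \<le> emeasure L (\<Union>k\<in>F. (+) (k - u) ` U)"
      using F S by (intro emeasure_mono sets.finite_UN) auto
    also have "\<dots> \<le> (\<Sum>k\<in>F. emeasure L ((+) (k - u) ` U))"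
      by (rule emeasure_subadditive_finite[OF F(2) S])
    also have "\<dots> = 0" using shift by simp
    finally show ?thesis by simp
  qed
  then have "(SUP K\<in>{K. compact K \<and> K \<subseteq> UNIV}. emeasure L K) = 0"
    by (intro SUP_eq_const) auto
  then show False using haar_inner[OF haar open_UNIV] haar_UNIV[OF haar] by simp
qed

lemma proper_invariant_metric_open:
  assumes "proper_invariant_metric d"
  shows "open S \<longleftrightarrow> (\<forall>x\<in>S. \<exists>r>0. \<forall>y. d x y < r \<longrightarrow> y \<in> S)"
proof -
  interpret Metric_space UNIV d using assms by (simp add: proper_invariant_metric_def)
  have "open S \<longleftrightarrow> openin mtopology S"
    using assms by (simp add: proper_invariant_metric_def)
  also have "\<dots> \<longleftrightarrow> (\<forall>x\<in>S. \<exists>r>0. \<forall>y. d x y < r \<longrightarrow> y \<in> S)"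
    unfolding openin_mtopology by (simp add: subset_eq mball_def Ball_def)
  finally show ?thesis .
qed

lemma proper_invariant_metric_continuous:
  fixes d :: "'a \<Rightarrow> 'a::{ab_group_add, topological_space} \<Rightarrow> real"
  assumes d: "proper_invariant_metric d"
  shows "continuous_on UNIV ((+) (a::'a))"
proof (rule continuous_on_UNIV_openI)
  fix B :: "'a set" assume B: "open B"
  show "open ((+) a -` B)"
    unfolding proper_invariant_metric_open[OF d]
  proof
    fix x assume "x \<in> (+) a -` B"
    then obtain r where "r > 0" "\<And>y. d (a + x) y < r \<Longrightarrow> y \<in> B"
      using B unfolding proper_invariant_metric_open[OF d] by force
    then show "\<exists>r>0. \<forall>y. d x y < r \<longrightarrow> y \<in> (+) a -` B"
      using d by (intro exI[of _ r]) (auto simp: proper_invariant_metric_def)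
  qed
qed

section \<open>The setting: exhaustion by compact sets and invariance of the product measure\<close>

locale tf_setting =
  fixes M :: "'g::{topological_ab_group_add, t2_space, second_countable_topology} measure"
    and N :: "'g pontryagin_dual measure"
    and d :: "'g pontryagin_dual \<times> 'g \<Rightarrow> 'g pontryagin_dual \<times> 'g \<Rightarrow> real"
  assumes haar_M: "haar_measure M"
    and plancherel: "plancherel_measure M N"
    and metric: "proper_invariant_metric d"
begin

lemma haar_N: "haar_measure N"
  using plancherel by (simp add: plancherel_measure_def)

lemma sets_M [measurable_cong, simp]: "sets M = sets borel"
  by (rule haar_sets[OF haar_M])

lemma sets_N [measurable_cong, simp]: "sets N = sets borel"
  by (rule haar_sets[OF haar_N])

lemma space_M [simp]: "space M = UNIV" using sets_eq_imp_space_eq[OF sets_M] by simp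

lemma space_N [simp]: "space N = UNIV" using sets_eq_imp_space_eq[OF sets_N] by simp

sublocale d: Metric_space UNIV d
  using metric by (simp add: proper_invariant_metric_def)

lemma d_translate: "d (a + x) (a + y) = d x y"
  using metric unfolding proper_invariant_metric_def by blast

lemma continuous_add_M: "continuous_on UNIV ((+) (a::'g))"
  by (intro continuous_intros)

text \<open>The compact-open topology need not be examined: translation by \<open>a\<close> on the
  dual is translation by (a, 0) on the slice of pairs (p, 0), and invariance of \<open>d\<close>
  makes translations of the product continuous.\<close>

lemma continuous_add_N: "continuous_on UNIV ((+) (a :: 'g pontryagin_dual))"
proof (rule continuous_on_UNIV_openI)
  fix B :: "'g pontryagin_dual set" assume "open B"
  then have "open (B \<times> (UNIV :: 'g set))" by (intro open_Times) auto
  then have "open ((+) (a, 0::'g) -` (B \<times> UNIV))"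
    by (rule open_vimage[OF _ proper_invariant_metric_continuous[OF metric]])
  then have "open ((\<lambda>p. (p, 0::'g)) -` ((+) (a, 0) -` (B \<times> UNIV)))"
    by (rule open_vimage) (intro continuous_intros)
  moreover have "(\<lambda>p. (p, 0::'g)) -` ((+) (a, 0) -` (B \<times> UNIV)) = (+) a -` B" by auto
  ultimately show "open ((+) a -` B)" by simp
qed

text \<open>
  The sets \<open>KK n\<close> below replace the balls of \<open>d\<close>, which are not visibly measurable
  with respect to the product of the Borel algebras.
\<close>

definition Kd :: "nat \<Rightarrow> 'g pontryagin_dual set" where
  "Kd n = fst ` closure (d.mball 0 (real n))"

definition Kg :: "nat \<Rightarrow> 'g set" where
  "Kg n = snd ` closure (d.mball 0 (real n))"

lemma compact_Kd: "compact (Kd n)" and compact_Kg: "compact (Kg n)"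
proof -
  have "compact (closure (d.mball 0 (real n)))"
    using metric unfolding proper_invariant_metric_def by blast
  then show "compact (Kd n)" "compact (Kg n)" unfolding Kd_def Kg_def
    by (rule compact_continuous_image[rotated], intro continuous_intros)+
qed

lemma mem_K: "d 0 (p, q) < real n \<Longrightarrow> p \<in> Kd n \<and> q \<in> Kg n"
proof -
  assume "d 0 (p, q) < real n"
  then have "(p, q) \<in> closure (d.mball 0 (real n))"
    by (intro subsetD[OF closure_subset]) (simp add: d.in_mball)
  then show ?thesis unfolding Kd_def Kg_def by (intro conjI image_eqI[of _ _ "(p, q)"]) simp_all
qed

lemma closed_K [measurable]: "Kd n \<in> sets borel" "Kg n \<in> sets borel"
  by (intro borel_closed compact_imp_closed compact_Kd compact_Kg)+

lemma emeasure_K: "emeasure N (Kd n) < \<infinity>" "emeasure M (Kg n) < \<infinity>"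
  by (rule haar_compact[OF haar_N compact_Kd], rule haar_compact[OF haar_M compact_Kg])

definition KK :: "nat \<Rightarrow> ('g pontryagin_dual \<times> 'g) set" where
  "KK n = Kd n \<times> Kg n"

lemma mem_KK: "d 0 w < real n \<Longrightarrow> w \<in> KK n"
  using mem_K[of "fst w" "snd w" n] by (simp add: KK_def mem_Times_iff)

lemma ev_mem_KK: "\<forall>\<^sub>F n in sequentially. w \<in> KK n"
proof -
  obtain n0 where "d 0 w < real n0" using reals_Archimedean2 by blast
  then show ?thesis
    unfolding eventually_sequentially by (intro exI[of _ n0]) (auto intro!: mem_KK)
qed

lemma ev_mem_Kg: "\<forall>\<^sub>F n in sequentially. x \<in> Kg n"
  using ev_mem_KK[of "(0, x)"] by (rule eventually_mono) (simp add: KK_def)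

sublocale M: sigma_finite_measure M
proof
  have "(\<Union>n. Kg n) = UNIV" using eventually_happens'[OF _ ev_mem_Kg] by auto
  then show "\<exists>A. countable A \<and> A \<subseteq> sets M \<and> \<Union>A = space M \<and> (\<forall>a\<in>A. emeasure M a \<noteq> \<infinity>)"
    using emeasure_K by (intro exI[of _ "range Kg"]) (auto simp: less_top)
qed

sublocale N: sigma_finite_measure N
proof
  have "\<exists>n. p \<in> Kd n" for p using eventually_happens'[OF _ ev_mem_KK[of "(p, 0)"]] by (auto simp: KK_def)
  then have "(\<Union>n. Kd n) = UNIV" by auto
  then show "\<exists>A. countable A \<and> A \<subseteq> sets N \<and> \<Union>A = space N \<and> (\<forall>a\<in>A. emeasure N a \<noteq> \<infinity>)"
    using emeasure_K by (intro exI[of _ "range Kd"]) (auto simp: less_top)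
qed

sublocale NM: pair_sigma_finite N M ..

abbreviation "P \<equiv> N \<Otimes>\<^sub>M M"

sublocale P: sigma_finite_measure P by (rule NM.sigma_finite_measure_axioms)

sublocale PP: pair_sigma_finite P P ..

lemma KK_sets [measurable]: "KK n \<in> sets P"
  unfolding KK_def by (intro pair_measureI) auto

lemma emeasure_KK: "emeasure P (KK n) < \<infinity>"
  unfolding KK_def using emeasure_K[of n] by (simp add: M.emeasure_pair_measure_Times ennreal_mult_less_top)

text \<open>Compact sets are bounded, so together with \<open>mem_KK\<close> this shows that going
  to infinity for \<open>d\<close> means leaving every \<open>KK n\<close>.\<close>

lemma KK_bounded: "\<exists>R. \<forall>w\<in>KK n. d 0 w < R"
proof -
  have "compact (KK n)" unfolding KK_def by (intro compact_Times compact_Kd compact_Kg)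
  then have "compactin d.mtopology (KK n)"
    using metric by (simp add: proper_invariant_metric_def)
  then have "d.mbounded (KK n)" by (rule d.compactin_imp_mbounded)
  then obtain c B where "KK n \<subseteq> d.mcball c B" unfolding d.mbounded_def by blast
  then have cB: "d c w \<le> B" if "w \<in> KK n" for w using that by (auto simp: subset_eq d.in_mcball)
  have "\<forall>w\<in>KK n. d 0 w < d 0 c + B + 1"
  proof
    fix w assume "w \<in> KK n"
    from cB[OF this] d.triangle[of 0 c w] show "d 0 w < d 0 c + B + 1" by simp
  qed
  then show ?thesis ..
qed

text \<open>Each compact \<open>KK n\<close> is totally bounded, and these sets cover the product.
  The dense set feeds the diagonal extraction of a subsequence.\<close>

lemma countable_dense:
  obtains D where "countable D" "\<And>w e. e > 0 \<Longrightarrow> \<exists>a\<in>D. d w a < e"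
proof -
  have "\<exists>F. finite F \<and> KK n \<subseteq> (\<Union>x\<in>F. d.mball x (1 / real (Suc m)))" for n m
  proof -
    have "compact (KK n)" unfolding KK_def by (intro compact_Times compact_Kd compact_Kg)
    then have "compactin d.mtopology (KK n)"
      using metric by (simp add: proper_invariant_metric_def)
    then have "d.mtotally_bounded (KK n)" by (rule d.compactin_imp_mtotally_bounded)
    then show ?thesis unfolding d.mtotally_bounded_def by (meson of_nat_0_less_iff zero_less_Suc zero_less_divide_1_iff)
  qed
  then obtain F where F: "\<And>n m. finite (F n m)" "\<And>n m. KK n \<subseteq> (\<Union>x\<in>F n m. d.mball x (1 / real (Suc m)))"
    by metis
  show thesis
  proof (rule that[of "\<Union>n m. F n m"])
    show "countable (\<Union>n m. F n m)" 
      by (rule countable_UN[OF countableI_type], rule countable_UN[OF countableI_type], rule countable_finite[OF F(1)])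
    fix w :: "'g pontryagin_dual \<times> 'g" and e :: real assume "e > 0"
    then obtain m where m: "1 / real (Suc m) < e" using nat_approx_posE by blast
    obtain n where "w \<in> KK n" using eventually_happens'[OF _ ev_mem_KK[of w]] by auto
    then obtain x where "x \<in> F n m" "d x w < 1 / real (Suc m)" using F(2)[of n m] by auto
    then show "\<exists>a\<in>(\<Union>n m. F n m). d w a < e" using m d.commute[of w x] by (intro bexI[of _ x]) auto
  qed
qed

lemma nn_integral_translate_M:
  "f \<in> borel_measurable M \<Longrightarrow> (\<integral>\<^sup>+x. f (a + x) \<partial>M) = (\<integral>\<^sup>+x. f x \<partial>M)"
  by (rule haar_nn_integral[OF haar_M continuous_add_M])

text \<open>The product measure lives on the product of the Borel algebras and is not known to
  satisfy \<open>haar_measure\<close>; hence invariance is taken one factor at a time through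
  Tonelli.\<close>

lemma nn_integral_translate_P:
  assumes [measurable]: "f \<in> borel_measurable P"
  shows "(\<integral>\<^sup>+z. f (a + z) \<partial>P) = (\<integral>\<^sup>+z. f z \<partial>P)"
proof -
  obtain p q where a: "a = (p, q)" by force
  have [measurable]: "(+) p \<in> measurable N N" "(+) q \<in> measurable M M"
    using borel_measurable_continuous_onI[OF continuous_add_N[of p]]
      borel_measurable_continuous_onI[OF continuous_add_M[of q]] by (simp_all cong: measurable_cong_sets)
  have [measurable]: "(\<lambda>z. f (a + z)) \<in> borel_measurable P"
  proof -
    have "(\<lambda>z. f (p + fst z, q + snd z)) \<in> borel_measurable P" by measurable
    then show ?thesis by (simp add: a plus_prod_def)
  qed
  have "(\<integral>\<^sup>+z. f (a + z) \<partial>P) = (\<integral>\<^sup>+s. \<integral>\<^sup>+t. f (a + (s, t)) \<partial>M \<partial>N)"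
    by (subst M.nn_integral_fst[symmetric]) simp_all
  also have "\<dots> = (\<integral>\<^sup>+s. \<integral>\<^sup>+t. f (p + s, t) \<partial>M \<partial>N)"
    unfolding a plus_prod_def using nn_integral_translate_M[of "\<lambda>t. f (p + _, t)" q] by simp
  also have "\<dots> = (\<integral>\<^sup>+s. \<integral>\<^sup>+t. f (s, t) \<partial>M \<partial>N)"
    by (rule haar_nn_integral[OF haar_N continuous_add_N, of "\<lambda>s. \<integral>\<^sup>+t. f (s, t) \<partial>M"]) measurable
  also have "\<dots> = (\<integral>\<^sup>+z. f z \<partial>P)" by (rule M.nn_integral_fst) simp
  finally show ?thesis .
qed

lemma distr_minus_M: "distr M M (\<lambda>x. x - q) = M"
proof -
  have "(\<lambda>x. x - q) = (+) (- q)" by (simp add: fun_eq_iff)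
  then show ?thesis using haar_distr[OF haar_M continuous_add_M[of "-q"]] by simp
qed

lemma measurable_minus_M [measurable]: "(\<lambda>x. x - q) \<in> measurable M M"
  by measurable

section \<open>Continuity of translation in L1\<close>

lemma integrable_shift:
  fixes f :: "'g \<Rightarrow> 'b::{banach, second_countable_topology}"
  shows "integrable M f \<Longrightarrow> integrable M (\<lambda>x. f (x - q))"
  using integrable_distr[OF measurable_minus_M[of q], of f] by (simp add: distr_minus_M)

lemma integral_shift:
  fixes f :: "'g \<Rightarrow> 'b::{banach, second_countable_topology}"
  shows "f \<in> borel_measurable M \<Longrightarrow> (LINT x|M. f (x - q)) = (LINT x|M. f x)"
  using integral_distr[OF measurable_minus_M[of q], of f] by (simp add: distr_minus_M)

text \<open>Continuity of translation at 0 in the L1 norm, phrased with sequences so that dominated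
  convergence applies. The group is first countable, so neighbourhood statements can be
  recovered.\<close>

definition L1_continuous :: "('g \<Rightarrow> complex) \<Rightarrow> bool" where
  "L1_continuous g \<longleftrightarrow> (\<forall>q. q \<longlonglongrightarrow> 0 \<longrightarrow> (\<lambda>n. LINT x|M. cmod (g (x - q n) - g x)) \<longlonglongrightarrow> 0)"

text \<open>Translation invariance gives g - h and its translate the same norm, so an approximation
  within e/3 suffices.\<close>

lemma L1_continuous_approx:
  assumes g: "integrable M g"
    and approx: "\<And>e. e > 0 \<Longrightarrow> \<exists>h. integrable M h \<and> L1_continuous h \<and> (LINT x|M. cmod (g x - h x)) < e"
  shows "L1_continuous g"
  unfolding L1_continuous_def
proof (intro allI impI LIMSEQ_I)
  fix q :: "nat \<Rightarrow> 'g" and e :: real assume q: "q \<longlonglongrightarrow> 0" and e: "e > 0"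
  obtain h where h: "integrable M h" "L1_continuous h" and gh: "(LINT x|M. cmod (g x - h x)) < e/3"
    using approx[of "e/3"] e by auto
  have [measurable]: "g \<in> borel_measurable M" "h \<in> borel_measurable M" using g h by auto
  from h(2) q have "(\<lambda>n. LINT x|M. cmod (h (x - q n) - h x)) \<longlonglongrightarrow> 0" by (simp add: L1_continuous_def)
  from LIMSEQ_D[OF this, of "e/3"] e obtain n0 where
    n0: "\<And>n. n \<ge> n0 \<Longrightarrow> (LINT x|M. cmod (h (x - q n) - h x)) < e/3" by auto
  have "norm ((LINT x|M. cmod (g (x - q n) - g x)) - 0) < e" if "n \<ge> n0" for n
  proof -
    have i1: "integrable M (\<lambda>x. cmod (g (x - q n) - h (x - q n)))"
      by (intro integrable_norm Bochner_Integration.integrable_diff integrable_shift g h)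
    have i2: "integrable M (\<lambda>x. cmod (h (x - q n) - h x))" "integrable M (\<lambda>x. cmod (g x - h x))"
      "integrable M (\<lambda>x. cmod (g (x - q n) - g x))"
      by (intro integrable_norm Bochner_Integration.integrable_diff integrable_shift g h)+
    have "(LINT x|M. cmod (g (x - q n) - g x))
        \<le> (LINT x|M. cmod (g (x - q n) - h (x - q n)) + (cmod (h (x - q n) - h x) + cmod (g x - h x)))"
    proof (intro integral_mono)
      fix x
      have "g (x - q n) - g x = (g (x - q n) - h (x - q n)) + ((h (x - q n) - h x) + (h x - g x))" by simp
      then show "cmod (g (x - q n) - g x) \<le> cmod (g (x - q n) - h (x - q n)) + (cmod (h (x - q n) - h x) + cmod (g x - h x))"
        by (metis add_left_mono norm_minus_commute norm_triangle_ineq order_trans)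
    qed (use i1 i2 in auto)
    also have "\<dots> = (LINT x|M. cmod (g (x - q n) - h (x - q n))) + ((LINT x|M. cmod (h (x - q n) - h x)) + (LINT x|M. cmod (g x - h x)))"
      using i1 i2 by simp
    also have "(LINT x|M. cmod (g (x - q n) - h (x - q n))) = (LINT x|M. cmod (g x - h x))"
      by (rule integral_shift[of "\<lambda>x. cmod (g x - h x)"]) measurable
    finally have "(LINT x|M. cmod (g (x - q n) - g x)) < e" using gh n0[OF that] by simp
    moreover have "0 \<le> (LINT x|M. cmod (g (x - q n) - g x))" by simp
    ultimately show ?thesis by simp
  qed
  then show "\<exists>n0. \<forall>n\<ge>n0. norm ((LINT x|M. cmod (g (x - q n) - g x)) - 0) < e" by blast
qed

text \<open>For sets, |1_A - 1_B| = 1_A + 1_B - 2 1_A 1_B, so it is enough that the integral of the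
  product converges. That holds because openness of \<open>U\<close> makes the translated indicator
  eventually 1 at each point of \<open>U\<close>.\<close>

lemma L1_continuous_open:
  assumes U: "open U" and fin: "emeasure M U < \<infinity>"
  shows "L1_continuous (\<lambda>x. indicator U x *\<^sub>R c)"
  unfolding L1_continuous_def
proof (intro allI impI)
  fix q :: "nat \<Rightarrow> 'g" assume q: "q \<longlonglongrightarrow> 0"
  have [measurable]: "U \<in> sets borel" using U by simp
  have iU: "integrable M (indicat_real U)" using fin by (intro integrable_real_indicator) auto
  define b where "b n x = indicat_real U (x - q n) * indicat_real U x" for n x
  have ib: "integrable M (b n)" for n
    unfolding b_def by (rule Bochner_Integration.integrable_bound[OF iU]) (auto simp: indicator_def)
  have "(\<lambda>n. LINT x|M. b n x) \<longlonglongrightarrow> (LINT x|M. indicat_real U x)"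
  proof (rule integral_dominated_convergence[OF _ _ iU])
    show "AE x in M. (\<lambda>n. b n x) \<longlonglongrightarrow> indicat_real U x"
    proof (rule AE_I2)
      fix x
      show "(\<lambda>n. b n x) \<longlonglongrightarrow> indicat_real U x"
      proof (cases "x \<in> U")
        case True
        have "(\<lambda>n. x - q n) \<longlonglongrightarrow> x - 0" by (intro tendsto_intros q)
        then have "\<forall>\<^sub>F n in sequentially. x - q n \<in> U" using U True by (simp add: tendsto_def)
        then have "\<forall>\<^sub>F n in sequentially. b n x = indicat_real U x"
          by eventually_elim (auto simp: b_def True)
        then show ?thesis by (rule tendsto_eventually)
      qed (simp add: b_def)
    qed
    show "AE x in M. norm (b n x) \<le> indicat_real U x" for n by (auto simp: b_def indicator_def)
  qed (use iU ib in \<open>auto simp: b_def\<close>)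
  then have "(\<lambda>n. cmod c * (2 * (LINT x|M. indicat_real U x) - 2 * (LINT x|M. b n x))) \<longlonglongrightarrow>
     cmod c * (2 * (LINT x|M. indicat_real U x) - 2 * (LINT x|M. indicat_real U x))"
    by (intro tendsto_intros)
  moreover have "(LINT x|M. cmod (indicator U (x - q n) *\<^sub>R c - indicator U x *\<^sub>R c))
    = cmod c * (2 * (LINT x|M. indicat_real U x) - 2 * (LINT x|M. b n x))" for n
  proof -
    have "(LINT x|M. cmod (indicator U (x - q n) *\<^sub>R c - indicator U x *\<^sub>R c))
       = (LINT x|M. cmod c * (indicat_real U (x - q n) + indicat_real U x - 2 * b n x))"
      by (intro Bochner_Integration.integral_cong) (auto simp: b_def indicator_def)
    also have "\<dots> = cmod c * ((LINT x|M. indicat_real U (x - q n)) + (LINT x|M. indicat_real U x) - 2 * (LINT x|M. b n x))"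
      using iU ib integrable_shift[OF iU] by simp
    also have "(LINT x|M. indicat_real U (x - q n)) = (LINT x|M. indicat_real U x)"
      by (rule integral_shift) measurable
    finally show ?thesis by simp
  qed
  ultimately show "(\<lambda>n. LINT x|M. cmod (indicator U (x - q n) *\<^sub>R c - indicator U x *\<^sub>R c)) \<longlonglongrightarrow> 0"
    by simp
qed

text \<open>Outer regularity reduces indicators of measurable sets to open sets of finite measure;
  sums follow from the triangle inequality and limits from
  \<open>L1_continuous_approx\<close>.\<close>

lemma L1_continuous: "integrable M (g :: 'g \<Rightarrow> complex) \<Longrightarrow> L1_continuous g"
proof (induction rule: integrable_induct)
  case (base A c)
  have iA: "integrable M (\<lambda>x. indicat_real A x *\<^sub>R c)"
    using base by (intro integrable_scaleR_left integrable_real_indicator) auto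
  show ?case
  proof (rule L1_continuous_approx[OF iA])
    fix e :: real assume e: "e > 0"
    \<comment> \<open>The error is at most |c| e'; the added 1 makes it strictly smaller than
      \<open>e\<close> and covers c = 0.\<close>
    define e' where "e' = e / (cmod c + 1)"
    have e': "e' > 0" using e by (simp add: e'_def add_nonneg_pos)
    have A: "A \<in> sets borel" using base by simp
    have "(INF U\<in>{U. open U \<and> A \<subseteq> U}. emeasure M U) = emeasure M A"
      by (rule haar_outer[OF haar_M A, symmetric])
    also have "\<dots> < emeasure M A + ennreal e'" using base(2) e'
      by (simp add: ennreal_add_left_cancel_less[where c=0, simplified] less_top)
    finally obtain U where U: "open U" "A \<subseteq> U" "emeasure M U < emeasure M A + ennreal e'"
      unfolding INF_less_iff by auto
    have fU: "emeasure M U < \<infinity>"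
      using U(3) base(2) by (metis ennreal_add_less_top ennreal_less_top infinity_ennreal_def less_trans)
    have [measurable]: "U \<in> sets borel" "A \<in> sets borel" using U A by auto
    have iU: "integrable M (\<lambda>x. indicat_real U x *\<^sub>R c)"
      using fU by (intro integrable_scaleR_left integrable_real_indicator) auto
    have "(LINT x|M. cmod (indicat_real A x *\<^sub>R c - indicat_real U x *\<^sub>R c)) = (LINT x|M. cmod c * indicat_real (U - A) x)"
      using U(2) by (intro Bochner_Integration.integral_cong) (auto simp: indicator_def)
    also have "\<dots> = cmod c * measure M (U - A)" by simp
    also have "measure M (U - A) = measure M U - measure M A"
      using fU base(2) U(2) by (intro measure_Diff) auto
    also have "measure M U < measure M A + e'"
    proof -
      have "ennreal (measure M U) < ennreal (measure M A + e')"
        using U(3) fU base(2) e' by (simp add: emeasure_eq_ennreal_measure less_top ennreal_plus)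
      then show ?thesis by (subst (asm) ennreal_less_iff) auto
    qed
    then have "cmod c * (measure M U - measure M A) \<le> cmod c * e'" by (intro mult_left_mono) auto
    also have "cmod c * e' < (cmod c + 1) * e'" using e' by simp
    also have "\<dots> = e"
    proof -
      have "cmod c + 1 \<noteq> 0" using norm_ge_zero[of c] by linarith
      then show ?thesis by (simp add: e'_def)
    qed
    finally show "\<exists>h. integrable M h \<and> L1_continuous h \<and> (LINT x|M. cmod (indicat_real A x *\<^sub>R c - h x)) < e"
      using iU L1_continuous_open[OF U(1) fU] by (intro exI[of _ "\<lambda>x. indicat_real U x *\<^sub>R c"]) auto
  qed
next
  case (add f g)
  have [measurable]: "f \<in> borel_measurable M" "g \<in> borel_measurable M" using add by auto
  show ?case unfolding L1_continuous_def
  proof (intro allI impI)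
    fix q :: "nat \<Rightarrow> 'g" assume q: "q \<longlonglongrightarrow> 0"
    have i: "integrable M (\<lambda>x. cmod (f (x - q n) - f x))" "integrable M (\<lambda>x. cmod (g (x - q n) - g x))" for n
      by (intro integrable_norm Bochner_Integration.integrable_diff integrable_shift add)+
    show "(\<lambda>n. LINT x|M. cmod ((f (x - q n) + g (x - q n)) - (f x + g x))) \<longlonglongrightarrow> 0"
    proof (rule Lim_null_comparison)
      show "(\<lambda>n. (LINT x|M. cmod (f (x - q n) - f x)) + (LINT x|M. cmod (g (x - q n) - g x))) \<longlonglongrightarrow> 0"
        using add.IH q by (intro tendsto_add_zero) (auto simp: L1_continuous_def)
      show "\<forall>\<^sub>F n in sequentially. norm (LINT x|M. cmod ((f (x - q n) + g (x - q n)) - (f x + g x)))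
         \<le> (LINT x|M. cmod (f (x - q n) - f x)) + (LINT x|M. cmod (g (x - q n) - g x))"
      proof (intro always_eventually allI)
        fix n
        have "(LINT x|M. cmod ((f (x - q n) + g (x - q n)) - (f x + g x)))
          \<le> (LINT x|M. cmod (f (x - q n) - f x) + cmod (g (x - q n) - g x))"
        proof (rule integral_mono)
          show "integrable M (\<lambda>x. cmod ((f (x - q n) + g (x - q n)) - (f x + g x)))"
            by (intro integrable_norm Bochner_Integration.integrable_diff Bochner_Integration.integrable_add integrable_shift add)
          show "cmod ((f (x - q n) + g (x - q n)) - (f x + g x)) \<le> cmod (f (x - q n) - f x) + cmod (g (x - q n) - g x)" for x
            by (simp add: add_diff_add norm_triangle_ineq)
        qed (use i in simp)
        then show "norm (LINT x|M. cmod ((f (x - q n) + g (x - q n)) - (f x + g x)))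
         \<le> (LINT x|M. cmod (f (x - q n) - f x)) + (LINT x|M. cmod (g (x - q n) - g x))"
          using i by simp
      qed
    qed
  qed
next
  case (lim f s)
  have [measurable]: "f \<in> borel_measurable M" "s i \<in> borel_measurable M" for i
    using lim.hyps(1,4) by (auto intro: borel_measurable_integrable)
  have "(\<lambda>i. LINT x|M. cmod (f x - s i x)) \<longlonglongrightarrow> (LINT x|M. 0)"
  proof (rule integral_dominated_convergence)
    \<comment> \<open>The induction provides |s i| \<le> 2 |f|, hence the dominating function 3
      |f|.\<close>
    show "integrable M (\<lambda>x. 3 * cmod (f x))" using lim.hyps(4) by simp
    show "AE x in M. (\<lambda>i. cmod (f x - s i x)) \<longlonglongrightarrow> 0"
    proof (rule AE_I2)
      fix x assume "x \<in> space M"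
      have "(\<lambda>i. cmod (f x - s i x)) \<longlonglongrightarrow> cmod (f x - f x)"
        by (intro tendsto_intros lim.hyps(2)) simp
      then show "(\<lambda>i. cmod (f x - s i x)) \<longlonglongrightarrow> 0" by simp
    qed
    show "AE x in M. norm (cmod (f x - s i x)) \<le> 3 * cmod (f x)" for i
    proof (rule AE_I2)
      fix x assume "x \<in> space M"
      from norm_triangle_ineq4[of "f x" "s i x"] lim.hyps(3)[OF this, of i]
      show "norm (cmod (f x - s i x)) \<le> 3 * cmod (f x)" by simp
    qed
  qed simp_all
  then have *: "(\<lambda>i. LINT x|M. cmod (f x - s i x)) \<longlonglongrightarrow> 0" by simp
  show ?case
  proof (rule L1_continuous_approx[OF lim.hyps(4)])
    fix e :: real assume "e > 0"
    from LIMSEQ_D[OF * this] obtain i where "(LINT x|M. cmod (f x - s i x)) < e" by auto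
    then show "\<exists>h. integrable M h \<and> L1_continuous h \<and> (LINT x|M. cmod (f x - h x)) < e"
      using lim.hyps(1)[of i] lim.IH[of i] by (intro exI[of _ "s i"] conjI)
  qed
qed

section \<open>Time-frequency shifts\<close>

text \<open>The function behind \<open>tf_shift\<close>. Functions, unlike classes, can be jointly
  measurable in the shift and the variable, which the Tonelli arguments require.\<close>

definition tfs :: "('g \<Rightarrow> complex) \<Rightarrow> 'g pontryagin_dual \<times> 'g \<Rightarrow> 'g \<Rightarrow> complex" where
  "tfs \<phi> z x = char_apply (fst z) (x - snd z) * \<phi> (x - snd z)"

text \<open>The function g = \<phi> |\<phi>| is integrable, so its translates converge in L1;
  \<open>cmod_diff_sq_le\<close> returns to \<phi>.\<close>

lemma l2_translation:
  assumes \<phi>: "square_integrable M \<phi>" and q: "q \<longlonglongrightarrow> 0"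
  shows "(\<lambda>n. l2_nrm M (\<lambda>x. \<phi> x - \<phi> (x - q n))) \<longlonglongrightarrow> 0"
proof -
  have [measurable]: "\<phi> \<in> borel_measurable M" using \<phi> by (simp add: square_integrable_def)
  define g where "g x = \<phi> x * of_real (cmod (\<phi> x))" for x
  have g: "integrable M g"
  proof (rule Bochner_Integration.integrable_bound)
    show "integrable M (\<lambda>x. (cmod (\<phi> x))\<^sup>2)" using \<phi> by (simp add: square_integrable_def)
    show "g \<in> borel_measurable M" unfolding g_def by measurable
  qed (simp add: g_def norm_mult power2_eq_square)
  have sq: "square_integrable M (\<lambda>x. \<phi> x - \<phi> (x - q n))" for n
  proof (rule square_integrable_diff[OF \<phi>])
    show "square_integrable M (\<lambda>x. \<phi> (x - q n))"
      using \<phi> integrable_shift[of "\<lambda>x. (cmod (\<phi> x))\<^sup>2"] by (simp add: square_integrable_def)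
  qed
  have "(\<lambda>n. (l2_nrm M (\<lambda>x. \<phi> x - \<phi> (x - q n)))\<^sup>2) \<longlonglongrightarrow> 0"
  proof (rule Lim_null_comparison)
    have "(\<lambda>n. LINT x|M. cmod (g (x - q n) - g x)) \<longlonglongrightarrow> 0"
      using L1_continuous[OF g] q by (simp add: L1_continuous_def)
    then show "(\<lambda>n. 2 * (LINT x|M. cmod (g (x - q n) - g x))) \<longlonglongrightarrow> 0"
      by (rule tendsto_mult_right_zero)
    show "\<forall>\<^sub>F n in sequentially. norm ((l2_nrm M (\<lambda>x. \<phi> x - \<phi> (x - q n)))\<^sup>2) \<le> 2 * (LINT x|M. cmod (g (x - q n) - g x))"
    proof (intro always_eventually allI)
      fix n
      have "(l2_nrm M (\<lambda>x. \<phi> x - \<phi> (x - q n)))\<^sup>2 \<le> (LINT x|M. 2 * cmod (g (x - q n) - g x))"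
        unfolding l2_nrm_sq
      proof (rule integral_mono)
        show "integrable M (\<lambda>x. (cmod (\<phi> x - \<phi> (x - q n)))\<^sup>2)" using sq[of n] by (simp add: square_integrable_def)
        show "integrable M (\<lambda>x. 2 * cmod (g (x - q n) - g x))"
          by (intro integrable_mult_right integrable_norm Bochner_Integration.integrable_diff integrable_shift g)
        show "(cmod (\<phi> x - \<phi> (x - q n)))\<^sup>2 \<le> 2 * cmod (g (x - q n) - g x)" for x
          unfolding g_def by (subst norm_minus_commute) (rule cmod_diff_sq_le)
      qed
      then show "norm ((l2_nrm M (\<lambda>x. \<phi> x - \<phi> (x - q n)))\<^sup>2) \<le> 2 * (LINT x|M. cmod (g (x - q n) - g x))"
        by simp
    qed
  qed
  from tendsto_real_sqrt[OF this] show ?thesis by simp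
qed

lemma tfs_square_integrable:
  assumes \<phi>: "square_integrable M \<phi>"
  shows "square_integrable M (tfs \<phi> z)"
proof -
  have [measurable]: "\<phi> \<in> borel_measurable M" using \<phi> by (simp add: square_integrable_def)
  have [measurable]: "char_apply p \<in> borel_measurable borel" for p :: "'g pontryagin_dual"
    by (rule borel_measurable_continuous_onI[OF continuous_char])
  have "tfs \<phi> z \<in> borel_measurable M" unfolding tfs_def by measurable
  moreover have "integrable M (\<lambda>x. (cmod (tfs \<phi> z x))\<^sup>2)"
    using \<phi> integrable_shift[of "\<lambda>x. (cmod (\<phi> x))\<^sup>2"] by (simp add: square_integrable_def tfs_def norm_mult)
  ultimately show ?thesis by (simp add: square_integrable_def)
qed

lemma tfs_nrm:
  assumes \<phi>: "\<phi> \<in> borel_measurable M"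
  shows "l2_nrm M (tfs \<phi> z) = l2_nrm M \<phi>"
proof -
  have [measurable]: "\<phi> \<in> borel_measurable M" by fact
  have "(LINT x|M. (cmod (\<phi> (x - snd z)))\<^sup>2) = (LINT x|M. (cmod (\<phi> x))\<^sup>2)"
    by (rule integral_shift[of "\<lambda>x. (cmod (\<phi> x))\<^sup>2"]) measurable
  then show ?thesis by (simp add: l2_nrm_def tfs_def norm_mult)
qed

text \<open>The compact-open topology controls characters only on compact sets. On
  \<open>Kg n\<close> the character is close to 1; off it, the factor |1 - p(x)|^2 is at most 4 and
  little of \<phi> is left.\<close>

lemma tfs_modulation_small:
  assumes \<phi>: "square_integrable M \<phi>" and e: "e > 0"
  shows "\<exists>U. open U \<and> 0 \<in> U \<and> (\<forall>p\<in>U. l2_nrm M (\<lambda>x. \<phi> x - char_apply p x * \<phi> x) < e)"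
proof -
  have [measurable]: "\<phi> \<in> borel_measurable M" using \<phi> by (simp add: square_integrable_def)
  have i\<phi>: "integrable M (\<lambda>x. (cmod (\<phi> x))\<^sup>2)" using \<phi> by (simp add: square_integrable_def)
  have [measurable]: "char_apply p \<in> borel_measurable borel" for p :: "'g pontryagin_dual"
    by (rule borel_measurable_continuous_onI[OF continuous_char])
  have [measurable]: "Kg n \<in> sets borel" for n by (rule closed_K)
  have "(\<lambda>n. LINT x|M. indicator (- Kg n) x * (cmod (\<phi> x))\<^sup>2) \<longlonglongrightarrow> (LINT x|M. 0)"
  proof (rule integral_dominated_convergence[OF _ _ i\<phi>])
    show "AE x in M. (\<lambda>n. indicator (- Kg n) x * (cmod (\<phi> x))\<^sup>2) \<longlonglongrightarrow> 0"
    proof (rule AE_I2)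
      fix x
      show "(\<lambda>n. indicator (- Kg n) x * (cmod (\<phi> x))\<^sup>2) \<longlonglongrightarrow> 0"
        by (rule tendsto_eventually, rule eventually_mono[OF ev_mem_Kg[of x]]) simp
    qed
  qed (auto simp: indicator_def)
  then have "(\<lambda>n. LINT x|M. indicator (- Kg n) x * (cmod (\<phi> x))\<^sup>2) \<longlonglongrightarrow> 0" by simp
  from LIMSEQ_D[OF this, of "e\<^sup>2/8"] e obtain n where
    n: "(LINT x|M. indicator (- Kg n) x * (cmod (\<phi> x))\<^sup>2) < e\<^sup>2/8" by auto
  define A where "A = (l2_nrm M \<phi>)\<^sup>2"
  \<comment> \<open>Half of e^2 goes to each region: 4 (e^2/8) off \<open>Kg n\<close> and at most
    \<eta>^2 A on it. The added 1 covers \<phi> = 0.\<close>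
  define \<eta> where "\<eta> = sqrt (e\<^sup>2 / (2 * (A + 1)))"
  have A: "A \<ge> 0" by (simp add: A_def)
  have \<eta>: "\<eta> > 0" using e A by (simp add: \<eta>_def)
  have \<eta>2: "\<eta>\<^sup>2 = e\<^sup>2 / (2 * (A + 1))" using e A by (simp add: \<eta>_def)
  define U :: "'g pontryagin_dual set" where "U = {p. char_apply p ` Kg n \<subseteq> ball 1 \<eta>}"
  have "open U" unfolding U_def by (rule open_char_image[OF compact_Kg]) simp
  moreover have "0 \<in> U" unfolding U_def using \<eta> by (auto simp: zero_pontryagin_dual.rep_eq)
  moreover have "l2_nrm M (\<lambda>x. \<phi> x - char_apply p x * \<phi> x) < e" if p: "p \<in> U" for p
  proof (rule power2_less_imp_less)
    have i1: "integrable M (\<lambda>x. indicator (- Kg n) x * (cmod (\<phi> x))\<^sup>2)"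
      by (rule Bochner_Integration.integrable_bound[OF i\<phi>]) (auto simp: indicator_def)
    have bd: "(cmod (\<phi> x - char_apply p x * \<phi> x))\<^sup>2 \<le> 4 * (indicator (- Kg n) x * (cmod (\<phi> x))\<^sup>2) + \<eta>\<^sup>2 * (cmod (\<phi> x))\<^sup>2" for x
    proof -
      have eq: "(cmod (\<phi> x - char_apply p x * \<phi> x))\<^sup>2 = (cmod (1 - char_apply p x))\<^sup>2 * (cmod (\<phi> x))\<^sup>2"
        by (simp add: norm_mult[symmetric] power_mult_distrib[symmetric] left_diff_distrib)
      show ?thesis
      proof (cases "x \<in> Kg n")
        case True
        then have "cmod (1 - char_apply p x) \<le> \<eta>" using p by (auto simp: U_def dist_norm)
        then have "(cmod (1 - char_apply p x))\<^sup>2 \<le> \<eta>\<^sup>2" by (intro power_mono) auto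
        then show ?thesis unfolding eq using True by (simp add: mult_right_mono)
      next
        case False
        have "cmod (1 - char_apply p x) \<le> 2" using norm_triangle_ineq4[of 1 "char_apply p x"] by simp
        then have "(cmod (1 - char_apply p x))\<^sup>2 \<le> 2\<^sup>2" by (intro power_mono) auto
        then have "(cmod (1 - char_apply p x))\<^sup>2 * (cmod (\<phi> x))\<^sup>2 \<le> 4 * (cmod (\<phi> x))\<^sup>2" by (intro mult_right_mono) auto
        then show ?thesis unfolding eq using False by (simp add: add_increasing2)
      qed
    qed
    have "(l2_nrm M (\<lambda>x. \<phi> x - char_apply p x * \<phi> x))\<^sup>2
       \<le> (LINT x|M. 4 * (indicator (- Kg n) x * (cmod (\<phi> x))\<^sup>2) + \<eta>\<^sup>2 * (cmod (\<phi> x))\<^sup>2)"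
      unfolding l2_nrm_sq
    proof (rule integral_mono[OF _ _ bd])
      show i2: "integrable M (\<lambda>x. 4 * (indicator (- Kg n) x * (cmod (\<phi> x))\<^sup>2) + \<eta>\<^sup>2 * (cmod (\<phi> x))\<^sup>2)"
        using i1 i\<phi> by simp
      show "integrable M (\<lambda>x. (cmod (\<phi> x - char_apply p x * \<phi> x))\<^sup>2)"
      proof (rule Bochner_Integration.integrable_bound[OF i2])
        show "AE x in M. norm ((cmod (\<phi> x - char_apply p x * \<phi> x))\<^sup>2)
          \<le> norm (4 * (indicator (- Kg n) x * (cmod (\<phi> x))\<^sup>2) + \<eta>\<^sup>2 * (cmod (\<phi> x))\<^sup>2)"
          by (rule AE_I2) (use bd in \<open>simp add: abs_of_nonneg\<close>)
      qed measurable
    qed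
    also have "\<dots> = 4 * (LINT x|M. indicator (- Kg n) x * (cmod (\<phi> x))\<^sup>2) + \<eta>\<^sup>2 * A"
      using i1 i\<phi> by (simp add: A_def l2_nrm_sq)
    also have "\<dots> < 4 * (e\<^sup>2/8) + e\<^sup>2/2"
    proof (rule add_less_le_mono)
      show "\<eta>\<^sup>2 * A \<le> e\<^sup>2/2" using A by (simp add: \<eta>2 field_simps)
    qed (use n in simp)
    also have "\<dots> = e\<^sup>2" by simp
    finally show "(l2_nrm M (\<lambda>x. \<phi> x - char_apply p x * \<phi> x))\<^sup>2 < e\<^sup>2" .
  qed (use e in simp)
  ultimately show ?thesis by blast
qed

text \<open>Translation and modulation are made small separately, and a product neighbourhood of 0
  contains a ball of \<open>d\<close>.\<close>

lemma tfs_strongly_continuous: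
  assumes \<phi>: "square_integrable M \<phi>" and e: "e > 0"
  shows "\<exists>r>0. \<forall>z. d 0 z < r \<longrightarrow> l2_nrm M (\<lambda>x. \<phi> x - tfs \<phi> z x) < e"
proof -
  have [measurable]: "\<phi> \<in> borel_measurable M" using \<phi> by (simp add: square_integrable_def)
  have [measurable]: "char_apply p \<in> borel_measurable borel" for p :: "'g pontryagin_dual"
    by (rule borel_measurable_continuous_onI[OF continuous_char])
  from tfs_modulation_small[OF \<phi>, of "e/2"] e obtain U where
    U: "open U" "0 \<in> U" "\<And>p. p \<in> U \<Longrightarrow> l2_nrm M (\<lambda>x. \<phi> x - char_apply p x * \<phi> x) < e/2" by auto
  \<comment> \<open>Continuity along sequences becomes a neighbourhood statement by first
    countability; the restriction to \<open>UNIV\<close> only fits the form of the rule.\<close>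
  have "eventually (\<lambda>q. l2_nrm M (\<lambda>x. \<phi> x - \<phi> (x - q)) < e/2) (inf (nhds 0) (principal UNIV))"
  proof (rule sequentially_imp_eventually_nhds_within, intro allI impI)
    fix q :: "nat \<Rightarrow> 'g" assume "(\<forall>n. q n \<in> UNIV) \<and> q \<longlonglongrightarrow> 0"
    then show "\<forall>\<^sub>F n in sequentially. l2_nrm M (\<lambda>x. \<phi> x - \<phi> (x - q n)) < e/2"
      using order_tendstoD(2)[OF l2_translation[OF \<phi>, of q], of "e/2"] e by simp
  qed
  then obtain V where V: "open V" "0 \<in> V" "\<And>q. q \<in> V \<Longrightarrow> l2_nrm M (\<lambda>x. \<phi> x - \<phi> (x - q)) < e/2"
    by (auto simp: eventually_nhds)
  have "open (U \<times> V)" using U V by (intro open_Times)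
  moreover have "0 \<in> U \<times> V" using U V by (simp add: zero_prod_def)
  ultimately obtain r where r: "r > 0" "\<And>z. d 0 z < r \<Longrightarrow> z \<in> U \<times> V"
    unfolding proper_invariant_metric_open[OF metric] by meson
  have "l2_nrm M (\<lambda>x. \<phi> x - tfs \<phi> z x) < e" if "d 0 z < r" for z
  proof -
    have pq: "fst z \<in> U" "snd z \<in> V" using r(2)[OF that] by (simp_all add: mem_Times_iff)
    have sq1: "square_integrable M (\<lambda>x. \<phi> (x - snd z))"
      using tfs_square_integrable[OF \<phi>, of "(0, snd z)"]
      by (simp add: tfs_def[abs_def] zero_pontryagin_dual.rep_eq)
    have "l2_nrm M (\<lambda>x. \<phi> x - tfs \<phi> z x)
        \<le> l2_nrm M (\<lambda>x. \<phi> x - \<phi> (x - snd z)) + l2_nrm M (\<lambda>x. \<phi> (x - snd z) - tfs \<phi> z x)"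
      by (rule l2_dist_triangle[OF \<phi> sq1 tfs_square_integrable[OF \<phi>]])
    \<comment> \<open>Translation invariance removes the common shift and leaves a pure modulation
      of \<phi>.\<close>
    also have "l2_nrm M (\<lambda>x. \<phi> (x - snd z) - tfs \<phi> z x) = l2_nrm M (\<lambda>x. \<phi> x - char_apply (fst z) x * \<phi> x)"
      unfolding l2_nrm_def tfs_def
      by (rule arg_cong[where f=sqrt], rule integral_shift[of "\<lambda>x. (cmod (\<phi> x - char_apply (fst z) x * \<phi> x))\<^sup>2"]) measurable
    finally show ?thesis using U(3)[OF pq(1)] V(3)[OF pq(2)] by simp
  qed
  with r(1) show ?thesis by (intro exI[of _ r] conjI allI impI)
qed

section \<open>Joint measurability, the short-time Fourier transform and the Moyal identity\<close>

lemma measurable_tfs [measurable (raw)]: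
  assumes [measurable]: "\<phi> \<in> borel_measurable M" "f \<in> measurable L P" "g \<in> measurable L M"
  shows "(\<lambda>x. tfs \<phi> (f x) (g x)) \<in> borel_measurable L"
proof -
  have [measurable]: "(\<lambda>x. fst (f x)) \<in> borel_measurable L" "(\<lambda>x. snd (f x)) \<in> borel_measurable L"
    "g \<in> borel_measurable L"
    using measurable_compose[OF assms(2) measurable_fst] measurable_compose[OF assms(2) measurable_snd] assms(3)
    by (simp_all cong: measurable_cong_sets)
  show ?thesis unfolding tfs_def
    by (intro borel_measurable_times measurable_char_joint) measurable
qed

text \<open>The short-time Fourier transform of \<open>f\<close>. The window is an argument because
  \<phi>_z and \<phi> - \<phi>_z also occur as windows.\<close>

definition stft :: "('g \<Rightarrow> complex) \<Rightarrow> ('g \<Rightarrow> complex) \<Rightarrow> 'g pontryagin_dual \<times> 'g \<Rightarrow> complex" where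
  "stft \<phi> f z = l2_ip M f (tfs \<phi> z)"

lemma measurable_l2_ip [measurable (raw)]:
  assumes [measurable]: "case_prod f \<in> borel_measurable (L \<Otimes>\<^sub>M M)" "case_prod g \<in> borel_measurable (L \<Otimes>\<^sub>M M)"
  shows "(\<lambda>x. l2_ip M (f x) (g x)) \<in> borel_measurable L"
  unfolding l2_ip_def by measurable

lemma measurable_stft [measurable (raw)]:
  assumes [measurable]: "\<phi> \<in> borel_measurable M" "f \<in> borel_measurable M" "w \<in> measurable L P"
  shows "(\<lambda>x. stft \<phi> f (w x)) \<in> borel_measurable L"
  unfolding stft_def by measurable

lemma stft_bound:
  assumes "square_integrable M \<phi>" "square_integrable M f"
  shows "cmod (stft \<phi> f z) \<le> l2_nrm M f * l2_nrm M \<phi>"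
  using l2_ip_CS[OF assms(2) tfs_square_integrable[OF assms(1)], of z] assms(1)
  by (simp add: stft_def tfs_nrm square_integrable_measurable)

lemma stft_diff_left:
  assumes "square_integrable M \<phi>" "square_integrable M f" "square_integrable M g"
  shows "stft \<phi> (\<lambda>x. f x - g x) z = stft \<phi> f z - stft \<phi> g z"
  unfolding stft_def by (rule l2_ip_diff_left[OF assms(2,3) tfs_square_integrable[OF assms(1)]])

lemma stft_add_left:
  assumes "square_integrable M \<phi>" "square_integrable M f" "square_integrable M g"
  shows "stft \<phi> (\<lambda>x. f x + g x) z = stft \<phi> f z + stft \<phi> g z"
  unfolding stft_def by (rule l2_ip_add_left[OF assms(2,3) tfs_square_integrable[OF assms(1)]])

lemma stft_scale_left: "stft \<phi> (\<lambda>x. c * f x) z = c * stft \<phi> f z"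
  unfolding stft_def by (rule l2_ip_scale_left)

lemma cmod_stft_fourier:
  assumes "square_integrable M \<phi>" "square_integrable M f"
  shows "cmod (stft \<phi> f (p, q)) = cmod (fourier M (\<lambda>x. f x * cnj (\<phi> (x - q))) p)"
proof -
  have *: "char_apply p (x - q) = char_apply p (- q) * char_apply p x" for x
    using char_add[of p "-q" x] by simp
  have "stft \<phi> f (p, q) = (LINT x|M. cnj (char_apply p (-q)) * (f x * cnj (\<phi> (x - q)) * cnj (char_apply p x)))"
    unfolding stft_def l2_ip_def tfs_def
    by (rule Bochner_Integration.integral_cong) (simp_all add: * mult_ac)
  also have "\<dots> = cnj (char_apply p (-q)) * fourier M (\<lambda>x. f x * cnj (\<phi> (x - q))) p"
    unfolding fourier_def by simp
  finally show ?thesis by (simp add: norm_mult)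
qed

text \<open>For fixed q, V f(p, q) is up to a phase the Fourier transform of \<open>h q\<close>, so
  Plancherel turns the integral over p into one over x, and Tonelli separates f from \<phi>.
  Plancherel is available on the intersection of L1 and L2: \<open>h q\<close> is integrable as a
  product of square-integrable functions, and square integrable for almost every q because the total
  is finite.\<close>

lemma moyal:
  assumes \<phi>: "square_integrable M \<phi>" and f: "square_integrable M f"
  shows "(\<integral>\<^sup>+z. ennreal ((cmod (stft \<phi> f z))\<^sup>2) \<partial>P) = ennreal ((l2_nrm M f * l2_nrm M \<phi>)\<^sup>2)"
proof -
  have [measurable]: "\<phi> \<in> borel_measurable M" "f \<in> borel_measurable M"
    using \<phi> f by (simp_all add: square_integrable_def)
  interpret MM: pair_sigma_finite M M ..
  define h where "h q x = f x * cnj (\<phi> (x - q))" for q x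
  have [measurable]: "h q \<in> borel_measurable M" for q unfolding h_def by measurable
  have "(\<integral>\<^sup>+q. \<integral>\<^sup>+x. ennreal ((cmod (h q x))\<^sup>2) \<partial>M \<partial>M)
      = (\<integral>\<^sup>+q. \<integral>\<^sup>+x. ennreal ((cmod (f (q + x)))\<^sup>2) * ennreal ((cmod (\<phi> x))\<^sup>2) \<partial>M \<partial>M)"
  proof (rule nn_integral_cong)
    fix q
    have "(\<integral>\<^sup>+x. ennreal ((cmod (h q x))\<^sup>2) \<partial>M) = (\<integral>\<^sup>+x. ennreal ((cmod (h q (q + x)))\<^sup>2) \<partial>M)"
      by (rule nn_integral_translate_M[symmetric]) measurable
    also have "\<dots> = (\<integral>\<^sup>+x. ennreal ((cmod (f (q + x)))\<^sup>2) * ennreal ((cmod (\<phi> x))\<^sup>2) \<partial>M)"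
      by (simp add: h_def norm_mult power_mult_distrib ennreal_mult)
    finally show "(\<integral>\<^sup>+x. ennreal ((cmod (h q x))\<^sup>2) \<partial>M)
      = (\<integral>\<^sup>+x. ennreal ((cmod (f (q + x)))\<^sup>2) * ennreal ((cmod (\<phi> x))\<^sup>2) \<partial>M)" .
  qed
  also have "\<dots> = (\<integral>\<^sup>+x. \<integral>\<^sup>+q. ennreal ((cmod (f (q + x)))\<^sup>2) * ennreal ((cmod (\<phi> x))\<^sup>2) \<partial>M \<partial>M)"
  proof (rule MM.Fubini'[symmetric])
    have eq: "(\<lambda>(q, x). ennreal ((cmod (f (q + x)))\<^sup>2) * ennreal ((cmod (\<phi> x))\<^sup>2))
       = (\<lambda>(q, x). ennreal ((cmod (f (q - (0 - x))))\<^sup>2) * ennreal ((cmod (\<phi> x))\<^sup>2))"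
      by simp
    show "(\<lambda>(q, x). ennreal ((cmod (f (q + x)))\<^sup>2) * ennreal ((cmod (\<phi> x))\<^sup>2)) \<in> borel_measurable (M \<Otimes>\<^sub>M M)"
      unfolding eq by measurable
  qed
  also have "\<dots> = (\<integral>\<^sup>+x. ennreal ((l2_nrm M f)\<^sup>2) * ennreal ((cmod (\<phi> x))\<^sup>2) \<partial>M)"
  proof (rule nn_integral_cong)
    fix x
    have m: "(\<lambda>q. ennreal ((cmod (f (q + x)))\<^sup>2)) \<in> borel_measurable M"
    proof -
      have "(\<lambda>q. ennreal ((cmod (f (q - (0 - x))))\<^sup>2)) \<in> borel_measurable M" by measurable
      then show ?thesis by simp
    qed
    have "(\<integral>\<^sup>+q. ennreal ((cmod (f (q + x)))\<^sup>2) \<partial>M) = (\<integral>\<^sup>+q. ennreal ((cmod (f q))\<^sup>2) \<partial>M)"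
      using nn_integral_translate_M[of "\<lambda>q. ennreal ((cmod (f q))\<^sup>2)" x] by (simp add: add.commute)
    then show "(\<integral>\<^sup>+q. ennreal ((cmod (f (q + x)))\<^sup>2) * ennreal ((cmod (\<phi> x))\<^sup>2) \<partial>M)
       = ennreal ((l2_nrm M f)\<^sup>2) * ennreal ((cmod (\<phi> x))\<^sup>2)"
      by (subst nn_integral_multc[OF m]) (simp add: nn_integral_sq_eq[OF f])
  qed
  also have "\<dots> = ennreal ((l2_nrm M f)\<^sup>2) * ennreal ((l2_nrm M \<phi>)\<^sup>2)"
    by (subst nn_integral_cmult) (simp_all add: nn_integral_sq_eq[OF \<phi>])
  also have "\<dots> = ennreal ((l2_nrm M f * l2_nrm M \<phi>)\<^sup>2)"
    by (simp add: ennreal_mult power_mult_distrib)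
  finally have total: "(\<integral>\<^sup>+q. \<integral>\<^sup>+x. ennreal ((cmod (h q x))\<^sup>2) \<partial>M \<partial>M) = ennreal ((l2_nrm M f * l2_nrm M \<phi>)\<^sup>2)" .
  have hm: "(\<lambda>q. \<integral>\<^sup>+x. ennreal ((cmod (h q x))\<^sup>2) \<partial>M) \<in> borel_measurable M"
    unfolding h_def by measurable
  have "AE q in M. (\<integral>\<^sup>+x. ennreal ((cmod (h q x))\<^sup>2) \<partial>M) \<noteq> \<infinity>"
    by (rule nn_integral_noteq_infinite[OF hm]) (simp add: total)
  then have ae: "AE q in M. (\<integral>\<^sup>+p. ennreal ((cmod (stft \<phi> f (p, q)))\<^sup>2) \<partial>N) = (\<integral>\<^sup>+x. ennreal ((cmod (h q x))\<^sup>2) \<partial>M)"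
  proof eventually_elim
    case (elim q)
    have "square_integrable M (\<lambda>x. \<phi> (x - q))"
      using \<phi> integrable_shift[of "\<lambda>x. (cmod (\<phi> x))\<^sup>2"] by (simp add: square_integrable_def)
    then have "integrable M (h q)" unfolding h_def by (rule square_integrable_prod(2)[OF f])
    moreover have "square_integrable M (h q)"
      using elim by (simp add: square_integrable_iff_nn less_top)
    ultimately show ?case
      using plancherel unfolding plancherel_measure_def cmod_stft_fourier[OF \<phi> f] h_def by blast
  qed
  have "(\<integral>\<^sup>+z. ennreal ((cmod (stft \<phi> f z))\<^sup>2) \<partial>P)
      = (\<integral>\<^sup>+q. \<integral>\<^sup>+p. ennreal ((cmod (stft \<phi> f (p, q)))\<^sup>2) \<partial>N \<partial>M)"
    by (rule NM.nn_integral_snd[symmetric]) measurable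
  also have "\<dots> = (\<integral>\<^sup>+q. \<integral>\<^sup>+x. ennreal ((cmod (h q x))\<^sup>2) \<partial>M \<partial>M)"
    by (rule nn_integral_cong_AE[OF ae])
  finally show ?thesis using total by simp
qed

lemma stft_square_integrable:
  assumes \<phi>: "square_integrable M \<phi>" and f: "square_integrable M f"
  shows "square_integrable P (stft \<phi> f)" "l2_nrm P (stft \<phi> f) = l2_nrm M f * l2_nrm M \<phi>"
proof -
  have [measurable]: "\<phi> \<in> borel_measurable M" "f \<in> borel_measurable M"
    using \<phi> f by (simp_all add: square_integrable_def)
  show sq: "square_integrable P (stft \<phi> f)"
    unfolding square_integrable_iff_nn moyal[OF assms] by simp
  have "(l2_nrm P (stft \<phi> f))\<^sup>2 = (l2_nrm M f * l2_nrm M \<phi>)\<^sup>2"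
    using moyal[OF assms] unfolding nn_integral_sq_eq[OF sq] by (subst (asm) ennreal_inj) auto
  then show "l2_nrm P (stft \<phi> f) = l2_nrm M f * l2_nrm M \<phi>"
    by (simp add: power2_eq_iff_nonneg)
qed

text \<open>Time-frequency shifts form a projective representation: they compose up to a phase,
  which disappears in the moduli used later.\<close>

lemma tfs_add: "tfs \<phi> (w + z) x = char_apply (fst w) (- snd z) * tfs (tfs \<phi> z) w x"
proof -
  have "char_apply (fst w) (x - (snd w + snd z)) = char_apply (fst w) (- snd z) * char_apply (fst w) (x - snd w)"
    using char_add[of "fst w" "- snd z" "x - snd w"] by (simp add: algebra_simps)
  then show ?thesis
    by (simp add: tfs_def plus_pontryagin_dual.rep_eq diff_diff_eq mult_ac)
qed

lemma cmod_stft_add: "cmod (stft \<phi> f (w + z)) = cmod (stft (tfs \<phi> z) f w)"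
proof -
  have "tfs \<phi> (w + z) = (\<lambda>x. char_apply (fst w) (- snd z) * tfs (tfs \<phi> z) w x)"
    by (rule ext) (rule tfs_add)
  then show ?thesis unfolding stft_def by (simp add: l2_ip_scale_right norm_mult)
qed

text \<open>The window splits as \<phi>_z + (\<phi> - \<phi>_z). The remainder is again a transform
  of \<open>f\<close>, so \<open>stft_bound\<close> estimates it uniformly in w and
  \<open>moyal\<close> in the mean.\<close>

lemma stft_translation_bound:
  assumes \<phi>: "square_integrable M \<phi>" and f: "square_integrable M f"
  shows "cmod (stft \<phi> f w) \<le> cmod (stft \<phi> f (w + z)) + cmod (stft (\<lambda>x. \<phi> x - tfs \<phi> z x) f w)"
proof -
  have "tfs (\<lambda>x. \<phi> x - tfs \<phi> z x) w = (\<lambda>x. tfs \<phi> w x - tfs (tfs \<phi> z) w x)"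
    by (rule ext) (simp add: tfs_def right_diff_distrib)
  then have "stft (\<lambda>x. \<phi> x - tfs \<phi> z x) f w = stft \<phi> f w - stft (tfs \<phi> z) f w"
    unfolding stft_def using l2_ip_diff_right[OF tfs_square_integrable[OF \<phi>] tfs_square_integrable[OF tfs_square_integrable[OF \<phi>]] f]
    by simp
  then show ?thesis
    unfolding cmod_stft_add using norm_triangle_sub[of "stft \<phi> f w" "stft (tfs \<phi> z) f w"] by simp
qed

lemma l2_ip_tfs:
  assumes [measurable]: "f \<in> borel_measurable M" "g \<in> borel_measurable M"
  shows "l2_ip M (tfs f w) (tfs g w) = l2_ip M f g"
proof -
  have "l2_ip M (tfs f w) (tfs g w) = (LINT x|M. f (x - snd w) * cnj (g (x - snd w)))"
    unfolding l2_ip_def tfs_def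
  proof (rule Bochner_Integration.integral_cong)
    fix x
    have "char_apply (fst w) (x - snd w) * f (x - snd w) * cnj (char_apply (fst w) (x - snd w) * g (x - snd w))
      = (char_apply (fst w) (x - snd w) * cnj (char_apply (fst w) (x - snd w))) * (f (x - snd w) * cnj (g (x - snd w)))"
      by simp
    then show "char_apply (fst w) (x - snd w) * f (x - snd w) * cnj (char_apply (fst w) (x - snd w) * g (x - snd w))
      = f (x - snd w) * cnj (g (x - snd w))" by (simp only: char_mult_cnj mult_1)
  qed simp
  also have "\<dots> = l2_ip M f g"
    unfolding l2_ip_def by (rule integral_shift[of "\<lambda>x. f x * cnj (g x)"]) measurable
  finally show ?thesis .
qed

text \<open>The common shift by \<open>w\<close> cancels up to a phase, so the value does not depend
  on \<open>w\<close>. This makes the averaging argument uniform in \<open>w\<close>.\<close>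

lemma cmod_stft_tfs:
  assumes \<phi>: "\<phi> \<in> borel_measurable M"
  shows "cmod (stft \<phi> (tfs \<phi> w) (w + z)) = cmod (l2_ip M \<phi> (tfs \<phi> z))"
proof -
  have [measurable]: "\<phi> \<in> borel_measurable M" by fact
  have "tfs \<phi> z \<in> borel_measurable M"
    using measurable_tfs[OF \<phi> measurable_const[of z P] measurable_ident] by (simp add: space_pair_measure comp_def)
  then show ?thesis unfolding cmod_stft_add unfolding stft_def by (simp add: l2_ip_tfs[OF \<phi>])
qed

section \<open>Small neighbourhoods of 0 and decay of transforms at infinity\<close>

lemma open_d_ball: "open {z. d 0 z < r}"
  unfolding proper_invariant_metric_open[OF metric]
proof
  fix x assume x: "x \<in> {z. d 0 z < r}"
  have "y \<in> {z. d 0 z < r}" if "d x y < r - d 0 x" for y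
  proof -
    have "d 0 y \<le> d 0 x + d x y" by (rule d.triangle) simp_all
    then show ?thesis using that by simp
  qed
  moreover have "r - d 0 x > 0" using x by simp
  ultimately show "\<exists>s>0. \<forall>y. d x y < s \<longrightarrow> y \<in> {z. d 0 z < r}"
    by (intro exI[of _ "r - d 0 x"] conjI allI impI)
qed

text \<open>An open box inside a ball is taken, since a box is measurable for the product of the
  Borel algebras. Its measure is positive by \<open>haar_open_pos\<close> and finite because the
  unit ball lies in \<open>KK 1\<close>.\<close>

lemma nhd_exists:
  assumes \<phi>: "square_integrable M \<phi>" and e: "e > 0"
  shows "\<exists>W\<in>sets P. 0 < emeasure P W \<and> emeasure P W < \<infinity> \<and>
    (\<forall>z\<in>W. d 0 z < 1 \<and> l2_nrm M (\<lambda>x. \<phi> x - tfs \<phi> z x) < e)"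
proof -
  obtain r where r: "r > 0" "\<forall>z. d 0 z < r \<longrightarrow> l2_nrm M (\<lambda>x. \<phi> x - tfs \<phi> z x) < e"
    using tfs_strongly_continuous[OF \<phi> e] by (elim exE conjE)
  define B where "B = {z. d 0 z < r} \<inter> {z. d 0 z < 1}"
  have "open B" unfolding B_def by (intro open_Int open_d_ball)
  moreover have "0 \<in> B" using r(1) by (simp add: B_def)
  ultimately obtain U V where UV: "open U" "open V" "0 \<in> U \<times> V" "U \<times> V \<subseteq> B"
    by (rule open_prod_elim)
  have [measurable]: "U \<in> sets N" "V \<in> sets M" using UV by simp_all
  have eq: "emeasure P (U \<times> V) = emeasure N U * emeasure M V"
    by (rule M.emeasure_pair_measure_Times) measurable
  have ne: "U \<noteq> {}" "V \<noteq> {}" using UV(3) by auto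
  have pos: "emeasure P (U \<times> V) > 0"
    using haar_open_pos[OF haar_N continuous_add_N UV(1) ne(1)] haar_open_pos[OF haar_M continuous_add_M UV(2) ne(2)]
    unfolding eq by (simp add: ennreal_zero_less_mult_iff)
  have B: "d 0 z < r" "d 0 z < 1" if "z \<in> U \<times> V" for z
    using subsetD[OF UV(4) that] by (simp_all only: B_def Int_iff mem_Collect_eq)
  have "U \<times> V \<subseteq> KK 1"
  proof
    fix z assume "z \<in> U \<times> V"
    from B(2)[OF this] show "z \<in> KK 1" by (intro mem_KK) simp
  qed
  then have "emeasure P (U \<times> V) \<le> emeasure P (KK 1)" by (intro emeasure_mono) measurable
  then have fin: "emeasure P (U \<times> V) < \<infinity>" using emeasure_KK[of 1] by (rule le_less_trans)
  have "U \<times> V \<in> sets P" by measurable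
  with pos fin show ?thesis
    using B r(2) by (intro bexI[of _ "U \<times> V"] conjI ballI) blast+
qed

lemma tail_to_0:
  fixes g :: "'g pontryagin_dual \<times> 'g \<Rightarrow> real"
  assumes g: "integrable P g"
  shows "(\<lambda>n. LINT z|P. indicator (- KK n) z * g z) \<longlonglongrightarrow> 0"
proof -
  have [measurable]: "g \<in> borel_measurable P" using g by simp
  have "(\<lambda>n. LINT z|P. indicator (- KK n) z * g z) \<longlonglongrightarrow> (LINT z|P. 0)"
  proof (rule integral_dominated_convergence)
    show "integrable P (\<lambda>z. \<bar>g z\<bar>)" using g by simp
    show "AE z in P. (\<lambda>n. indicator (- KK n) z * g z) \<longlonglongrightarrow> 0"
    proof (rule AE_I2)
      fix z
      show "(\<lambda>n. indicator (- KK n) z * g z) \<longlonglongrightarrow> 0"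
        by (rule tendsto_eventually, rule eventually_mono[OF ev_mem_KK[of z]]) simp
    qed
    show "AE z in P. norm (indicator (- KK n) z * g z) \<le> \<bar>g z\<bar>" for n
      by (rule AE_I2) (simp add: indicator_def)
    have "- KK n \<in> sets P" for n using sets.compl_sets[OF KK_sets[of n]] by (simp add: space_pair_measure Compl_eq_Diff_UNIV)
    then show "(\<lambda>z. indicator (- KK n) z * g z) \<in> borel_measurable P" for n by measurable
  qed measurable
  then show ?thesis by simp
qed

text \<open>If |V h| reaches e at w, then |V h| is at least e/2 on the translate w + W, whose mass
  does not depend on w. Far out this contradicts the smallness of the tail of the integral of |V
  h|^2.\<close>

lemma stft_vanishes_at_infinity:
  assumes \<phi>: "square_integrable M \<phi>" and h: "square_integrable M h" and e: "e > 0"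
  shows "\<exists>R. \<forall>w. d 0 w \<ge> R \<longrightarrow> cmod (stft \<phi> h w) < e"
proof -
  have [measurable]: "\<phi> \<in> borel_measurable M" "h \<in> borel_measurable M"
    using \<phi> h by (simp_all add: square_integrable_def)
  have compl [measurable]: "- KK n \<in> sets P" for n
    using sets.compl_sets[OF KK_sets[of n]] by (simp add: space_pair_measure Compl_eq_Diff_UNIV)
  \<comment> \<open>Chosen so that passing from w to w + z with z in \<open>W\<close> costs at most
    half of \<open>e\<close>; the added 1 covers h = 0.\<close>
  define \<epsilon> where "\<epsilon> = e / (2 * (l2_nrm M h + 1))"
  have hp: "l2_nrm M h + 1 > 0" by (simp add: add_nonneg_pos)
  then have \<epsilon>: "\<epsilon> > 0" using e by (simp add: \<epsilon>_def)
  have \<epsilon>h: "l2_nrm M h * \<epsilon> \<le> e/2"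
  proof -
    have "l2_nrm M h * \<epsilon> \<le> (l2_nrm M h + 1) * \<epsilon>" using \<epsilon> by simp
    also have "\<dots> = e/2" using hp unfolding \<epsilon>_def by (simp add: field_simps)
    finally show ?thesis .
  qed
  obtain W where W [measurable]: "W \<in> sets P" and Wpos: "emeasure P W > 0" "emeasure P W < \<infinity>"
    and W': "\<forall>z\<in>W. d 0 z < 1 \<and> l2_nrm M (\<lambda>x. \<phi> x - tfs \<phi> z x) < \<epsilon>"
    using nhd_exists[OF \<phi> \<epsilon>] by (elim bexE conjE)
  note W1 = W'[THEN bspec, THEN conjunct1] and We = W'[THEN bspec, THEN conjunct2]
  define m where "m = measure P W"
  have m1: "emeasure P W = ennreal m"
    unfolding m_def by (rule emeasure_eq_ennreal_measure) (use Wpos(2) in auto)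
  have m2: "m > 0" using Wpos(1) unfolding m1 by simp
  have i: "integrable P (\<lambda>z. (cmod (stft \<phi> h z))\<^sup>2)"
    using stft_square_integrable(1)[OF \<phi> h] by (simp add: square_integrable_def)
  have "(e/2)\<^sup>2 * m > 0" using e m2 by simp
  from LIMSEQ_D[OF tail_to_0[OF i] this] obtain n where
    n: "(LINT z|P. indicator (- KK n) z * (cmod (stft \<phi> h z))\<^sup>2) < (e/2)\<^sup>2 * m" by auto
  obtain R where R: "\<forall>w\<in>KK n. d 0 w < R" using KK_bounded[of n] by (rule exE)
  \<comment> \<open>\<open>W\<close> lies within distance 1 of 0, so beyond R + 1 the whole
    translate w + W stays outside \<open>KK n\<close>.\<close>
  have "cmod (stft \<phi> h w) < e" if w: "d 0 w \<ge> R + 1" for w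
  proof (rule ccontr)
    assume "\<not> cmod (stft \<phi> h w) < e"
    then have big: "cmod (stft \<phi> h w) \<ge> e" by simp
    define G where "G v = ennreal (indicator (- KK n) v * (cmod (stft \<phi> h v))\<^sup>2)" for v
    have [measurable]: "G \<in> borel_measurable P" unfolding G_def by measurable
    have Wz: "ennreal ((e/2)\<^sup>2) \<le> G (w + z)" if z: "z \<in> W" for z
    proof -
      have "d w (w + z) = d 0 z" using d_translate[of w 0 z] by simp
      moreover have "d 0 w \<le> d 0 (w + z) + d w (w + z)"
        using d.triangle[of 0 "w + z" w] d.commute[of w "w + z"] by simp
      ultimately have "d 0 (w + z) > R" using w W1[OF z] by linarith
      then have "w + z \<notin> KK n" using R by (meson less_asym)
      moreover have "cmod (stft (\<lambda>x. \<phi> x - tfs \<phi> z x) h w) \<le> l2_nrm M h * \<epsilon>"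
      proof (rule order_trans[OF stft_bound[OF square_integrable_diff[OF \<phi> tfs_square_integrable[OF \<phi>]] h]])
        show "l2_nrm M h * l2_nrm M (\<lambda>x. \<phi> x - tfs \<phi> z x) \<le> l2_nrm M h * \<epsilon>"
          using We[OF z] by (intro mult_left_mono) auto
      qed
      then have "e/2 \<le> cmod (stft \<phi> h (w + z))"
        using stft_translation_bound[OF \<phi> h, of w z] \<epsilon>h big by linarith
      then have "(e/2)\<^sup>2 \<le> (cmod (stft \<phi> h (w + z)))\<^sup>2" using e by (intro power_mono) auto
      ultimately show ?thesis by (simp add: G_def ennreal_leI)
    qed
    have "ennreal ((e/2)\<^sup>2 * m) = (\<integral>\<^sup>+z. ennreal ((e/2)\<^sup>2) * indicator W z \<partial>P)"
      using m2 by (subst nn_integral_cmult_indicator[OF W]) (simp add: m1 ennreal_mult)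
    also have "\<dots> \<le> (\<integral>\<^sup>+z. G (w + z) \<partial>P)"
      using Wz by (intro nn_integral_mono) (auto simp: indicator_def)
    also have "\<dots> = (\<integral>\<^sup>+z. G z \<partial>P)" by (rule nn_integral_translate_P) measurable
    also have "\<dots> = ennreal (LINT z|P. indicator (- KK n) z * (cmod (stft \<phi> h z))\<^sup>2)"
      unfolding G_def
    proof (rule nn_integral_eq_integral)
      show "integrable P (\<lambda>z. indicator (- KK n) z * (cmod (stft \<phi> h z))\<^sup>2)"
        by (rule Bochner_Integration.integrable_bound[OF i]) (measurable, simp add: indicator_def)
    qed simp
    also have "\<dots> < ennreal ((e/2)\<^sup>2 * m)"
      using n e m2 by (intro ennreal_lessI) auto
    finally show False by simp
  qed
  then show ?thesis by (intro exI[of _ "R + 1"] allI impI)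
qed

section \<open>The Berezin transform of the symbol\<close>

lemma space_P [simp]: "space P = UNIV"
  by (simp add: space_pair_measure)

lemma measurable_section:
  assumes "(\<lambda>(w, z). F w z) \<in> measurable (P \<Otimes>\<^sub>M P) L"
  shows "F w \<in> measurable P L"
  using measurable_compose[OF measurable_Pair1' assms, of w] by simp

text \<open>The function F of the overview, with extended values so that it matches the integral in
  \<open>thin\<close> and Tonelli applies without integrability conditions.\<close>

definition berezin :: "('g \<Rightarrow> complex) \<Rightarrow> ('g pontryagin_dual \<times> 'g \<Rightarrow> real) \<Rightarrow> 'g pontryagin_dual \<times> 'g \<Rightarrow> ennreal" where
  "berezin \<phi> \<sigma> v = (\<integral>\<^sup>+w. ennreal (\<sigma> w * (cmod (l2_ip M (tfs \<phi> w) (tfs \<phi> v)))\<^sup>2) \<partial>P)"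

lemma measurable_berezin [measurable]:
  assumes [measurable]: "\<phi> \<in> borel_measurable M" "\<sigma> \<in> borel_measurable P"
  shows "berezin \<phi> \<sigma> \<in> borel_measurable P"
  unfolding berezin_def by measurable

text \<open>In \<open>measurable_tfs\<close> the window is fixed; here it moves with the point, as
  the double integrals below require.\<close>

lemma measurable_tfs_tfs [measurable (raw)]:
  assumes [measurable]: "\<phi> \<in> borel_measurable M" "f \<in> measurable L P" "h \<in> measurable L P" "g \<in> measurable L M"
  shows "(\<lambda>x. tfs (tfs \<phi> (h x)) (f x) (g x)) \<in> borel_measurable L"
proof -
  have [measurable]: "(\<lambda>x. fst (f x)) \<in> borel_measurable L" "(\<lambda>x. snd (f x)) \<in> borel_measurable L"
    "g \<in> borel_measurable L"
    using measurable_compose[OF assms(2) measurable_fst] measurable_compose[OF assms(2) measurable_snd] assms(4)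
    by (simp_all cong: measurable_cong_sets)
  have g': "(\<lambda>x. g x - snd (f x)) \<in> measurable L M" by measurable
  have "(\<lambda>x. tfs \<phi> (h x) (g x - snd (f x))) \<in> borel_measurable L"
    by (rule measurable_tfs[OF assms(1,3) g'])
  moreover have "(\<lambda>x. char_apply (fst (f x)) (g x - snd (f x))) \<in> borel_measurable L"
    by (rule measurable_char_joint) measurable
  ultimately show ?thesis unfolding tfs_def[of "tfs \<phi> _"] by (rule borel_measurable_times[rotated])
qed

text \<open>
  The first summand on the right arises by replacing the indicator of \<open>W\<close> by the squared
  inner product of \<open>\<phi>\<close> with its shift by \<open>z\<close>, which equals that of the shifts by \<open>w\<close> and
  \<open>w + z\<close>; integrating in \<open>w\<close> then yields the Berezin transform.
\<close>

lemma stft_average_bound: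
  assumes \<phi>: "square_integrable M \<phi>" and f: "square_integrable M f"
    and \<sigma> [measurable]: "\<sigma> \<in> borel_measurable P" and \<sigma>01: "\<And>z. 0 \<le> \<sigma> z" "\<And>z. \<sigma> z \<le> 1"
    and W [measurable]: "W \<in> sets P"
    and We: "\<And>z. z \<in> W \<Longrightarrow> l2_nrm M (\<lambda>x. \<phi> x - tfs \<phi> z x) \<le> e"
    and c: "0 \<le> c" and Wc: "\<And>z. z \<in> W \<Longrightarrow> c \<le> (cmod (l2_ip M \<phi> (tfs \<phi> z)))\<^sup>2"
  shows "ennreal c * emeasure P W * (\<integral>\<^sup>+w. ennreal (\<sigma> w * (cmod (stft \<phi> f w))\<^sup>2) \<partial>P)
    \<le> 2 * (\<integral>\<^sup>+v. ennreal ((cmod (stft \<phi> f v))\<^sup>2) * berezin \<phi> \<sigma> v \<partial>P)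
      + ennreal (2 * c * (l2_nrm M f * e)\<^sup>2) * emeasure P W"
proof -
  have [measurable]: "\<phi> \<in> borel_measurable M" "f \<in> borel_measurable M"
    using \<phi> f by (simp_all add: square_integrable_def)
  \<comment> \<open>\<open>A\<close> and \<open>B\<close> are spelled out through \<open>tfs\<close>
    so that joint measurability in \<open>w\<close> and \<open>z\<close> follows from
    \<open>measurable_tfs_tfs\<close>; \<open>A_eq\<close> and \<open>B_eq\<close> restore the
    transforms.\<close>
  define A where "A w z = (cmod (l2_ip M f (tfs (tfs \<phi> z) w)))\<^sup>2" for w z
  define B where "B w z = (cmod (l2_ip M f (\<lambda>x. tfs \<phi> w x - tfs (tfs \<phi> z) w x)))\<^sup>2" for w z
  have [measurable]: "(\<lambda>(w, z). A w z) \<in> borel_measurable (P \<Otimes>\<^sub>M P)" "(\<lambda>(w, z). B w z) \<in> borel_measurable (P \<Otimes>\<^sub>M P)"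
    unfolding A_def B_def by measurable
  have B_eq: "B w z = (cmod (stft (\<lambda>x. \<phi> x - tfs \<phi> z x) f w))\<^sup>2" for w z
  proof -
    have "tfs (\<lambda>x. \<phi> x - tfs \<phi> z x) w = (\<lambda>x. tfs \<phi> w x - tfs (tfs \<phi> z) w x)"
      by (rule ext) (simp add: tfs_def right_diff_distrib)
    then show ?thesis by (simp add: B_def stft_def)
  qed
  have A_eq: "A w z = (cmod (stft \<phi> f (w + z)))\<^sup>2" for w z
    using cmod_stft_add[of \<phi> f w z] by (simp add: A_def stft_def)
  have pt: "(cmod (stft \<phi> f w))\<^sup>2 \<le> 2 * A w z + 2 * B w z" for w z
  proof -
    have "(cmod (stft \<phi> f w))\<^sup>2 \<le> (cmod (stft \<phi> f (w + z)) + cmod (stft (\<lambda>x. \<phi> x - tfs \<phi> z x) f w))\<^sup>2"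
      by (intro power_mono stft_translation_bound[OF \<phi> f]) simp
    also have "\<dots> \<le> 2 * (cmod (stft \<phi> f (w + z)))\<^sup>2 + 2 * (cmod (stft (\<lambda>x. \<phi> x - tfs \<phi> z x) f w))\<^sup>2"
      using zero_le_power2[of "cmod (stft \<phi> f (w + z)) - cmod (stft (\<lambda>x. \<phi> x - tfs \<phi> z x) f w)"]
      by (simp add: power2_eq_square algebra_simps)
    finally show ?thesis by (simp add: A_eq B_eq)
  qed
  define K where "K w v = \<sigma> w * (cmod (l2_ip M (tfs \<phi> w) (tfs \<phi> v)))\<^sup>2 * (cmod (stft \<phi> f v))\<^sup>2" for w v
  have [measurable]: "(\<lambda>(w, v). K w v) \<in> borel_measurable (P \<Otimes>\<^sub>M P)" "K w \<in> borel_measurable P" for w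
  proof -
    show "(\<lambda>(w, v). K w v) \<in> borel_measurable (P \<Otimes>\<^sub>M P)" unfolding K_def by measurable
    then show "K w \<in> borel_measurable P" by (rule measurable_section)
  qed
  define Q where "Q w z = ennreal (c * B w z) * indicator W z" for w z
  have [measurable]: "(\<lambda>(w, z). Q w z) \<in> borel_measurable (P \<Otimes>\<^sub>M P)" "Q w \<in> borel_measurable P" for w
  proof -
    show "(\<lambda>(w, z). Q w z) \<in> borel_measurable (P \<Otimes>\<^sub>M P)" unfolding Q_def by measurable
    then show "Q w \<in> borel_measurable P" by (rule measurable_section)
  qed
  have step: "ennreal c * emeasure P W * ennreal (\<sigma> w * (cmod (stft \<phi> f w))\<^sup>2)
      \<le> 2 * (\<integral>\<^sup>+v. ennreal (K w v) \<partial>P) + 2 * (\<integral>\<^sup>+z. Q w z \<partial>P)" for w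
  proof -
    define s where "s = \<sigma> w * (cmod (stft \<phi> f w))\<^sup>2"
    have s0: "0 \<le> s" using \<sigma>01 by (simp add: s_def)
    have "(\<lambda>z. K w (w + z)) = (\<lambda>z. \<sigma> w * (cmod (l2_ip M \<phi> (tfs \<phi> z)))\<^sup>2 * A w z)"
      using cmod_stft_tfs[of \<phi> w] by (intro ext) (simp add: K_def A_eq stft_def)
    then have KA: "K w (w + z) = \<sigma> w * (cmod (l2_ip M \<phi> (tfs \<phi> z)))\<^sup>2 * A w z" for z
      by (rule fun_cong)
    have "(\<lambda>(w, z). ennreal (\<sigma> w * (cmod (l2_ip M \<phi> (tfs \<phi> z)))\<^sup>2 * A w z)) \<in> borel_measurable (P \<Otimes>\<^sub>M P)"
      by measurable
    then have Km: "(\<lambda>z. ennreal (K w (w + z))) \<in> borel_measurable P"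
      unfolding KA by (rule measurable_section)
    have "ennreal c * emeasure P W * ennreal s = (\<integral>\<^sup>+z. ennreal (c * s) * indicator W z \<partial>P)"
      by (subst nn_integral_cmult_indicator[OF W]) (simp add: ennreal_mult c s0 mult_ac)
    also have "\<dots> \<le> (\<integral>\<^sup>+z. 2 * ennreal (K w (w + z)) + 2 * Q w z \<partial>P)"
    proof (rule nn_integral_mono)
      fix z
      show "ennreal (c * s) * indicator W z \<le> 2 * ennreal (K w (w + z)) + 2 * Q w z"
      proof (cases "z \<in> W")
        case True
        have A0: "0 \<le> A w z" "0 \<le> B w z" by (simp_all add: A_def B_def)
        have "s \<le> \<sigma> w * (2 * A w z + 2 * B w z)"
          unfolding s_def using \<sigma>01 by (intro mult_left_mono pt) auto
        \<comment> \<open>The weight \<sigma> is kept on the term with \<open>A\<close>, where it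
          builds the Berezin transform, and estimated by 1 on the term with \<open>B\<close>, where
          the unweighted Moyal identity is applied.\<close>
        also have "\<dots> \<le> 2 * (\<sigma> w * A w z) + 2 * B w z"
          using mult_right_mono[OF \<sigma>01(2)[of w] A0(2)] by (simp add: algebra_simps)
        finally have "c * s \<le> c * (2 * (\<sigma> w * A w z) + 2 * B w z)" using c by (rule mult_left_mono)
        also have "\<dots> = 2 * (\<sigma> w * c * A w z) + 2 * (c * B w z)" by (simp add: algebra_simps)
        also have "\<dots> \<le> 2 * K w (w + z) + 2 * (c * B w z)"
          unfolding KA using Wc[OF True] \<sigma>01 A0 by (intro add_right_mono mult_left_mono mult_right_mono) auto
        finally have "ennreal (c * s) \<le> ennreal (2 * K w (w + z) + 2 * (c * B w z))" by (rule ennreal_leI)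
        also have "\<dots> = 2 * ennreal (K w (w + z)) + 2 * Q w z"
          using True A0 c \<sigma>01 by (simp add: Q_def KA ennreal_plus ennreal_mult)
        finally show ?thesis using True by simp
      qed simp
    qed
    also have "\<dots> = 2 * (\<integral>\<^sup>+z. ennreal (K w (w + z)) \<partial>P) + 2 * (\<integral>\<^sup>+z. Q w z \<partial>P)"
      using Km by (simp add: nn_integral_add nn_integral_cmult)
    also have "(\<integral>\<^sup>+z. ennreal (K w (w + z)) \<partial>P) = (\<integral>\<^sup>+v. ennreal (K w v) \<partial>P)"
      by (rule nn_integral_translate_P) measurable
    finally show ?thesis by (simp add: s_def)
  qed
  have "ennreal c * emeasure P W * (\<integral>\<^sup>+w. ennreal (\<sigma> w * (cmod (stft \<phi> f w))\<^sup>2) \<partial>P)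
      = (\<integral>\<^sup>+w. ennreal c * emeasure P W * ennreal (\<sigma> w * (cmod (stft \<phi> f w))\<^sup>2) \<partial>P)"
    by (rule nn_integral_cmult[symmetric]) measurable
  also have "\<dots> \<le> (\<integral>\<^sup>+w. 2 * (\<integral>\<^sup>+v. ennreal (K w v) \<partial>P) + 2 * (\<integral>\<^sup>+z. Q w z \<partial>P) \<partial>P)"
    by (rule nn_integral_mono) (rule step)
  also have "\<dots> = 2 * (\<integral>\<^sup>+w. \<integral>\<^sup>+v. ennreal (K w v) \<partial>P \<partial>P) + 2 * (\<integral>\<^sup>+w. \<integral>\<^sup>+z. Q w z \<partial>P \<partial>P)"
    by (simp add: nn_integral_add nn_integral_cmult)
  also have "(\<integral>\<^sup>+w. \<integral>\<^sup>+v. ennreal (K w v) \<partial>P \<partial>P) = (\<integral>\<^sup>+v. \<integral>\<^sup>+w. ennreal (K w v) \<partial>P \<partial>P)"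
    by (rule PP.Fubini'[symmetric]) measurable
  also have "\<dots> = (\<integral>\<^sup>+v. ennreal ((cmod (stft \<phi> f v))\<^sup>2) * berezin \<phi> \<sigma> v \<partial>P)"
  proof (rule nn_integral_cong)
    fix v
    have "(\<integral>\<^sup>+w. ennreal (K w v) \<partial>P)
      = (\<integral>\<^sup>+w. ennreal ((cmod (stft \<phi> f v))\<^sup>2) * ennreal (\<sigma> w * (cmod (l2_ip M (tfs \<phi> w) (tfs \<phi> v)))\<^sup>2) \<partial>P)"
      using \<sigma>01 by (simp add: K_def ennreal_mult[symmetric] mult_ac)
    also have "\<dots> = ennreal ((cmod (stft \<phi> f v))\<^sup>2) * berezin \<phi> \<sigma> v"
      unfolding berezin_def
    proof (rule nn_integral_cmult)
      have "tfs \<phi> v \<in> borel_measurable M" using tfs_square_integrable[OF \<phi>] by (simp add: square_integrable_def)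
      then show "(\<lambda>w. ennreal (\<sigma> w * (cmod (l2_ip M (tfs \<phi> w) (tfs \<phi> v)))\<^sup>2)) \<in> borel_measurable P"
        by measurable
    qed
    finally show "(\<integral>\<^sup>+w. ennreal (K w v) \<partial>P) = ennreal ((cmod (stft \<phi> f v))\<^sup>2) * berezin \<phi> \<sigma> v" .
  qed
  \<comment> \<open>For fixed z in \<open>W\<close>, integrating \<open>Q\<close> over w is an
    instance of Moyal with the small window \<phi> - \<phi>_z.\<close>
  also have "(\<integral>\<^sup>+w. \<integral>\<^sup>+z. Q w z \<partial>P \<partial>P) = (\<integral>\<^sup>+z. \<integral>\<^sup>+w. Q w z \<partial>P \<partial>P)"
    by (rule PP.Fubini'[symmetric]) measurable
  also have "\<dots> \<le> (\<integral>\<^sup>+z. ennreal (c * (l2_nrm M f * e)\<^sup>2) * indicator W z \<partial>P)"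
  proof (rule nn_integral_mono)
    fix z
    show "(\<integral>\<^sup>+w. Q w z \<partial>P) \<le> ennreal (c * (l2_nrm M f * e)\<^sup>2) * indicator W z"
    proof (cases "z \<in> W")
      case True
      have sq: "square_integrable M (\<lambda>x. \<phi> x - tfs \<phi> z x)"
        by (intro square_integrable_diff \<phi> tfs_square_integrable)
      then have m: "(\<lambda>w. ennreal ((cmod (stft (\<lambda>x. \<phi> x - tfs \<phi> z x) f w))\<^sup>2)) \<in> borel_measurable P"
        by (intro measurable_compose[OF _ measurable_ennreal] borel_measurable_power borel_measurable_norm
            measurable_stft measurable_ident_sets square_integrable_measurable) (simp_all add: f)
      have "(\<integral>\<^sup>+w. Q w z \<partial>P) = (\<integral>\<^sup>+w. ennreal c * ennreal ((cmod (stft (\<lambda>x. \<phi> x - tfs \<phi> z x) f w))\<^sup>2) \<partial>P)"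
        using True c by (simp add: Q_def B_eq ennreal_mult)
      also have "\<dots> = ennreal c * ennreal ((l2_nrm M f * l2_nrm M (\<lambda>x. \<phi> x - tfs \<phi> z x))\<^sup>2)"
        by (subst nn_integral_cmult[OF m]) (simp add: moyal[OF sq f])
      also have "\<dots> \<le> ennreal c * ennreal ((l2_nrm M f * e)\<^sup>2)"
        using We[OF True] by (intro mult_left_mono ennreal_leI power_mono mult_left_mono) auto
      finally show ?thesis using True c by (simp add: ennreal_mult)
    qed (simp add: Q_def)
  qed
  also have "\<dots> = ennreal (c * (l2_nrm M f * e)\<^sup>2) * emeasure P W"
    by (rule nn_integral_cmult_indicator[OF W])
  finally show ?thesis
    using c by (simp add: ennreal_mult mult.assoc add_left_mono mult_left_mono)
qed

text \<open>Because \<sigma>^2 \<le> \<sigma>, the weight loses one power in the last estimate. The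
  norm that Cauchy-Schwarz produces in \<open>form_bound\<close> is thus controlled by the very
  integral treated in \<open>stft_average_bound\<close>.\<close>

lemma weighted_square_integrable:
  assumes \<phi>: "square_integrable M \<phi>" and f: "square_integrable M f"
    and [measurable]: "\<sigma> \<in> borel_measurable P" and \<sigma>01: "\<And>z. 0 \<le> \<sigma> z" "\<And>z. \<sigma> z \<le> (1::real)"
  shows "integrable P (\<lambda>z. \<sigma> z * (cmod (stft \<phi> f z))\<^sup>2)"
    and "square_integrable P (\<lambda>z. of_real (\<sigma> z) * stft \<phi> f z)"
    and "(l2_nrm P (\<lambda>z. of_real (\<sigma> z) * stft \<phi> f z))\<^sup>2 \<le> (LINT z|P. \<sigma> z * (cmod (stft \<phi> f z))\<^sup>2)"
proof -
  have i: "integrable P (\<lambda>z. (cmod (stft \<phi> f z))\<^sup>2)"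
    using stft_square_integrable(1)[OF \<phi> f] by (simp add: square_integrable_def)
  have [measurable]: "stft \<phi> f \<in> borel_measurable P"
    using stft_square_integrable(1)[OF \<phi> f] by (simp add: square_integrable_def)
  show i1: "integrable P (\<lambda>z. \<sigma> z * (cmod (stft \<phi> f z))\<^sup>2)"
  proof (rule Bochner_Integration.integrable_bound[OF i])
    show "AE z in P. norm (\<sigma> z * (cmod (stft \<phi> f z))\<^sup>2) \<le> norm ((cmod (stft \<phi> f z))\<^sup>2)"
      using \<sigma>01 by (intro AE_I2) (simp add: abs_mult abs_of_nonneg mult_left_le_one_le)
  qed measurable
  have le: "(cmod (of_real (\<sigma> z) * stft \<phi> f z))\<^sup>2 \<le> \<sigma> z * (cmod (stft \<phi> f z))\<^sup>2" for z
  proof -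
    have "(\<sigma> z)\<^sup>2 \<le> \<sigma> z" using \<sigma>01[of z] by (simp add: power2_eq_square mult_left_le_one_le)
    then show ?thesis using \<sigma>01[of z] by (simp add: norm_mult power_mult_distrib mult_right_mono)
  qed
  show sq: "square_integrable P (\<lambda>z. of_real (\<sigma> z) * stft \<phi> f z)"
    unfolding square_integrable_def
  proof
    show "integrable P (\<lambda>z. (cmod (of_real (\<sigma> z) * stft \<phi> f z))\<^sup>2)"
    proof (rule Bochner_Integration.integrable_bound[OF i1])
      show "AE z in P. norm ((cmod (of_real (\<sigma> z) * stft \<phi> f z))\<^sup>2) \<le> norm (\<sigma> z * (cmod (stft \<phi> f z))\<^sup>2)"
        using le \<sigma>01 by (intro AE_I2) (simp add: abs_of_nonneg)
    qed measurable
  qed measurable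
  show "(l2_nrm P (\<lambda>z. of_real (\<sigma> z) * stft \<phi> f z))\<^sup>2 \<le> (LINT z|P. \<sigma> z * (cmod (stft \<phi> f z))\<^sup>2)"
    unfolding l2_nrm_sq using sq i1 le by (intro integral_mono) (auto simp: square_integrable_def)
qed

lemma berezin_eq:
  assumes \<phi>: "square_integrable M \<phi>"
    and \<sigma>: "\<sigma> \<in> borel_measurable P" "\<And>z. 0 \<le> \<sigma> z" "\<And>z. \<sigma> z \<le> (1::real)"
  shows "berezin \<phi> \<sigma> w = ennreal (LINT z|P. \<sigma> z * (cmod (stft \<phi> (tfs \<phi> w) z))\<^sup>2)"
proof -
  have "cmod (l2_ip M (tfs \<phi> z) (tfs \<phi> w)) = cmod (stft \<phi> (tfs \<phi> w) z)" for z
    unfolding stft_def by (subst l2_ip_cnj[symmetric]) simp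
  then have "berezin \<phi> \<sigma> w = (\<integral>\<^sup>+z. ennreal (\<sigma> z * (cmod (stft \<phi> (tfs \<phi> w) z))\<^sup>2) \<partial>P)"
    by (simp add: berezin_def)
  also have "\<dots> = ennreal (LINT z|P. \<sigma> z * (cmod (stft \<phi> (tfs \<phi> w) z))\<^sup>2)"
    using \<sigma>(2) by (intro nn_integral_eq_integral weighted_square_integrable(1)[OF \<phi> tfs_square_integrable[OF \<phi>] \<sigma>] AE_I2) simp
  finally show ?thesis .
qed

text \<open>The fourth power arises because the window and the shifted \<phi> have the same norm and
  Moyal squares their product. The bound is used on a compact set, where thinness gives no
  smallness.\<close>

lemma berezin_le:
  assumes \<phi>: "square_integrable M \<phi>"
    and \<sigma>: "\<sigma> \<in> borel_measurable P" "\<And>z. 0 \<le> \<sigma> z" "\<And>z. \<sigma> z \<le> (1::real)"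
  shows "berezin \<phi> \<sigma> w \<le> ennreal ((l2_nrm M \<phi>)^4)"
proof -
  have "berezin \<phi> \<sigma> w \<le> (\<integral>\<^sup>+z. ennreal ((cmod (stft \<phi> (tfs \<phi> w) z))\<^sup>2) \<partial>P)"
    unfolding berezin_def
  proof (rule nn_integral_mono)
    fix z
    have "cmod (l2_ip M (tfs \<phi> z) (tfs \<phi> w)) = cmod (stft \<phi> (tfs \<phi> w) z)"
      unfolding stft_def by (subst l2_ip_cnj[symmetric]) simp
    then show "ennreal (\<sigma> z * (cmod (l2_ip M (tfs \<phi> z) (tfs \<phi> w)))\<^sup>2) \<le> ennreal ((cmod (stft \<phi> (tfs \<phi> w) z))\<^sup>2)"
      using \<sigma>(2,3) by (intro ennreal_leI) (simp add: mult_left_le_one_le)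
  qed
  also have "\<dots> = ennreal ((l2_nrm M \<phi>)^4)"
    unfolding moyal[OF \<phi> tfs_square_integrable[OF \<phi>]] using \<phi>
    by (simp add: tfs_nrm square_integrable_measurable power_mult_distrib flip: power_add)
  finally show ?thesis .
qed

section \<open>Sequences of transforms: local and weighted Cauchy estimates, convergent
  subsequences\<close>

lemma stft_local_Cauchy:
  assumes \<phi>: "square_integrable M \<phi>" and u: "\<And>n. square_integrable M (u n)" "\<And>n. l2_nrm M (u n) \<le> 1"
    and lim: "\<And>z. (\<lambda>n. stft \<phi> (u n) z) \<longlonglongrightarrow> v z" and e: "e > 0"
  shows "\<exists>n0. \<forall>m\<ge>n0. \<forall>n\<ge>n0. (LINT z|P. indicator (KK k) z * (cmod (stft \<phi> (\<lambda>x. u m x - u n x) z))\<^sup>2) \<le> e"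
proof -
  define A where "A = l2_nrm M \<phi>"
  have A: "A \<ge> 0" by (simp add: A_def)
  have [measurable]: "stft \<phi> (u n) \<in> borel_measurable P" for n
    using stft_square_integrable(1)[OF \<phi> u(1)] by (simp add: square_integrable_def)
  \<comment> \<open>The pointwise limit \<open>v\<close> is not known to be a transform, so it is
    only an intermediary: the differences are compared through it on \<open>KK k\<close>, where
    finite measure and the bound \<open>A\<close> permit dominated convergence.\<close>
  have [measurable]: "v \<in> borel_measurable P"
    by (rule borel_measurable_LIMSEQ_metric[OF _ lim]) measurable
  have ub: "cmod (stft \<phi> (u n) z) \<le> A" for n z
    using order_trans[OF stft_bound[OF \<phi> u(1)] mult_right_mono[OF u(2)]] by (simp add: A_def)
  have vb: "cmod (v z) \<le> A" for z
    using LIMSEQ_le_const2[OF tendsto_norm[OF lim]] ub by blast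
  have iK: "integrable P (indicat_real (KK k))"
    using emeasure_KK[of k] by (intro integrable_real_indicator KK_sets)
  have db: "indicator (KK k) z * (cmod (stft \<phi> (u n) z - v z))\<^sup>2 \<le> (4 * A\<^sup>2) * indicator (KK k) z" for n z
  proof -
    have "(cmod (stft \<phi> (u n) z - v z))\<^sup>2 \<le> (A + A)\<^sup>2"
      using norm_triangle_ineq4[of "stft \<phi> (u n) z" "v z"] ub[of n z] vb[of z] by (intro power_mono) auto
    then show ?thesis by (simp add: indicator_def power2_eq_square algebra_simps)
  qed
  have iD: "integrable P (\<lambda>z. indicator (KK k) z * (cmod (stft \<phi> (u n) z - v z))\<^sup>2)" for n
  proof (rule Bochner_Integration.integrable_bound)
    show "integrable P (\<lambda>z. (4 * A\<^sup>2) * indicat_real (KK k) z)" using iK by (rule integrable_mult_right)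
    show "AE z in P. norm (indicator (KK k) z * (cmod (stft \<phi> (u n) z - v z))\<^sup>2) \<le> norm ((4 * A\<^sup>2) * indicat_real (KK k) z)"
      using db[of _ n] by (intro AE_I2) (simp add: abs_of_nonneg)
  qed measurable
  have "(\<lambda>n. LINT z|P. indicator (KK k) z * (cmod (stft \<phi> (u n) z - v z))\<^sup>2) \<longlonglongrightarrow> (LINT z|P. 0)"
  proof (rule integral_dominated_convergence)
    show "integrable P (\<lambda>z. (4 * A\<^sup>2) * indicat_real (KK k) z)" using iK by (rule integrable_mult_right)
    show "AE z in P. (\<lambda>n. indicator (KK k) z * (cmod (stft \<phi> (u n) z - v z))\<^sup>2) \<longlonglongrightarrow> 0"
    proof (rule AE_I2)
      fix z
      have "(\<lambda>n. indicator (KK k) z * (cmod (stft \<phi> (u n) z - v z))\<^sup>2) \<longlonglongrightarrow> indicator (KK k) z * (cmod (v z - v z))\<^sup>2"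
        by (intro tendsto_intros lim)
      then show "(\<lambda>n. indicator (KK k) z * (cmod (stft \<phi> (u n) z - v z))\<^sup>2) \<longlonglongrightarrow> 0" by simp
    qed
    show "AE z in P. norm (indicator (KK k) z * (cmod (stft \<phi> (u n) z - v z))\<^sup>2) \<le> (4 * A\<^sup>2) * indicat_real (KK k) z" for n
      using db[of _ n] by (intro AE_I2) (simp add: abs_of_nonneg)
  qed measurable
  then have "(\<lambda>n. LINT z|P. indicator (KK k) z * (cmod (stft \<phi> (u n) z - v z))\<^sup>2) \<longlonglongrightarrow> 0" by simp
  \<comment> \<open>A quarter, because the square of a sum of two terms costs a factor 2 for each of
    them.\<close>
  from LIMSEQ_D[OF this, of "e/4"] e obtain n0 where
    n0: "\<And>n. n \<ge> n0 \<Longrightarrow> (LINT z|P. indicator (KK k) z * (cmod (stft \<phi> (u n) z - v z))\<^sup>2) < e/4" by auto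
  have "(LINT z|P. indicator (KK k) z * (cmod (stft \<phi> (\<lambda>x. u m x - u n x) z))\<^sup>2) \<le> e" if "m \<ge> n0" "n \<ge> n0" for m n
  proof -
    have "(LINT z|P. indicator (KK k) z * (cmod (stft \<phi> (\<lambda>x. u m x - u n x) z))\<^sup>2)
      \<le> (LINT z|P. 2 * (indicator (KK k) z * (cmod (stft \<phi> (u m) z - v z))\<^sup>2) + 2 * (indicator (KK k) z * (cmod (stft \<phi> (u n) z - v z))\<^sup>2))"
    proof (rule integral_mono')
      show "integrable P (\<lambda>z. 2 * (indicator (KK k) z * (cmod (stft \<phi> (u m) z - v z))\<^sup>2) + 2 * (indicator (KK k) z * (cmod (stft \<phi> (u n) z - v z))\<^sup>2))"
        by (intro Bochner_Integration.integrable_add integrable_mult_right iD)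
      fix z
      have "(cmod (stft \<phi> (\<lambda>x. u m x - u n x) z))\<^sup>2 = (cmod ((stft \<phi> (u m) z - v z) + (v z - stft \<phi> (u n) z)))\<^sup>2"
        by (simp add: stft_diff_left[OF \<phi> u(1) u(1)])
      also have "\<dots> \<le> 2 * (cmod (stft \<phi> (u m) z - v z))\<^sup>2 + 2 * (cmod (v z - stft \<phi> (u n) z))\<^sup>2"
        by (rule cmod_add_sq)
      finally show "indicator (KK k) z * (cmod (stft \<phi> (\<lambda>x. u m x - u n x) z))\<^sup>2
         \<le> 2 * (indicator (KK k) z * (cmod (stft \<phi> (u m) z - v z))\<^sup>2) + 2 * (indicator (KK k) z * (cmod (stft \<phi> (u n) z - v z))\<^sup>2)"
        by (simp add: indicator_def norm_minus_commute)
    qed simp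
    also have "\<dots> = 2 * (LINT z|P. indicator (KK k) z * (cmod (stft \<phi> (u m) z - v z))\<^sup>2) + 2 * (LINT z|P. indicator (KK k) z * (cmod (stft \<phi> (u n) z - v z))\<^sup>2)"
      using iD by simp
    also have "\<dots> \<le> e" using n0[OF that(1)] n0[OF that(2)] by simp
    finally show ?thesis .
  qed
  then show ?thesis by (intro exI[of _ n0] allI impI)
qed

text \<open>\<open>stft_average_bound\<close> is applied to f = u m - u n, of norm at most 2.
  Outside \<open>KK k\<close> thinness bounds the Berezin transform by \<eta>; inside,
  \<open>berezin_le\<close> and local convergence take over. The order of choices matters:
  \<open>e\<close> determines \<open>W\<close>, then \<open>k\<close>, and only then
  \<open>n0\<close>.\<close>

lemma stft_weighted_Cauchy:
  assumes \<phi>: "square_integrable M \<phi>"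
    and \<sigma>: "\<sigma> \<in> borel_measurable P" "\<And>z. 0 \<le> \<sigma> z" "\<And>z. \<sigma> z \<le> (1::real)"
    and thin: "\<And>e. e > 0 \<Longrightarrow> \<exists>R. \<forall>w. d 0 w \<ge> R \<longrightarrow> berezin \<phi> \<sigma> w < ennreal e"
    and u: "\<And>n. square_integrable M (u n)" "\<And>n. l2_nrm M (u n) \<le> 1"
    and lim: "\<And>z. (\<lambda>n. stft \<phi> (u n) z) \<longlonglongrightarrow> v z" and e: "e > 0"
  shows "\<exists>n0. \<forall>m\<ge>n0. \<forall>n\<ge>n0. (LINT z|P. \<sigma> z * (cmod (stft \<phi> (\<lambda>x. u m x - u n x) z))\<^sup>2) \<le> e"
proof (cases "l2_nrm M \<phi> = 0")
  \<comment> \<open>The null window is set aside because \<eta> and \<delta> below divide by powers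
    of its norm.\<close>
  case True
  have "stft \<phi> (\<lambda>x. u m x - u n x) z = 0" for m n z
    using stft_bound[OF \<phi> square_integrable_diff[OF u(1) u(1)], of m n z] True by simp
  then show ?thesis using e by simp
next
  case False
  define A where "A = l2_nrm M \<phi>"
  have A: "A > 0" using False by (simp add: A_def less_le)
  have Ae: "min A (sqrt (e / 24)) > 0" using A e by simp
  \<comment> \<open>\<open>e1 \<le> A\<close> keeps the inner product of \<phi> with its shifts away
    from 0 on \<open>W\<close>; e1^2 \<le> e/24 makes the error 2 c (2 e1)^2 p at most c p e /
    3.\<close>
  define e1 where "e1 = min A (sqrt (e / 24))"
  have e1: "e1 > 0" "e1 \<le> A" "e1\<^sup>2 \<le> e / 24"
  proof -
    show "e1 > 0" unfolding e1_def by (rule Ae)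
    show "e1 \<le> A" by (simp add: e1_def)
    have "e1\<^sup>2 \<le> (sqrt (e / 24))\<^sup>2" using Ae by (intro power_mono) (simp_all add: e1_def)
    then show "e1\<^sup>2 \<le> e / 24" using e by simp
  qed
  obtain W where W: "W \<in> sets P" and Wpos: "emeasure P W > 0" "emeasure P W < \<infinity>"
    and W': "\<forall>z\<in>W. d 0 z < 1 \<and> l2_nrm M (\<lambda>x. \<phi> x - tfs \<phi> z x) < e1"
    using nhd_exists[OF \<phi> e1(1)] by (elim bexE conjE)
  define p where "p = measure P W"
  have p1: "emeasure P W = ennreal p"
    unfolding p_def by (rule emeasure_eq_ennreal_measure) (use Wpos(2) in auto)
  have p2: "p > 0" using Wpos(1) unfolding p1 by simp
  have We: "l2_nrm M (\<lambda>x. \<phi> x - tfs \<phi> z x) \<le> e1" if "z \<in> W" for z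
    using W'[THEN bspec, THEN conjunct2, OF that] by (rule less_imp_le)
  \<comment> \<open>Since ||\<phi> - \<phi>_z||^2 = 2 A^2 - 2 Re <\<phi>, \<phi>_z>, a distance of
    at most A forces the real part to be at least A^2/2; \<open>c\<close> is the square of this
    bound.\<close>
  define c where "c = (A\<^sup>2 / 2)\<^sup>2"
  have c: "c > 0" using A by (simp add: c_def)
  have Wc: "c \<le> (cmod (l2_ip M \<phi> (tfs \<phi> z)))\<^sup>2" if z: "z \<in> W" for z
  proof -
    have "(l2_nrm M (\<lambda>x. \<phi> x - tfs \<phi> z x))\<^sup>2 \<le> A\<^sup>2"
      using We[OF z] e1 by (intro power_mono) auto
    then have "A\<^sup>2 / 2 \<le> Re (l2_ip M \<phi> (tfs \<phi> z))"
      unfolding l2_nrm_diff_sq[OF \<phi> tfs_square_integrable[OF \<phi>]]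
      using \<phi> by (simp add: tfs_nrm square_integrable_measurable A_def)
    also have "\<dots> \<le> cmod (l2_ip M \<phi> (tfs \<phi> z))" by (rule complex_Re_le_cmod)
    finally show ?thesis unfolding c_def by (intro power_mono) auto
  qed
  \<comment> \<open>\<eta> and, below, \<delta> make 4 A^2 \<eta> and A^4 \<delta> each equal to c p
    e / 6. Doubling their sum gives two thirds of c p e; the error from \<open>e1\<close> is the
    remaining third.\<close>
  define \<eta> where "\<eta> = c * p * e / (24 * A\<^sup>2)"
  have \<eta>: "\<eta> > 0" using A c p2 e by (simp add: \<eta>_def)
  obtain R where R: "\<forall>w. d 0 w \<ge> R \<longrightarrow> berezin \<phi> \<sigma> w < ennreal \<eta>"
    using thin[OF \<eta>] by (elim exE)
  obtain k where k: "R < real k" using reals_Archimedean2 by blast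
  define \<delta> where "\<delta> = c * p * e / (6 * A^4)"
  have \<delta>: "\<delta> > 0" using A c p2 e by (simp add: \<delta>_def)
  obtain n0 where n0: "\<forall>m\<ge>n0. \<forall>n\<ge>n0. (LINT z|P. indicator (KK k) z * (cmod (stft \<phi> (\<lambda>x. u m x - u n x) z))\<^sup>2) \<le> \<delta>"
    using stft_local_Cauchy[OF \<phi> u lim \<delta>, of k] by (elim exE)
  have "(LINT z|P. \<sigma> z * (cmod (stft \<phi> (\<lambda>x. u m x - u n x) z))\<^sup>2) \<le> e" if mn: "m \<ge> n0" "n \<ge> n0" for m n
  proof -
    define f where "f x = u m x - u n x" for x
    have f: "square_integrable M f" unfolding f_def by (intro square_integrable_diff u)
    have fb: "l2_nrm M f \<le> 2"
      using l2_nrm_triangle[OF u(1)[of m] square_integrable_scale[OF u(1)[of n], of "-1"]] u(2)[of m] u(2)[of n]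
        l2_nrm_scale[of M "-1" "u n"] unfolding f_def by simp
    have [measurable]: "stft \<phi> f \<in> borel_measurable P"
      using stft_square_integrable(1)[OF \<phi> f] by (simp add: square_integrable_def)
    have iV: "integrable P (\<lambda>z. (cmod (stft \<phi> f z))\<^sup>2)"
      using stft_square_integrable(1)[OF \<phi> f] by (simp add: square_integrable_def)
    have iKV: "integrable P (\<lambda>z. indicator (KK k) z * (cmod (stft \<phi> f z))\<^sup>2)"
      by (rule Bochner_Integration.integrable_bound[OF iV]) (measurable, simp add: indicator_def)
    define I where "I = (LINT z|P. \<sigma> z * (cmod (stft \<phi> f z))\<^sup>2)"
    have nnI: "(\<integral>\<^sup>+z. ennreal (\<sigma> z * (cmod (stft \<phi> f z))\<^sup>2) \<partial>P) = ennreal I"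
      unfolding I_def using \<sigma>(2) by (intro nn_integral_eq_integral weighted_square_integrable(1)[OF \<phi> f \<sigma>] AE_I2) simp
    have I0: "I \<ge> 0" unfolding I_def using \<sigma>(2) by (intro integral_nonneg_AE AE_I2) simp
    have "(\<integral>\<^sup>+v. ennreal ((cmod (stft \<phi> f v))\<^sup>2) * berezin \<phi> \<sigma> v \<partial>P)
      \<le> (\<integral>\<^sup>+v. ennreal (A^4 * (indicator (KK k) v * (cmod (stft \<phi> f v))\<^sup>2) + \<eta> * (cmod (stft \<phi> f v))\<^sup>2) \<partial>P)"
    proof (rule nn_integral_mono)
      fix v
      show "ennreal ((cmod (stft \<phi> f v))\<^sup>2) * berezin \<phi> \<sigma> v
         \<le> ennreal (A^4 * (indicator (KK k) v * (cmod (stft \<phi> f v))\<^sup>2) + \<eta> * (cmod (stft \<phi> f v))\<^sup>2)"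
      proof (cases "v \<in> KK k")
        case True
        have "ennreal ((cmod (stft \<phi> f v))\<^sup>2) * berezin \<phi> \<sigma> v \<le> ennreal ((cmod (stft \<phi> f v))\<^sup>2) * ennreal (A^4)"
          unfolding A_def by (intro mult_left_mono berezin_le[OF \<phi> \<sigma>]) simp
        also have "\<dots> = ennreal (A^4 * (cmod (stft \<phi> f v))\<^sup>2)"
          using A by (simp add: ennreal_mult[symmetric] mult.commute)
        also have "\<dots> \<le> ennreal (A^4 * (cmod (stft \<phi> f v))\<^sup>2 + \<eta> * (cmod (stft \<phi> f v))\<^sup>2)"
          using \<eta> by (intro ennreal_leI) simp
        finally show ?thesis using True by simp
      next
        case False
        then have "\<not> d 0 v < real k" using mem_KK[of v k] by (rule contrapos_nn)
        then have "R \<le> d 0 v" using k by simp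
        then have "berezin \<phi> \<sigma> v \<le> ennreal \<eta>" by (rule less_imp_le[OF R[THEN spec, THEN mp]])
        then have "ennreal ((cmod (stft \<phi> f v))\<^sup>2) * berezin \<phi> \<sigma> v \<le> ennreal ((cmod (stft \<phi> f v))\<^sup>2) * ennreal \<eta>"
          by (intro mult_left_mono) simp_all
        also have "\<dots> = ennreal (\<eta> * (cmod (stft \<phi> f v))\<^sup>2)"
          using \<eta> by (simp add: ennreal_mult[symmetric] mult.commute)
        finally show ?thesis using False by simp
      qed
    qed
    also have "\<dots> = ennreal (LINT v|P. A^4 * (indicator (KK k) v * (cmod (stft \<phi> f v))\<^sup>2) + \<eta> * (cmod (stft \<phi> f v))\<^sup>2)"
      using \<eta> A by (intro nn_integral_eq_integral Bochner_Integration.integrable_add integrable_mult_right iKV iV AE_I2) simp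
    also have "(LINT v|P. A^4 * (indicator (KK k) v * (cmod (stft \<phi> f v))\<^sup>2) + \<eta> * (cmod (stft \<phi> f v))\<^sup>2)
      = A^4 * (LINT v|P. indicator (KK k) v * (cmod (stft \<phi> f v))\<^sup>2) + \<eta> * (LINT v|P. (cmod (stft \<phi> f v))\<^sup>2)"
      using iKV iV by simp
    also have "ennreal \<dots> \<le> ennreal (A^4 * \<delta> + \<eta> * (4 * A\<^sup>2))"
    proof (intro ennreal_leI add_mono mult_left_mono)
      show "(LINT v|P. indicator (KK k) v * (cmod (stft \<phi> f v))\<^sup>2) \<le> \<delta>"
        using n0 mn unfolding f_def by simp
      have "(LINT v|P. (cmod (stft \<phi> f v))\<^sup>2) = (l2_nrm M f * A)\<^sup>2"
        unfolding l2_nrm_sq[symmetric] stft_square_integrable(2)[OF \<phi> f] A_def ..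
      also have "\<dots> \<le> (2 * A)\<^sup>2" using fb A by (intro power_mono mult_right_mono) auto
      finally show "(LINT v|P. (cmod (stft \<phi> f v))\<^sup>2) \<le> 4 * A\<^sup>2" by (simp add: power_mult_distrib)
    qed (use A \<eta> in auto)
    also have "A^4 * \<delta> + \<eta> * (4 * A\<^sup>2) = c * p * e / 3"
      using A unfolding \<delta>_def \<eta>_def by (simp add: field_simps)
    finally have J: "(\<integral>\<^sup>+v. ennreal ((cmod (stft \<phi> f v))\<^sup>2) * berezin \<phi> \<sigma> v \<partial>P) \<le> ennreal (c * p * e / 3)" .
    have "ennreal (c * p * I) = ennreal c * emeasure P W * (\<integral>\<^sup>+w. ennreal (\<sigma> w * (cmod (stft \<phi> f w))\<^sup>2) \<partial>P)"
      using c p2 I0 by (simp add: nnI p1 ennreal_mult)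
    also have "\<dots> \<le> 2 * (\<integral>\<^sup>+v. ennreal ((cmod (stft \<phi> f v))\<^sup>2) * berezin \<phi> \<sigma> v \<partial>P)
      + ennreal (2 * c * (l2_nrm M f * e1)\<^sup>2) * emeasure P W"
      by (rule stft_average_bound[OF \<phi> f \<sigma> W We less_imp_le[OF c] Wc])
    also have "\<dots> \<le> 2 * ennreal (c * p * e / 3) + ennreal (2 * c * (2 * e1)\<^sup>2) * ennreal p"
      unfolding p1 using fb e1 c
      by (intro add_mono mult_left_mono mult_right_mono J ennreal_leI power_mono) auto
    also have "\<dots> = ennreal (2 * (c * p * e / 3) + 2 * c * (2 * e1)\<^sup>2 * p)"
    proof -
      have "2 * ennreal x + ennreal y * ennreal t = ennreal (2 * x + y * t)" if "0 \<le> x" "0 \<le> y" "0 \<le> t" for x y t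
        using that by (simp add: ennreal_mult)
      then show ?thesis using c p2 e by simp
    qed
    finally have "c * p * I \<le> 2 * (c * p * e / 3) + 2 * c * (2 * e1)\<^sup>2 * p"
      using c p2 e by (subst (asm) ennreal_le_iff) auto
    also have "\<dots> = c * p * (2 * e / 3 + 8 * e1\<^sup>2)" by (simp add: power_mult_distrib algebra_simps)
    also have "\<dots> \<le> c * p * e" using e1(3) c p2 by (intro mult_left_mono) auto
    finally have "I \<le> e" using c p2 by simp
    then show ?thesis by (simp add: I_def f_def[abs_def])
  qed
  then show ?thesis by (intro exI[of _ n0] allI impI)
qed

text \<open>Comparing moduli of V f for the difference f = u m - u n sidesteps the phase in
  \<open>tfs_add\<close>. The radius \<open>r\<close> depends on the window and \<open>e\<close>
  alone, so it serves all such f, whose norms are at most 2.\<close>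

lemma stft_convergent_everywhere:
  assumes \<phi>: "square_integrable M \<phi>" and u: "\<And>n. square_integrable M (u n)" "\<And>n. l2_nrm M (u n) \<le> 1"
    and D: "\<And>w e. e > 0 \<Longrightarrow> \<exists>a\<in>D. d w a < e"
    and conv: "\<And>a. a \<in> D \<Longrightarrow> convergent (\<lambda>n. stft \<phi> (u n) a)"
  shows "convergent (\<lambda>n. stft \<phi> (u n) w)"
proof -
  have "Cauchy (\<lambda>n. stft \<phi> (u n) w)"
  proof (rule metric_CauchyI)
    fix e :: real assume e: "e > 0"
    \<comment> \<open>A quarter, because the window error is multiplied by ||f|| \<le> 2; the other
      half of \<open>e\<close> is spent at \<open>a\<close>.\<close>
    then have "e/4 > 0" by simp
    from tfs_strongly_continuous[OF \<phi> this]
    obtain r where r: "r > 0" "\<forall>z. d 0 z < r \<longrightarrow> l2_nrm M (\<lambda>x. \<phi> x - tfs \<phi> z x) < e/4" by (elim exE conjE)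
    obtain a where a: "a \<in> D" "d w a < r" using D[OF r(1), of w] by (elim bexE)
    define z where "z = a - w"
    have wz: "w + z = a" by (simp add: z_def)
    have "d 0 z = d w a" using d_translate[of w 0 z] by (simp add: wz)
    then have "d 0 z < r" using a(2) by simp
    then have dz: "l2_nrm M (\<lambda>x. \<phi> x - tfs \<phi> z x) < e/4" by (rule r(2)[THEN spec, THEN mp])
    have "Cauchy (\<lambda>n. stft \<phi> (u n) a)" using conv[OF a(1)] by (rule convergent_Cauchy)
    then obtain n0 where n0: "\<forall>m\<ge>n0. \<forall>n\<ge>n0. dist (stft \<phi> (u m) a) (stft \<phi> (u n) a) < e/2"
      unfolding Cauchy_def using e by (metis half_gt_zero)
    have "dist (stft \<phi> (u m) w) (stft \<phi> (u n) w) < e" if mn: "m \<ge> n0" "n \<ge> n0" for m n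
    proof -
      define f where "f x = u m x - u n x" for x
      have f: "square_integrable M f" unfolding f_def by (intro square_integrable_diff u)
      have fb: "l2_nrm M f \<le> 2"
        using l2_nrm_triangle[OF u(1)[of m] square_integrable_scale[OF u(1)[of n], of "-1"]] u(2)[of m] u(2)[of n]
          l2_nrm_scale[of M "-1" "u n"] unfolding f_def by simp
      have eq: "stft \<phi> f y = stft \<phi> (u m) y - stft \<phi> (u n) y" for y
        unfolding f_def by (rule stft_diff_left[OF \<phi> u(1) u(1)])
      have "cmod (stft \<phi> f w) \<le> cmod (stft \<phi> f a) + cmod (stft (\<lambda>x. \<phi> x - tfs \<phi> z x) f w)"
        using stft_translation_bound[OF \<phi> f, of w z] by (simp add: wz)
      also have "cmod (stft (\<lambda>x. \<phi> x - tfs \<phi> z x) f w) \<le> l2_nrm M f * l2_nrm M (\<lambda>x. \<phi> x - tfs \<phi> z x)"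
        by (rule stft_bound[OF square_integrable_diff[OF \<phi> tfs_square_integrable[OF \<phi>]] f])
      also have "\<dots> \<le> 2 * (e/4)" using fb dz by (intro mult_mono) auto
      also have "cmod (stft \<phi> f a) < e/2" using n0 mn by (simp add: eq dist_norm)
      finally show ?thesis by (simp add: eq dist_norm)
    qed
    then show "\<exists>n0. \<forall>m\<ge>n0. \<forall>n\<ge>n0. dist (stft \<phi> (u m) w) (stft \<phi> (u n) w) < e"
      by (intro exI[of _ n0] allI impI)
  qed
  then show ?thesis by (rule Cauchy_convergent)
qed

text \<open>Diagonal extraction over a countable dense set, where the values are bounded by
  ||\<phi>||; \<open>stft_convergent_everywhere\<close> spreads the convergence. No weak limit in L2
  has to be produced.\<close>

lemma stft_convergent_subsequence:
  assumes \<phi>: "square_integrable M \<phi>" and u: "\<And>n. square_integrable M (u n)" "\<And>n. l2_nrm M (u n) \<le> 1"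
  obtains r where "strict_mono (r :: nat \<Rightarrow> nat)" "\<And>z. convergent (\<lambda>n. stft \<phi> (u (r n)) z)"
proof -
  obtain D where D: "countable D" "\<And>w e. e > 0 \<Longrightarrow> \<exists>a\<in>D. d w a < e" using countable_dense by blast
  have b: "norm (stft \<phi> (u n) x) \<le> l2_nrm M \<phi>" for n x
    using order_trans[OF stft_bound[OF \<phi> u(1)] mult_right_mono[OF u(2)]] by simp
  obtain r where r: "strict_mono (r :: nat \<Rightarrow> nat)" "\<And>x. x \<in> D \<Longrightarrow> \<exists>l. (\<lambda>n. stft \<phi> (u (r n)) x) \<longlonglongrightarrow> l"
    using function_convergent_subsequence[of D "\<lambda>n. stft \<phi> (u n)", OF D(1) b] by blast
  have "convergent (\<lambda>n. stft \<phi> (u (r n)) z)" for z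
    by (rule stft_convergent_everywhere[of \<phi> "\<lambda>n. u (r n)" D, OF \<phi> u D(2)])
      (use r(2) in \<open>simp_all add: convergent_def\<close>)
  with r(1) show thesis by (rule that)
qed

section \<open>The localization operator\<close>

lemma tf_shift_class: "tf_shift M \<phi> z = L2_class M (tfs (L2_rep \<phi>) z)"
  by (cases z) (simp add: tf_shift_def tfs_def[abs_def])

lemma tf_shift_in: "\<phi> \<in> L2 M \<Longrightarrow> tf_shift M \<phi> z \<in> L2 M"
  unfolding tf_shift_class by (intro L2_class_in tfs_square_integrable L2_rep_sq)

lemma L2_inner_tf_shift:
  assumes "\<phi> \<in> L2 M" "u \<in> L2 M"
  shows "L2_inner M u (tf_shift M \<phi> z) = stft (L2_rep \<phi>) (L2_rep u) z"
    and "L2_inner M (tf_shift M \<phi> z) u = cnj (stft (L2_rep \<phi>) (L2_rep u) z)"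
proof -
  show 1: "L2_inner M u (tf_shift M \<phi> z) = stft (L2_rep \<phi>) (L2_rep u) z"
    unfolding tf_shift_class stft_def
    by (rule L2_inner_class_right[OF tfs_square_integrable[OF L2_rep_sq[OF assms(1)]] assms(2)])
  show "L2_inner M (tf_shift M \<phi> z) u = cnj (stft (L2_rep \<phi>) (L2_rep u) z)"
    using L2_inner_cnj[of M u "tf_shift M \<phi> z"] by (simp add: 1)
qed

lemma L2_inner_tf_shift_tf_shift:
  assumes "\<phi> \<in> L2 M"
  shows "L2_inner M (tf_shift M \<phi> z) (tf_shift M \<phi> w) = l2_ip M (tfs (L2_rep \<phi>) z) (tfs (L2_rep \<phi>) w)"
proof -
  have sq: "square_integrable M (tfs (L2_rep \<phi>) y)" for y
    by (rule tfs_square_integrable[OF L2_rep_sq[OF assms]])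
  have "L2_inner M (tf_shift M \<phi> z) (tf_shift M \<phi> w) = l2_ip M (tfs (L2_rep \<phi>) z) (L2_rep (tf_shift M \<phi> w))"
    unfolding tf_shift_class[of \<phi> z] by (rule L2_inner_class_left[OF sq tf_shift_in[OF assms]])
  also have "\<dots> = l2_ip M (tfs (L2_rep \<phi>) z) (tfs (L2_rep \<phi>) w)"
    unfolding tf_shift_class using L2_rep_class[OF sq[of w]] sq
    by (intro l2_ip_cong_AE) (auto simp: square_integrable_def)
  finally show ?thesis .
qed

lemma thin_iff:
  assumes \<phi>: "\<phi> \<in> L2 M"
  shows "thin M N d \<phi> \<sigma> \<longleftrightarrow> (\<forall>e>0. \<exists>R. \<forall>w. d 0 w \<ge> R \<longrightarrow> berezin (L2_rep \<phi>) \<sigma> w < ennreal e)"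
proof -
  have eq: "(\<lambda>w. \<integral>\<^sup>+z. ennreal (\<sigma> z * (cmod (L2_inner M (tf_shift M \<phi> z) (tf_shift M \<phi> w)))\<^sup>2) \<partial>P)
    = berezin (L2_rep \<phi>) \<sigma>"
    by (rule ext) (simp add: berezin_def L2_inner_tf_shift_tf_shift[OF \<phi>])
  have ev: "eventually Q (filtercomap (\<lambda>w. d w 0) at_top) \<longleftrightarrow> (\<exists>R. \<forall>w. d 0 w \<ge> R \<longrightarrow> Q w)" for Q
    unfolding eventually_filtercomap_at_top_linorder by (simp only: d.commute[of 0])
  show ?thesis
  proof
    assume "thin M N d \<phi> \<sigma>"
    then have lim: "(berezin (L2_rep \<phi>) \<sigma> \<longlongrightarrow> 0) (filtercomap (\<lambda>w. d w 0) at_top)"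
      unfolding thin_def eq .
    show "\<forall>e>0. \<exists>R. \<forall>w. d 0 w \<ge> R \<longrightarrow> berezin (L2_rep \<phi>) \<sigma> w < ennreal e"
    proof (intro allI impI)
      fix e :: real assume "e > 0"
      then have "0 < ennreal e" by simp
      from order_tendstoD(2)[OF lim this] show "\<exists>R. \<forall>w. d 0 w \<ge> R \<longrightarrow> berezin (L2_rep \<phi>) \<sigma> w < ennreal e"
        unfolding ev .
    qed
  next
    assume R: "\<forall>e>0. \<exists>R. \<forall>w. d 0 w \<ge> R \<longrightarrow> berezin (L2_rep \<phi>) \<sigma> w < ennreal e"
    have "(berezin (L2_rep \<phi>) \<sigma> \<longlongrightarrow> 0) (filtercomap (\<lambda>w. d w 0) at_top)"
    proof (rule order_tendstoI)
      fix a :: ennreal assume "0 < a"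
      \<comment> \<open>The target \<open>a\<close> may be infinite; any \<open>b\<close> strictly
        below it is finite, so the hypothesis applies.\<close>
      then obtain b where b: "0 < b" "b < a" using dense by blast
      then obtain e where e: "b = ennreal e" "0 \<le> e" by (cases b) auto
      then have "e > 0" using b(1) by simp
      from R[THEN spec, THEN mp, OF this]
      obtain R where R: "\<forall>w. d 0 w \<ge> R \<longrightarrow> berezin (L2_rep \<phi>) \<sigma> w < ennreal e"
        by (elim exE)
      show "eventually (\<lambda>w. berezin (L2_rep \<phi>) \<sigma> w < a) (filtercomap (\<lambda>w. d w 0) at_top)"
        unfolding ev
      proof (intro exI[of _ R] allI impI)
        fix w assume "R \<le> d 0 w"
        then have "berezin (L2_rep \<phi>) \<sigma> w < b" unfolding e by (rule R[THEN spec, THEN mp])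
        then show "berezin (L2_rep \<phi>) \<sigma> w < a" using b(2) by (rule less_trans)
      qed
    qed simp
    then show "thin M N d \<phi> \<sigma>" unfolding thin_def eq .
  qed
qed

end

locale localization_setting = tf_setting M N d
  for M :: "'g::{topological_ab_group_add, t2_space, second_countable_topology} measure"
    and N :: "'g pontryagin_dual measure"
    and d :: "'g pontryagin_dual \<times> 'g \<Rightarrow> 'g pontryagin_dual \<times> 'g \<Rightarrow> real" +
  fixes \<phi> :: "'g l2" and \<sigma> :: "'g pontryagin_dual \<times> 'g \<Rightarrow> real"
  assumes \<phi>: "\<phi> \<in> L2 M"
    and \<sigma>_meas: "\<sigma> \<in> borel_measurable P"
    and \<sigma>_nonneg: "\<And>z. 0 \<le> \<sigma> z" and \<sigma>_le: "\<And>z. \<sigma> z \<le> 1"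
begin

abbreviation "\<phi>' \<equiv> L2_rep \<phi>"
abbreviation "V \<equiv> stft \<phi>'"
abbreviation "T \<equiv> localization_operator M N \<phi> \<sigma>"

lemma \<phi>': "square_integrable M \<phi>'" by (rule L2_rep_sq[OF \<phi>])

lemmas \<sigma> = \<sigma>_meas \<sigma>_nonneg \<sigma>_le

text \<open>The sesquilinear form <T f, g>, written as an inner product over \<open>P\<close> with
  the symbol on the first factor, so that Cauchy-Schwarz isolates a weighted integral of |V
  f|^2.\<close>

definition form :: "('g \<Rightarrow> complex) \<Rightarrow> ('g \<Rightarrow> complex) \<Rightarrow> complex" where
  "form f g = l2_ip P (\<lambda>z. of_real (\<sigma> z) * V f z) (V g)"

text \<open>Cauchy-Schwarz over \<open>P\<close>, then \<sigma>^2 \<le> \<sigma> for the first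
  factor and Moyal for the second. The asymmetry is intended: the factor with \<open>f\<close>
  becomes small for differences along a subsequence, while \<open>g\<close> is arbitrary.\<close>

lemma form_bound:
  assumes "square_integrable M f" "square_integrable M g"
  shows "cmod (form f g) \<le> sqrt (LINT z|P. \<sigma> z * (cmod (V f z))\<^sup>2) * l2_nrm M \<phi>' * l2_nrm M g"
proof -
  have "cmod (form f g) \<le> l2_nrm P (\<lambda>z. of_real (\<sigma> z) * V f z) * l2_nrm P (V g)"
    unfolding form_def
    by (rule l2_ip_CS[OF weighted_square_integrable(2)[OF \<phi>' assms(1) \<sigma>] stft_square_integrable(1)[OF \<phi>' assms(2)]])
  also have "\<dots> \<le> sqrt (LINT z|P. \<sigma> z * (cmod (V f z))\<^sup>2) * l2_nrm P (V g)"
    using weighted_square_integrable(3)[OF \<phi>' assms(1) \<sigma>] by (intro mult_right_mono real_le_rsqrt) simp_all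
  finally show ?thesis by (simp add: stft_square_integrable(2)[OF \<phi>' assms(2)] mult_ac)
qed

lemma form_add_left:
  assumes "square_integrable M f" "square_integrable M g" "square_integrable M h"
  shows "form (\<lambda>x. f x + g x) h = form f h + form g h"
  unfolding form_def stft_add_left[OF \<phi>' assms(1,2)] distrib_left
  by (rule l2_ip_add_left[OF weighted_square_integrable(2)[OF \<phi>' assms(1) \<sigma>]
        weighted_square_integrable(2)[OF \<phi>' assms(2) \<sigma>] stft_square_integrable(1)[OF \<phi>' assms(3)]])

lemma form_scale_left: "form (\<lambda>x. c * f x) h = c * form f h"
  unfolding form_def stft_scale_left l2_ip_scale_left[symmetric] by (simp add: mult.left_commute)

lemma form_diff_left:
  assumes "square_integrable M f" "square_integrable M g" "square_integrable M h"
  shows "form (\<lambda>x. f x - g x) h = form f h - form g h"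
  using form_add_left[OF assms(1) square_integrable_scale[OF assms(2), of "-1"] assms(3)] form_scale_left[of "-1" g h]
  by simp

text \<open>Boundedness of the form provides the vector that the weak integral should
  define.\<close>

lemma form_riesz:
  assumes f: "square_integrable M f"
  obtains h where "square_integrable M h" "\<And>g. square_integrable M g \<Longrightarrow> l2_ip M h g = form f g"
proof (rule l2_riesz[of M "form f"])
  fix g h assume gh: "square_integrable M g" "square_integrable M h"
  show "form f (\<lambda>x. g x + h x) = form f g + form f h"
    unfolding form_def stft_add_left[OF \<phi>' gh, abs_def]
    by (rule l2_ip_add_right[OF stft_square_integrable(1)[OF \<phi>' gh(1)] stft_square_integrable(1)[OF \<phi>' gh(2)]
        weighted_square_integrable(2)[OF \<phi>' f \<sigma>]])
next
  fix g c
  show "form f (\<lambda>x. c * g x) = cnj c * form f g"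
    unfolding form_def stft_scale_left[abs_def] by (rule l2_ip_scale_right)
next
  fix g assume g: "square_integrable M g"
  show "cmod (form f g) \<le> (sqrt (LINT z|P. \<sigma> z * (cmod (V f z))\<^sup>2) * l2_nrm M \<phi>') * l2_nrm M g"
    by (rule form_bound[OF f g])
qed (rule that)

lemma has_bochner_integral_form:
  assumes f: "square_integrable M f" and g: "square_integrable M g"
  shows "has_bochner_integral P (\<lambda>z. of_real (\<sigma> z) * V f z * cnj (V g z)) (form f g)"
  unfolding form_def l2_ip_def
  by (rule has_bochner_integral_integrable[OF square_integrable_prod(2)[OF weighted_square_integrable(2)[OF \<phi>' f \<sigma>]
        stft_square_integrable(1)[OF \<phi>' g]]])

text \<open>The operator is a definite description: \<open>form_riesz\<close> gives existence and
  \<open>L2_eqI\<close> uniqueness. The integrand is integrable for every test vector, so the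
  Bochner condition reduces to the equation between inner products in
  \<open>spec_iff\<close>.\<close>

lemma localization_operator:
  assumes u: "u \<in> L2 M"
  shows "T u \<in> L2 M" and "\<And>g. g \<in> L2 M \<Longrightarrow> L2_inner M (T u) g = form (L2_rep u) (L2_rep g)"
proof -
  define spec where "spec h \<longleftrightarrow> h \<in> L2 M \<and>
     (\<forall>g\<in>L2 M. has_bochner_integral P
        (\<lambda>z. of_real (\<sigma> z) * L2_inner M u (tf_shift M \<phi> z) * L2_inner M (tf_shift M \<phi> z) g) (L2_inner M h g))" for h
  have spec_iff: "spec h \<longleftrightarrow> h \<in> L2 M \<and> (\<forall>g\<in>L2 M. L2_inner M h g = form (L2_rep u) (L2_rep g))" for h
  proof -
    have "has_bochner_integral P
        (\<lambda>z. of_real (\<sigma> z) * L2_inner M u (tf_shift M \<phi> z) * L2_inner M (tf_shift M \<phi> z) g) (L2_inner M h g)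
      \<longleftrightarrow> L2_inner M h g = form (L2_rep u) (L2_rep g)" if g: "g \<in> L2 M" for g
      unfolding L2_inner_tf_shift(1)[OF \<phi> u] L2_inner_tf_shift(2)[OF \<phi> g]
      using has_bochner_integral_form[OF L2_rep_sq[OF u] L2_rep_sq[OF g]] has_bochner_integral_eq
      by (metis (no_types, lifting))
    then show ?thesis unfolding spec_def by (simp cong: conj_cong)
  qed
  obtain h where h: "square_integrable M h" "\<And>g. square_integrable M g \<Longrightarrow> l2_ip M h g = form (L2_rep u) g"
    using form_riesz[OF L2_rep_sq[OF u]] by blast
  have "spec (L2_class M h)"
    unfolding spec_iff using h by (simp add: L2_class_in L2_inner_class_left L2_rep_sq)
  moreover have "k = L2_class M h" if "spec k" for k
    by (rule L2_eqI[of _ M]) (use that \<open>spec (L2_class M h)\<close> in \<open>simp_all add: spec_iff\<close>)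
  moreover have "T u = (THE h. spec h)"
    unfolding localization_operator_def spec_def ..
  ultimately have "spec (T u)" by (metis theI)
  then show "T u \<in> L2 M" "\<And>g. g \<in> L2 M \<Longrightarrow> L2_inner M (T u) g = form (L2_rep u) (L2_rep g)"
    by (simp_all add: spec_iff)
qed

text \<open>The representative of a sum or multiple agrees with the sum or multiple of
  representatives only almost everywhere; linearity of \<open>T\<close> passes through this.\<close>

lemma form_cong_AE:
  assumes "AE x in M. f x = f' x" "square_integrable M f" "square_integrable M f'"
  shows "form f g = form f' g"
proof -
  have "V f z = V f' z" for z
    unfolding stft_def using assms tfs_square_integrable[OF \<phi>']
    by (intro l2_ip_cong_AE) (auto simp: square_integrable_def)
  then show ?thesis by (simp add: form_def)
qed

lemma localization_operator_linear: "L2_linear M T"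
  unfolding L2_linear_def
proof (intro conjI ballI allI)
  show "T u \<in> L2 M" if "u \<in> L2 M" for u by (rule localization_operator(1)[OF that])
next
  fix u v assume u: "u \<in> L2 M" and v: "v \<in> L2 M"
  show "T (L2_add M u v) = L2_add M (T u) (T v)"
  proof (rule L2_eqI)
    fix g assume g: "g \<in> L2 M"
    have sq: "square_integrable M (\<lambda>x. L2_rep u x + L2_rep v x)" by (intro square_integrable_add L2_rep_sq u v)
    have "form (L2_rep (L2_add M u v)) (L2_rep g) = form (\<lambda>x. L2_rep u x + L2_rep v x) (L2_rep g)"
      unfolding L2_add_def by (rule form_cong_AE[OF L2_rep_class(2)[OF sq] L2_rep_class(1)[OF sq] sq])
    then show "L2_inner M (T (L2_add M u v)) g = L2_inner M (L2_add M (T u) (T v)) g"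
      by (simp add: localization_operator u v g L2_add_in L2_inner_add_left form_add_left L2_rep_sq)
  qed (simp_all add: localization_operator(1) u v L2_add_in)
next
  fix c u assume u: "u \<in> L2 M"
  show "T (L2_scale M c u) = L2_scale M c (T u)"
  proof (rule L2_eqI)
    fix g assume g: "g \<in> L2 M"
    have sq: "square_integrable M (\<lambda>x. c * L2_rep u x)" by (intro square_integrable_scale L2_rep_sq u)
    have "form (L2_rep (L2_scale M c u)) (L2_rep g) = form (\<lambda>x. c * L2_rep u x) (L2_rep g)"
      unfolding L2_scale_def by (rule form_cong_AE[OF L2_rep_class(2)[OF sq] L2_rep_class(1)[OF sq] sq])
    then show "L2_inner M (T (L2_scale M c u)) g = L2_inner M (L2_scale M c (T u)) g"
      by (simp add: localization_operator u g L2_scale_in L2_inner_scale_left form_scale_left)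
  qed (simp_all add: localization_operator(1) u L2_scale_in)
qed

text \<open>The difference w of T u and T v is tested against itself; \<open>form_bound\<close> then
  gives ||w||^2 \<le> S ||w||.\<close>

lemma localization_operator_dist:
  assumes u: "u \<in> L2 M" and v: "v \<in> L2 M"
  shows "L2_dist M (T u) (T v)
    \<le> sqrt (LINT z|P. \<sigma> z * (cmod (V (\<lambda>x. L2_rep u x - L2_rep v x) z))\<^sup>2) * l2_nrm M \<phi>'"
proof -
  define w where "w x = L2_rep (T u) x - L2_rep (T v) x" for x
  define S where "S = sqrt (LINT z|P. \<sigma> z * (cmod (V (\<lambda>x. L2_rep u x - L2_rep v x) z))\<^sup>2) * l2_nrm M \<phi>'"
  have S: "0 \<le> S" unfolding S_def using \<sigma>(2) by (intro mult_nonneg_nonneg real_sqrt_ge_zero integral_nonneg_AE AE_I2) simp_all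
  note Tu = localization_operator(1)[OF u] and Tv = localization_operator(1)[OF v]
  have w: "square_integrable M w" unfolding w_def by (intro square_integrable_diff L2_rep_sq Tu Tv)
  have wr: "square_integrable M (L2_rep (L2_class M w))" by (rule L2_rep_class(1)[OF w])
  have nw: "l2_nrm M (L2_rep (L2_class M w)) = l2_nrm M w"
    using L2_rep_class[OF w] w by (intro l2_nrm_cong_AE) (auto simp: square_integrable_def)
  have "complex_of_real ((l2_nrm M w)\<^sup>2) = l2_ip M w w" by (rule l2_ip_self[symmetric])
  also have "\<dots> = l2_ip M (L2_rep (T u)) w - l2_ip M (L2_rep (T v)) w"
    unfolding w_def[abs_def] by (intro l2_ip_diff_left square_integrable_diff L2_rep_sq Tu Tv)
  also have "\<dots> = L2_inner M (T u) (L2_class M w) - L2_inner M (T v) (L2_class M w)"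
    by (simp only: L2_inner_class_right[OF w Tu] L2_inner_class_right[OF w Tv])
  also have "\<dots> = form (\<lambda>x. L2_rep u x - L2_rep v x) (L2_rep (L2_class M w))"
    by (simp only: localization_operator(2)[OF u L2_class_in[OF w]] localization_operator(2)[OF v L2_class_in[OF w]]
        form_diff_left[OF L2_rep_sq[OF u] L2_rep_sq[OF v] wr])
  finally have "cmod (complex_of_real ((l2_nrm M w)\<^sup>2)) \<le> S * l2_nrm M w"
    using form_bound[OF square_integrable_diff[OF L2_rep_sq[OF u] L2_rep_sq[OF v]] wr] by (simp add: S_def nw)
  then have *: "l2_nrm M w * l2_nrm M w \<le> S * l2_nrm M w" by (simp add: power2_eq_square norm_mult)
  have "l2_nrm M w \<le> S"
  proof (cases "l2_nrm M w = 0")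
    case False
    then have "l2_nrm M w > 0" using l2_nrm_nonneg[of M w] by linarith
    with * show ?thesis by simp
  qed (use S in simp)
  then show ?thesis by (simp add: L2_dist_nrm S_def w_def[abs_def])
qed

text \<open>Every sequence in the image of the unit ball has a Cauchy subsequence: along one with
  pointwise convergent transforms, \<open>stft_weighted_Cauchy\<close> makes the differences small
  and \<open>localization_operator_dist\<close> carries this over to T.\<close>

lemma thin_imp_compact:
  assumes thin: "thin M N d \<phi> \<sigma>"
  shows "compact_operator M T"
proof -
  interpret L2: Metric_space "L2 M" "L2_dist M" by (rule Metric_space_L2)
  define B where "B = {u \<in> L2 M. L2_norm M u \<le> 1}"
  have "L2.mtotally_bounded (T ` B)"
    unfolding L2.mtotally_bounded_sequentially
  proof (intro conjI allI impI)
    show "T ` B \<subseteq> L2 M" using localization_operator(1) by (auto simp: B_def)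
    fix s :: "nat \<Rightarrow> 'g l2" assume "range s \<subseteq> T ` B"
    then have "\<forall>n. \<exists>u. u \<in> B \<and> s n = T u" by (auto simp: subset_eq image_iff)
    then obtain u where u: "\<And>n. u n \<in> B" "\<And>n. s n = T (u n)" by metis
    have uL: "u n \<in> L2 M" for n using u(1) by (simp add: B_def)
    have u1: "square_integrable M (L2_rep (u n))" "l2_nrm M (L2_rep (u n)) \<le> 1" for n
      using u(1)[of n] by (simp_all add: B_def L2_rep_sq L2_norm_nrm)
    obtain r where r: "strict_mono (r :: nat \<Rightarrow> nat)" "\<And>z. convergent (\<lambda>n. V (L2_rep (u (r n))) z)"
      by (rule stft_convergent_subsequence[of \<phi>' "\<lambda>n. L2_rep (u n)", OF \<phi>' u1]) blast
    then have lim: "(\<lambda>n. V (L2_rep (u (r n))) z) \<longlonglongrightarrow> lim (\<lambda>n. V (L2_rep (u (r n))) z)" for z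
      by (simp add: convergent_LIMSEQ_iff)
    have th: "\<exists>R. \<forall>w. d 0 w \<ge> R \<longrightarrow> berezin \<phi>' \<sigma> w < ennreal e" if "e > 0" for e
      using thin that unfolding thin_iff[OF \<phi>] by blast
    define A where "A = l2_nrm M \<phi>' + 1"
    have A: "A > 0" "l2_nrm M \<phi>' \<le> A" unfolding A_def by (simp_all add: add_nonneg_pos)
    have "L2.MCauchy (s \<circ> r)"
      unfolding L2.MCauchy_def
    proof (intro conjI allI impI)
      show "range (s \<circ> r) \<subseteq> L2 M" using u localization_operator(1)[OF uL] by auto
      fix e :: real assume e: "e > 0"
      \<comment> \<open>With sqrt e2 = e / (2 A) the distance is at most e/2, hence strictly below
        \<open>e\<close>; \<open>A\<close> exceeds the norm of the window so as to be
        positive.\<close>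
      define e2 where "e2 = (e / (2 * A))\<^sup>2"
      have e2: "e2 > 0" using e A by (simp add: e2_def)
      have "\<exists>n0. \<forall>m\<ge>n0. \<forall>n\<ge>n0. (LINT z|P. \<sigma> z * (cmod (V (\<lambda>x. L2_rep (u (r m)) x - L2_rep (u (r n)) x) z))\<^sup>2) \<le> e2"
        by (rule stft_weighted_Cauchy[of \<phi>' \<sigma> "\<lambda>n. L2_rep (u (r n))", OF \<phi>' \<sigma> th u1 lim e2])
      then obtain n0 where n0: "\<forall>m\<ge>n0. \<forall>n\<ge>n0. (LINT z|P. \<sigma> z * (cmod (V (\<lambda>x. L2_rep (u (r m)) x - L2_rep (u (r n)) x) z))\<^sup>2) \<le> e2"
        by (elim exE)
      have "L2_dist M (s (r m)) (s (r n)) < e" if "m \<ge> n0" "n \<ge> n0" for m n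
      proof -
        have "sqrt (LINT z|P. \<sigma> z * (cmod (V (\<lambda>x. L2_rep (u (r m)) x - L2_rep (u (r n)) x) z))\<^sup>2) \<le> sqrt e2"
          using n0 that by simp
        also have "sqrt e2 = e / (2 * A)" using e A by (simp add: e2_def)
        finally have "L2_dist M (s (r m)) (s (r n)) \<le> e / (2 * A) * A"
          unfolding u(2) using e A
          by (intro order_trans[OF localization_operator_dist[OF uL uL]] mult_mono) auto
        also have "\<dots> < e" using e A by simp
        finally show ?thesis .
      qed
      then show "\<exists>n0. \<forall>n n'. n0 \<le> n \<longrightarrow> n0 \<le> n' \<longrightarrow> L2_dist M ((s \<circ> r) n) ((s \<circ> r) n') < e"
        by (intro exI[of _ n0]) simp
    qed
    with r(1) show "\<exists>r. strict_mono r \<and> L2.MCauchy (s \<circ> r)" by blast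
  qed
  then have "compactin L2.mtopology (L2.mtopology closure_of (T ` B))"
    unfolding L2.mtotally_bounded_eq_compact_closure_of[OF L2_mcomplete] by (rule conjunct2)
  then show ?thesis
    unfolding compact_operator_def B_def using localization_operator_linear by blast
qed

text \<open>If F stays at least e at points w n tending to infinity, compactness lets T of the
  scaled shifts u n converge along a subsequence to some h. The inner product of T (u n) with the
  shift by w n is c F(w n) \<ge> c e, yet it differs little from that of h with the same shift,
  which tends to 0. Weak convergence of the shifts is thus tested only against the one vector
  h.\<close>

lemma compact_imp_thin:
  assumes comp: "compact_operator M T"
  shows "thin M N d \<phi> \<sigma>"
proof (rule ccontr)
  interpret L2: Metric_space "L2 M" "L2_dist M" by (rule Metric_space_L2)
  assume "\<not> thin M N d \<phi> \<sigma>"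
  then have "\<exists>e>0. \<forall>R. \<exists>w. d 0 w \<ge> R \<and> \<not> berezin \<phi>' \<sigma> w < ennreal e"
    unfolding thin_iff[OF \<phi>] by simp
  then obtain e where e: "e > 0" and "\<forall>R. \<exists>w. d 0 w \<ge> R \<and> \<not> berezin \<phi>' \<sigma> w < ennreal e"
    by (elim exE conjE)
  then have "\<forall>n. \<exists>w. d 0 w \<ge> real n \<and> \<not> berezin \<phi>' \<sigma> w < ennreal e" by blast
  then obtain w where w: "\<And>n. d 0 (w n) \<ge> real n" "\<And>n. \<not> berezin \<phi>' \<sigma> (w n) < ennreal e"
    by metis
  define A where "A = l2_nrm M \<phi>'"
  \<comment> \<open>Scales the shifts into the closed unit ball; A + 1 in place of A also covers the
    window 0.\<close>
  define c where "c = 1 / (A + 1)"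
  have A: "A \<ge> 0" by (simp add: A_def)
  have c: "c > 0" "c * A \<le> 1" using A by (simp_all add: c_def)
  define t where "t n = tfs \<phi>' (w n)" for n
  have t: "square_integrable M (t n)" "l2_nrm M (t n) = A" for n
    unfolding t_def A_def using \<phi>' by (simp_all add: tfs_square_integrable tfs_nrm square_integrable_measurable)
  define u where "u n = L2_class M (\<lambda>x. of_real c * t n x)" for n
  have sq: "square_integrable M (\<lambda>x. of_real c * t n x)" for n by (intro square_integrable_scale t)
  have uL: "u n \<in> L2 M" for n unfolding u_def by (rule L2_class_in[OF sq])
  have un: "L2_norm M (u n) \<le> 1" for n
  proof -
    have "L2_norm M (u n) = l2_nrm M (\<lambda>x. of_real c * t n x)"
      unfolding L2_norm_nrm u_def using L2_rep_class[OF sq] sq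
      by (intro l2_nrm_cong_AE) (auto simp: square_integrable_def)
    then show ?thesis using c by (simp add: l2_nrm_scale t)
  qed
  define S where "S = T ` {u \<in> L2 M. L2_norm M u \<le> 1}"
  have SL: "S \<subseteq> L2 M" unfolding S_def using localization_operator(1) by auto
  have TS: "T (u n) \<in> L2.mtopology closure_of S" for n
  proof -
    have "T (u n) \<in> S" unfolding S_def using uL un by blast
    then show ?thesis using closure_of_subset[of S L2.mtopology] SL by auto
  qed
  have "compactin L2.mtopology (L2.mtopology closure_of S)"
    using comp unfolding compact_operator_def S_def by (rule conjunct2)
  then have cs: "\<forall>s. range s \<subseteq> L2.mtopology closure_of S \<longrightarrow>
      (\<exists>l r. l \<in> L2.mtopology closure_of S \<and> strict_mono (r :: nat \<Rightarrow> nat) \<and> limitin L2.mtopology (s \<circ> r) l sequentially)"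
    unfolding L2.compactin_sequentially by (rule conjunct2)
  have "range (\<lambda>n. T (u n)) \<subseteq> L2.mtopology closure_of S" using TS by auto
  then obtain h r where r: "strict_mono (r :: nat \<Rightarrow> nat)" and lim: "limitin L2.mtopology ((\<lambda>n. T (u n)) \<circ> r) h sequentially"
    using cs by metis
  have hL: "h \<in> L2 M" and dist: "(\<lambda>n. L2_dist M (T (u (r n))) h) \<longlonglongrightarrow> 0"
    using lim unfolding L2.limitin_metric_dist_null by (simp_all add: o_def)
  note h = L2_rep_sq[OF hL]
  have big: "c * e \<le> L2_dist M (T (u n)) h * A + cmod (V (L2_rep h) (w n))" for n
  proof -
    define I where "I = (LINT z|P. \<sigma> z * (cmod (V (t n) z))\<^sup>2)"
    have I0: "I \<ge> 0" unfolding I_def using \<sigma>(2) by (intro integral_nonneg_AE AE_I2) simp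
    have "ennreal e \<le> ennreal I"
      using w(2)[of n] unfolding berezin_eq[OF \<phi>' \<sigma>] I_def t_def by simp
    then have eI: "e \<le> I" using I0 by simp
    have Tu: "square_integrable M (L2_rep (T (u n)))" by (rule L2_rep_sq[OF localization_operator(1)[OF uL]])
    have tr: "square_integrable M (L2_rep (L2_class M (t n)))" "AE x in M. L2_rep (L2_class M (t n)) x = t n x"
      using L2_rep_class[OF t(1)] by auto
    have Vtr: "V (L2_rep (L2_class M (t n))) = V (t n)"
      unfolding stft_def[abs_def] using tr t(1)[of n] tfs_square_integrable[OF \<phi>']
      by (intro ext l2_ip_cong_AE) (auto simp: square_integrable_def)
    have "l2_ip M (L2_rep (T (u n))) (t n) = L2_inner M (T (u n)) (L2_class M (t n))"
      by (rule L2_inner_class_right[OF t(1) localization_operator(1)[OF uL], symmetric])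
    also have "\<dots> = form (L2_rep (u n)) (L2_rep (L2_class M (t n)))"
      by (rule localization_operator(2)[OF uL L2_class_in[OF t(1)]])
    also have "\<dots> = form (\<lambda>x. of_real c * t n x) (L2_rep (L2_class M (t n)))"
      unfolding u_def by (rule form_cong_AE[OF L2_rep_class(2)[OF sq] L2_rep_class(1)[OF sq] sq])
    also have "\<dots> = of_real c * form (t n) (t n)"
      unfolding form_scale_left by (simp add: form_def Vtr)
    also have "form (t n) (t n) = of_real I"
    proof -
      have "form (t n) (t n) = (LINT z|P. complex_of_real (\<sigma> z * (cmod (V (t n) z))\<^sup>2))"
        unfolding form_def l2_ip_def
        by (rule Bochner_Integration.integral_cong) (simp_all only: of_real_mult complex_norm_square mult.assoc)
      then show ?thesis by (simp only: integral_complex_of_real I_def)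
    qed
    finally have ip: "l2_ip M (L2_rep (T (u n))) (t n) = of_real (c * I)" by simp
    have "c * e \<le> c * I" using eI c by simp
    also have "\<dots> = cmod (l2_ip M (L2_rep (T (u n))) (t n))" unfolding ip norm_of_real using c I0 by simp
    also have "l2_ip M (L2_rep (T (u n))) (t n) = l2_ip M (\<lambda>x. L2_rep (T (u n)) x - L2_rep h x) (t n) + V (L2_rep h) (w n)"
      unfolding l2_ip_diff_left[OF Tu h t(1)] by (simp add: stft_def t_def)
    also have "cmod \<dots> \<le> cmod (l2_ip M (\<lambda>x. L2_rep (T (u n)) x - L2_rep h x) (t n)) + cmod (V (L2_rep h) (w n))"
      by (rule norm_triangle_ineq)
    also have "cmod (l2_ip M (\<lambda>x. L2_rep (T (u n)) x - L2_rep h x) (t n)) \<le> L2_dist M (T (u n)) h * A"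
      using l2_ip_CS[OF square_integrable_diff[OF Tu h] t(1)[of n]] by (simp add: L2_dist_nrm t)
    finally show ?thesis by simp
  qed
  have "c * e / 2 > 0" using c e by simp
  obtain R where R: "\<forall>z. d 0 z \<ge> R \<longrightarrow> cmod (V (L2_rep h) z) < c * e / 2"
    using stft_vanishes_at_infinity[OF \<phi>' h \<open>c * e / 2 > 0\<close>] by (elim exE)
  have "(\<lambda>n. L2_dist M (T (u (r n))) h * A) \<longlonglongrightarrow> 0" by (rule tendsto_mult_left_zero[OF dist])
  then have "\<forall>\<^sub>F n in sequentially. L2_dist M (T (u (r n))) h * A < c * e / 2"
    using \<open>c * e / 2 > 0\<close> by (rule order_tendstoD(2))
  moreover have "\<forall>\<^sub>F n in sequentially. R \<le> real n"
    using filterlim_real_sequentially by (simp add: filterlim_at_top)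
  ultimately have "\<forall>\<^sub>F n in sequentially. L2_dist M (T (u (r n))) h * A < c * e / 2 \<and> R \<le> real n"
    by (rule eventually_conj)
  then obtain n where n: "L2_dist M (T (u (r n))) h * A < c * e / 2" "R \<le> real n"
    using eventually_happens'[OF sequentially_bot] by blast
  \<comment> \<open>A strictly increasing index satisfies n \<le> r n, so the subsequence also
    leaves every ball.\<close>
  have "real n \<le> real (r n)" using seq_suble[OF r] by simp
  also have "\<dots> \<le> d 0 (w (r n))" by (rule w(1))
  finally have "R \<le> d 0 (w (r n))" using n(2) by simp
  then have "cmod (V (L2_rep h) (w (r n))) < c * e / 2" by (rule R[THEN spec, THEN mp])
  with n(1) big[of "r n"] show False by linarith
qed

end

theorem theorem4:
  fixes M :: "'g::{topological_ab_group_add, t2_space, second_countable_topology} measure"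
    and N :: "'g pontryagin_dual measure"
    and d :: "'g pontryagin_dual \<times> 'g \<Rightarrow> 'g pontryagin_dual \<times> 'g \<Rightarrow> real"
    and \<phi> :: "'g l2"
    and \<sigma> :: "'g pontryagin_dual \<times> 'g \<Rightarrow> real"
  assumes "locally_compact_space (euclidean :: 'g topology)"
    and "\<not> compact (UNIV :: 'g set)"
    and "haar_measure M"
    and "plancherel_measure M N"
    and "proper_invariant_metric d"
    and "\<phi> \<in> L2 M"
    and "\<sigma> \<in> borel_measurable (N \<Otimes>\<^sub>M M)"
    and "\<And>z. \<sigma> z \<in> {0..1}"
  shows "thin M N d \<phi> \<sigma> \<longleftrightarrow> compact_operator M (localization_operator M N \<phi> \<sigma>)"
proof -
  interpret tf_setting M N d using assms(3-5) by (rule tf_setting.intro)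
  interpret localization_setting M N d \<phi> \<sigma>
    by unfold_locales (use assms(6-8) in auto)
  show ?thesis using thin_imp_compact compact_imp_thin by blast
qed

end
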